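(* There exist a two-dimensional regular local ring $R$ with maximal ideal $m_R$ and a graded filtration $\mathcal I=\{I_n\}_{n\in\mathbb N}$ of $m_R$-primary ideals of $R$ such that the ideal $m_RR[\mathcal I]$ of $R[\mathcal I]$ has infinitely many distinct minimal primes, and the scheme $\mathrm{Proj}(R[\mathcal I]/m_RR[\mathcal I])$ is one-dimensional and has infinitely many distinct one-dimensional irreducible components. In particular, the two-dimensional scheme $\mathrm{Proj}(R[\mathcal I])$ is not Noetherian.
   Context: A graded family of ideals in a ring $R$ is a family $\mathcal I=\{I_n\}_{n\in\mathbb N}$ of ideals with $I_0=R$ and $I_mI_n\subset I_{m+n}$ for all $m,n$. A graded filtration is a graded family which moreover satisfies $I_{n+1}\subset I_n$ for all $n$. That it consists of $m_R$-primary ideals means that $I_n$ is $m_R$-primary for every $n>0$. The Rees algebra of $\mathcal I$ is the graded ring $R[\mathcal I]=\bigoplus_{n\ge0}I_n\cong\sum_{n\ge 0}I_nt^n\subset R[t]$. *)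

theory Defs
  imports
    "HOL-Analysis.Abstract_Topology"
    "HOL-Library.Extended_Real"
    "HOL-Computational_Algebra.Formal_Power_Series"
    "HOL-Algebra.UnivPoly"
    "HOL-Algebra.QuotRing"
    "HOL-Algebra.Ideal_Product"
    "HOL-Algebra.Ring_Divisibility"
begin

section \<open>Dimension\<close>

text \<open>Supremum of the lengths \<open>n\<close> of strict chains \<open>c 0 \<subset> \<dots> \<subset> c n\<close> in \<open>F\<close>. The value lies in
  \<^typ>\<open>ereal\<close>, so that the dimension of an empty space (or of the zero ring) is \<open>-\<infinity>\<close>.\<close>

definition chain_dim :: "'a set set \<Rightarrow> ereal" where
  "chain_dim F = (SUP n \<in> {n::nat. \<exists>c. (\<forall>i\<le>n. c i \<in> F) \<and> (\<forall>i<n. c i \<subset> c (Suc i))}. ereal (real n))"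

definition ring_dim :: "('a, 'b) ring_scheme \<Rightarrow> ereal" where
  "ring_dim R = chain_dim {p. primeideal p R}"

definition irreducible_subset :: "'a topology \<Rightarrow> 'a set \<Rightarrow> bool" where
  "irreducible_subset X Z \<longleftrightarrow> Z \<subseteq> topspace X \<and> Z \<noteq> {} \<and>
     (\<forall>C D. closedin X C \<and> closedin X D \<and> Z \<subseteq> C \<union> D \<longrightarrow> Z \<subseteq> C \<or> Z \<subseteq> D)"

definition irreducible_component :: "'a topology \<Rightarrow> 'a set \<Rightarrow> bool" where
  "irreducible_component X Z \<longleftrightarrow> irreducible_subset X Z \<and>
     (\<forall>W. irreducible_subset X W \<and> Z \<subseteq> W \<longrightarrow> W = Z)"

definition space_dim :: "'a topology \<Rightarrow> ereal" where
  "space_dim X = chain_dim {Z. closedin X Z \<and> irreducible_subset X Z}"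


section \<open>Commutative algebra\<close>

definition local_ring :: "('a, 'b) ring_scheme \<Rightarrow> 'a set \<Rightarrow> bool" where
  "local_ring R m \<longleftrightarrow> cring R \<and> {n. maximalideal n R} = {m}"

definition regular_local_ring :: "('a, 'b) ring_scheme \<Rightarrow> 'a set \<Rightarrow> bool" where
  "regular_local_ring R m \<longleftrightarrow> local_ring R m \<and> noetherian_ring R \<and>
     (\<exists>X \<subseteq> carrier R. finite X \<and> m = Idl\<^bsub>R\<^esub> X \<and> ereal (real (card X)) = ring_dim R)"

definition ideal_radical :: "('a, 'b) ring_scheme \<Rightarrow> 'a set \<Rightarrow> 'a set" where
  "ideal_radical R I = {a \<in> carrier R. \<exists>n::nat. a [^]\<^bsub>R\<^esub> n \<in> I}"

definition primary_ideal :: "('a, 'b) ring_scheme \<Rightarrow> 'a set \<Rightarrow> bool" where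
  "primary_ideal R Q \<longleftrightarrow> ideal Q R \<and> Q \<noteq> carrier R \<and>
     (\<forall>a \<in> carrier R. \<forall>b \<in> carrier R. a \<otimes>\<^bsub>R\<^esub> b \<in> Q \<longrightarrow> a \<in> Q \<or> b \<in> ideal_radical R Q)"

definition primary_to :: "('a, 'b) ring_scheme \<Rightarrow> 'a set \<Rightarrow> 'a set \<Rightarrow> bool" where
  "primary_to R p Q \<longleftrightarrow> primary_ideal R Q \<and> ideal_radical R Q = p"

definition minimal_primes :: "('a, 'b) ring_scheme \<Rightarrow> 'a set \<Rightarrow> 'a set set" where
  "minimal_primes R J = {p. primeideal p R \<and> J \<subseteq> p \<and>
     (\<forall>q. primeideal q R \<and> J \<subseteq> q \<and> q \<subseteq> p \<longrightarrow> q = p)}"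


section \<open>Graded families and Rees algebras\<close>

definition graded_family :: "('a, 'b) ring_scheme \<Rightarrow> (nat \<Rightarrow> 'a set) \<Rightarrow> bool" where
  "graded_family R I \<longleftrightarrow> (\<forall>n. ideal (I n) R) \<and> I 0 = carrier R \<and>
     (\<forall>m n. ideal_prod R (I m) (I n) \<subseteq> I (m + n))"

definition graded_filtration :: "('a, 'b) ring_scheme \<Rightarrow> (nat \<Rightarrow> 'a set) \<Rightarrow> bool" where
  "graded_filtration R I \<longleftrightarrow> graded_family R I \<and> (\<forall>n. I (Suc n) \<subseteq> I n)"

definition rees_algebra ::
    "('a, 'b) ring_scheme \<Rightarrow> (nat \<Rightarrow> 'a set) \<Rightarrow> ('a, nat \<Rightarrow> 'a) up_ring" where
  "rees_algebra R I =
     (UP R)\<lparr>carrier := {f \<in> carrier (UP R). \<forall>n. up_ring.coeff (UP R) f n \<in> I n}\<rparr>"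

text \<open>The homogeneous component \<open>I\<^sub>n t\<^sup>n\<close>.\<close>

definition rees_grading ::
    "('a, 'b) ring_scheme \<Rightarrow> (nat \<Rightarrow> 'a set) \<Rightarrow> nat \<Rightarrow> (nat \<Rightarrow> 'a) set" where
  "rees_grading R I n =
     {f \<in> carrier (rees_algebra R I). \<forall>k. k \<noteq> n \<longrightarrow> up_ring.coeff (UP R) f k = \<zero>\<^bsub>R\<^esub>}"

text \<open>The extension \<open>J R[I]\<close> of an ideal \<open>J\<close> of \<open>R\<close>.\<close>

definition rees_extension ::
    "('a, 'b) ring_scheme \<Rightarrow> (nat \<Rightarrow> 'a set) \<Rightarrow> 'a set \<Rightarrow> (nat \<Rightarrow> 'a) set" where
  "rees_extension R I J = Idl\<^bsub>rees_algebra R I\<^esub> ((\<lambda>a. up_ring.monom (UP R) a 0) ` J)"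

definition quotient_grading ::
    "('a, 'b) ring_scheme \<Rightarrow> (nat \<Rightarrow> 'a set) \<Rightarrow> 'a set \<Rightarrow> nat \<Rightarrow> 'a set set" where
  "quotient_grading A G J n = (\<lambda>a. J +>\<^bsub>A\<^esub> a) ` G n"


section \<open>Localization\<close>

text \<open>\<open>fraction A T a s\<close> is the class of the fraction \<open>a/s\<close> in \<open>T\<inverse>A\<close>, as a set of pairs. The operations
  on classes are the unions over all representatives of the classes given by the usual formulas
  (all these classes agree).\<close>

definition fraction :: "('a, 'b) ring_scheme \<Rightarrow> 'a set \<Rightarrow> 'a \<Rightarrow> 'a \<Rightarrow> ('a \<times> 'a) set" where
  "fraction A T a s = {(b, t). b \<in> carrier A \<and> t \<in> T \<and>
     (\<exists>u \<in> T. u \<otimes>\<^bsub>A\<^esub> (a \<otimes>\<^bsub>A\<^esub> t) = u \<otimes>\<^bsub>A\<^esub> (b \<otimes>\<^bsub>A\<^esub> s))}"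

definition fraction_add ::
    "('a, 'b) ring_scheme \<Rightarrow> 'a set \<Rightarrow> ('a \<times> 'a) set \<Rightarrow> ('a \<times> 'a) set \<Rightarrow> ('a \<times> 'a) set" where
  "fraction_add A T x y =
     (\<Union>(a, s) \<in> x. \<Union>(b, t) \<in> y. fraction A T (a \<otimes>\<^bsub>A\<^esub> t \<oplus>\<^bsub>A\<^esub> b \<otimes>\<^bsub>A\<^esub> s) (s \<otimes>\<^bsub>A\<^esub> t))"

definition fraction_mult ::
    "('a, 'b) ring_scheme \<Rightarrow> 'a set \<Rightarrow> ('a \<times> 'a) set \<Rightarrow> ('a \<times> 'a) set \<Rightarrow> ('a \<times> 'a) set" where
  "fraction_mult A T x y = (\<Union>(a, s) \<in> x. \<Union>(b, t) \<in> y. fraction A T (a \<otimes>\<^bsub>A\<^esub> b) (s \<otimes>\<^bsub>A\<^esub> t))"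


section \<open>Ringed spaces, Spec and Proj\<close>

record ('p, 's) ringed_space =
  pts :: "'p topology"
  sections :: "'p set \<Rightarrow> 's ring"
  res :: "'p set \<Rightarrow> 'p set \<Rightarrow> 's \<Rightarrow> 's"

definition open_subspace :: "('p, 's) ringed_space \<Rightarrow> 'p set \<Rightarrow> ('p, 's) ringed_space" where
  "open_subspace X U = X\<lparr>pts := subtopology (pts X) U\<rparr>"

text \<open>An isomorphism of ringed spaces between locally ringed spaces is automatically local, so this
  is also isomorphism of locally ringed spaces.\<close>

definition ringed_space_iso :: "('p, 's) ringed_space \<Rightarrow> ('q, 't) ringed_space \<Rightarrow> bool" where
  "ringed_space_iso X Y \<longleftrightarrow> (\<exists>\<phi> \<psi>. homeomorphic_map (pts X) (pts Y) \<phi> \<and>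
     (\<forall>U. openin (pts X) U \<longrightarrow> \<psi> U \<in> ring_iso (sections X U) (sections Y (\<phi> ` U))) \<and>
     (\<forall>U V. openin (pts X) U \<and> openin (pts X) V \<and> V \<subseteq> U \<longrightarrow>
        (\<forall>s \<in> carrier (sections X U). \<psi> V (res X U V s) = res Y (\<phi> ` U) (\<phi> ` V) (\<psi> U s))))"

text \<open>The sections over \<open>U\<close> of the structure sheaf of \<open>Spec A\<close> and of \<open>Proj A\<close>: families
  \<open>(s q)\<close> for \<open>q \<in> U\<close> with \<open>s q \<in> (T q)\<inverse>A\<close> which locally are of the form \<open>a/f\<close> for a fixed
  admissible pair \<open>(a, f) \<in> F\<close>. The functions take the value \<^const>\<open>undefined\<close> outside \<open>U\<close>, and the
  ring operations are pointwise.\<close>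

definition fraction_sections ::
    "('a, 'b) ring_scheme \<Rightarrow> 'a set topology \<Rightarrow> ('a set \<Rightarrow> 'a set) \<Rightarrow> ('a \<times> 'a) set \<Rightarrow>
     'a set set \<Rightarrow> ('a set \<Rightarrow> ('a \<times> 'a) set) ring" where
  "fraction_sections A X T F U =
     \<lparr>carrier = {s \<in> extensional U. \<forall>p \<in> U. \<exists>V. openin X V \<and> p \<in> V \<and> V \<subseteq> U \<and>
        (\<exists>(a, f) \<in> F. \<forall>q \<in> V. f \<in> T q \<and> s q = fraction A (T q) a f)},
      mult = (\<lambda>s t. \<lambda>q \<in> U. fraction_mult A (T q) (s q) (t q)),
      one = (\<lambda>q \<in> U. fraction A (T q) \<one>\<^bsub>A\<^esub> \<one>\<^bsub>A\<^esub>),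
      zero = (\<lambda>q \<in> U. fraction A (T q) \<zero>\<^bsub>A\<^esub> \<one>\<^bsub>A\<^esub>),
      add = (\<lambda>s t. \<lambda>q \<in> U. fraction_add A (T q) (s q) (t q))\<rparr>"

definition fraction_space ::
    "('a, 'b) ring_scheme \<Rightarrow> 'a set topology \<Rightarrow> ('a set \<Rightarrow> 'a set) \<Rightarrow> ('a \<times> 'a) set \<Rightarrow>
     ('a set, 'a set \<Rightarrow> ('a \<times> 'a) set) ringed_space" where
  "fraction_space A X T F =
     \<lparr>pts = X, sections = fraction_sections A X T F, res = (\<lambda>U V s. restrict s V)\<rparr>"

definition zariski :: "('a, 'b) ring_scheme \<Rightarrow> 'a set topology" where
  "zariski A = topology (\<lambda>U. \<exists>E \<subseteq> carrier A. U = {p. primeideal p A \<and> \<not> E \<subseteq> p})"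

lemma istopology_zariski:
  "istopology (\<lambda>U. \<exists>E \<subseteq> carrier A. U = {p. primeideal p A \<and> \<not> E \<subseteq> p})"
  unfolding istopology_def
proof (intro conjI allI impI)
  fix U V
  assume "\<exists>E\<subseteq>carrier A. U = {p. primeideal p A \<and> \<not> E \<subseteq> p}"
    and "\<exists>E\<subseteq>carrier A. V = {p. primeideal p A \<and> \<not> E \<subseteq> p}"
  then obtain E F where E: "E \<subseteq> carrier A" "U = {p. primeideal p A \<and> \<not> E \<subseteq> p}"
    and F: "F \<subseteq> carrier A" "V = {p. primeideal p A \<and> \<not> F \<subseteq> p}"
    by blast
  let ?P = "{e \<otimes>\<^bsub>A\<^esub> f | e f. e \<in> E \<and> f \<in> F} \<inter> carrier A"
  have "(\<not> E \<subseteq> p \<and> \<not> F \<subseteq> p) \<longleftrightarrow> \<not> ?P \<subseteq> p" if p: "primeideal p A" for p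
  proof -
    interpret primeideal p A by (rule p)
    show ?thesis
    proof
      assume "\<not> E \<subseteq> p \<and> \<not> F \<subseteq> p"
      then obtain e f where "e \<in> E" "e \<notin> p" "f \<in> F" "f \<notin> p"
        by blast
      moreover from this have "e \<otimes>\<^bsub>A\<^esub> f \<notin> p" "e \<otimes>\<^bsub>A\<^esub> f \<in> carrier A"
        using I_prime E(1) F(1) by blast+
      ultimately show "\<not> ?P \<subseteq> p"
        by blast
    next
      assume "\<not> ?P \<subseteq> p"
      then obtain e f where "e \<in> E" "f \<in> F" "e \<otimes>\<^bsub>A\<^esub> f \<notin> p"
        by blast
      then show "\<not> E \<subseteq> p \<and> \<not> F \<subseteq> p"
        using I_l_closed I_r_closed E(1) F(1) by blast
    qed
  qed
  then have "U \<inter> V = {p. primeideal p A \<and> \<not> ?P \<subseteq> p}"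
    using E(2) F(2) by blast
  then show "\<exists>E\<subseteq>carrier A. U \<inter> V = {p. primeideal p A \<and> \<not> E \<subseteq> p}"
    by blast
next
  fix \<K>
  assume *: "\<forall>K\<in>\<K>. \<exists>E\<subseteq>carrier A. K = {p. primeideal p A \<and> \<not> E \<subseteq> p}"
  let ?E = "\<Union>{E. E \<subseteq> carrier A \<and> {p. primeideal p A \<and> \<not> E \<subseteq> p} \<in> \<K>}"
  have "\<Union>\<K> = {p. primeideal p A \<and> \<not> ?E \<subseteq> p}"
  proof
    show "\<Union>\<K> \<subseteq> {p. primeideal p A \<and> \<not> ?E \<subseteq> p}"
    proof
      fix p
      assume "p \<in> \<Union>\<K>"
      then obtain K where K: "K \<in> \<K>" "p \<in> K"
        by blast
      moreover from * K(1) obtain E where "E \<subseteq> carrier A" "K = {p. primeideal p A \<and> \<not> E \<subseteq> p}"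
        by blast
      ultimately show "p \<in> {p. primeideal p A \<and> \<not> ?E \<subseteq> p}"
        by blast
    qed
  qed blast
  then show "\<exists>E\<subseteq>carrier A. \<Union>\<K> = {p. primeideal p A \<and> \<not> E \<subseteq> p}"
    by (intro exI[of _ ?E]) blast
qed

lemma openin_zariski:
  "openin (zariski A) U \<longleftrightarrow> (\<exists>E \<subseteq> carrier A. U = {p. primeideal p A \<and> \<not> E \<subseteq> p})"
  unfolding zariski_def by (simp add: topology_inverse'[OF istopology_zariski])

definition spec_scheme :: "('a, 'b) ring_scheme \<Rightarrow> ('a set, 'a set \<Rightarrow> ('a \<times> 'a) set) ringed_space" where
  "spec_scheme A = fraction_space A (zariski A) (\<lambda>p. carrier A - p) (carrier A \<times> carrier A)"

text \<open>In the following, \<open>A\<close> is a ring graded by the subgroups \<open>G n\<close>.\<close>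

definition homogeneous_ideal :: "('a, 'b) ring_scheme \<Rightarrow> (nat \<Rightarrow> 'a set) \<Rightarrow> 'a set \<Rightarrow> bool" where
  "homogeneous_ideal A G J \<longleftrightarrow> ideal J A \<and> J = Idl\<^bsub>A\<^esub> (J \<inter> (\<Union>n. G n))"

definition proj_points :: "('a, 'b) ring_scheme \<Rightarrow> (nat \<Rightarrow> 'a set) \<Rightarrow> 'a set set" where
  "proj_points A G =
     {p. primeideal p A \<and> homogeneous_ideal A G p \<and> \<not> (\<Union>n\<in>{0<..}. G n) \<subseteq> p}"

text \<open>The stalk at \<open>p\<close> is the degree \<open>0\<close> part of the localization at the homogeneous elements outside
  \<open>p\<close>; this is why numerator and denominator have the same degree.\<close>

definition proj_scheme ::
    "('a, 'b) ring_scheme \<Rightarrow> (nat \<Rightarrow> 'a set) \<Rightarrow> ('a set, 'a set \<Rightarrow> ('a \<times> 'a) set) ringed_space" where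
  "proj_scheme A G = fraction_space A (subtopology (zariski A) (proj_points A G))
     (\<lambda>p. (\<Union>n. G n) - p) (\<Union>n. G n \<times> G n)"

text \<open>The test rings \<open>A\<close> may be taken in the type \<open>'s\<close> of the sections of \<open>X\<close> without loss of
  generality: if \<open>U\<close> is isomorphic to \<open>Spec A\<close>, then \<open>A\<close> is isomorphic to the ring of sections over
  \<open>U\<close>.\<close>

definition locally_noetherian_scheme :: "('p, 's) ringed_space \<Rightarrow> bool" where
  "locally_noetherian_scheme X \<longleftrightarrow> (\<forall>p \<in> topspace (pts X). \<exists>U. openin (pts X) U \<and> p \<in> U \<and>
     (\<exists>A :: 's ring. cring A \<and> noetherian_ring A \<and>
        ringed_space_iso (open_subspace X U) (spec_scheme A)))"

definition noetherian_scheme :: "('p, 's) ringed_space \<Rightarrow> bool" where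
  "noetherian_scheme X \<longleftrightarrow> locally_noetherian_scheme X \<and> compact_space (pts X)"

end

theory Submission
  imports Defs "HOL-Computational_Algebra.Fundamental_Theorem_Algebra"
begin

text \<open>Take \<open>R = \<complex>[[x, y]]\<close> and let \<open>I\<^sub>n\<close> be spanned by the monomials with exponent in \<open>n C\<close>, where \<open>C\<close> is a
  convex region in the quadrant with infinitely many compact edges. Modulo the maximal ideal, a
  monomial \<open>x\<^sup>i y\<^sup>j t\<^sup>n\<close> is nilpotent unless \<open>(i, j)\<close> lies on the boundary of \<open>n C\<close>, and the product of
  two monomials on the boundary is nilpotent unless they lie on a common edge. So each edge
  contributes a minimal prime of the fiber cone with quotient a polynomial ring in two variables: the
  closed fiber is an infinite chain of projective lines, together with a limit point. Each vertex
  gives a closed point with an affine neighbourhood that contains no other vertex point, so Proj is not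
  quasi-compact. Away from the closed fiber the points of Proj are primes of \<open>R\<close>, and no nonzero one
  of these specializes to the generic point of a line, because the local ring there is the
  discrete valuation ring of a monomial valuation.\<close>

section \<open>Chains and dimension\<close>

text \<open>The slopes and vertices are chosen so that two neighbouring vertices, made integral,
  generate all lattice points of the cone over their edge. The edge quotient is then the polynomial
  ring in \<open>vert k\<close> and \<open>vert (Suc k)\<close>, of degrees \<open>2^k\<close> and
  \<open>2^(k+1)\<close>, and the coordinate on its line is
  \<open>vert k ^ 2 / vert (Suc k)\<close>. The obstacle is that dimension and components concern
  all homogeneous primes over the maximal ideal, not just the monomial ones. They are classified by
  the monomials they miss: modulo the maximal ideal a homogeneous element is a finite combination of
  monomials, and a monomial survives only on an edge or as a power of the limit vertex. What remains
  is a prime in two variables, whose forms split over an algebraically closed field; hence the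
  complex coefficients. A closed point of the fiber is recognized by a quotient spanned by powers of
  one element, so that no larger point of Proj exists. Edge primes are minimal among all primes over
  the maximal ideal, which gives the minimal primes of the Rees algebra and the components of the
  fiber at once.\<close>

text \<open>A longer chain has an initial segment of length \<open>Suc n\<close>, so excluding this
  one length is enough.\<close>

lemma chain_dim_eqI:
  assumes c: "\<forall>i\<le>n. c i \<in> F" "\<forall>i<n. c i \<subset> c (Suc i)"
    and no: "\<And>d. \<forall>i\<le>Suc n. d i \<in> F \<Longrightarrow> \<forall>i<Suc n. d i \<subset> d (Suc i) \<Longrightarrow> False"
  shows "chain_dim F = ereal (real n)"
proof -
  have le: "k \<le> n" if d: "\<forall>i\<le>k. d i \<in> F" "\<forall>i<k. d i \<subset> d (Suc i)" for k d
    using no[of d] d by (meson Suc_leI leI order_less_le_trans order_trans)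
  show ?thesis
    unfolding chain_dim_def
    by (rule antisym) (use le c in \<open>auto intro!: SUP_least SUP_upper\<close>)
qed

text \<open>The order-reversing alternative serves the passage between closed irreducible sets and
  their generic points; the chain is then read backwards.\<close>

lemma chain_dim_le:
  assumes "\<And>A. A \<in> F \<Longrightarrow> f A \<in> F'"
    and "(\<forall>A \<in> F. \<forall>B \<in> F. A \<subset> B \<longrightarrow> f A \<subset> f B) \<or>
         (\<forall>A \<in> F. \<forall>B \<in> F. A \<subset> B \<longrightarrow> f B \<subset> f A)"
  shows "chain_dim F \<le> chain_dim F'"
  unfolding chain_dim_def
proof (rule SUP_subset_mono)
  show "{n. \<exists>c. (\<forall>i\<le>n. c i \<in> F) \<and> (\<forall>i<n. c i \<subset> c (Suc i))} \<subseteq>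
    {n. \<exists>c. (\<forall>i\<le>n. c i \<in> F') \<and> (\<forall>i<n. c i \<subset> c (Suc i))}"
  proof (clarify)
    fix n c
    assume c: "\<forall>i\<le>n. c i \<in> F" "\<forall>i<n. c i \<subset> c (Suc i)"
    from assms(2) show "\<exists>c. (\<forall>i\<le>n. c i \<in> F') \<and> (\<forall>i<n. c i \<subset> c (Suc i))"
    proof
      assume "\<forall>A \<in> F. \<forall>B \<in> F. A \<subset> B \<longrightarrow> f A \<subset> f B"
      then show ?thesis
        using c assms(1) by (intro exI[of _ "\<lambda>i. f (c i)"]) auto
    next
      assume anti: "\<forall>A \<in> F. \<forall>B \<in> F. A \<subset> B \<longrightarrow> f B \<subset> f A"
      have "f (c (n - i)) \<subset> f (c (n - Suc i))" if "i < n" for i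
      proof -
        have "n - i = Suc (n - Suc i)" "n - Suc i < n"
          using that by auto
        then show ?thesis
          using c anti by (metis diff_le_self)
      qed
      then show ?thesis
        using c assms(1) by (intro exI[of _ "\<lambda>i. f (c (n - i))"]) auto
    qed
  qed
qed simp

lemma chain_dim_embedding:
  assumes f: "\<And>A B. A \<in> F \<Longrightarrow> B \<in> F \<Longrightarrow> f A \<subseteq> f B \<longleftrightarrow> A \<subseteq> B"
  shows "chain_dim (f ` F) = chain_dim F"
proof (rule antisym)
  have less: "f A \<subset> f B \<longleftrightarrow> A \<subset> B" if "A \<in> F" "B \<in> F" for A B
    using f[OF that] f[OF that(2,1)] by (simp add: less_le_not_le)
  then show "chain_dim F \<le> chain_dim (f ` F)"
    by (intro chain_dim_le[where f = f]) auto
  have inv: "inv_into F f (f A) = A" if "A \<in> F" for A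
    using f that by (intro inv_into_f_f inj_onI) (auto intro: subset_antisym)
  show "chain_dim (f ` F) \<le> chain_dim F"
    by (rule chain_dim_le[where f = "inv_into F f"]) (auto simp: inv less)
qed

section \<open>Spaces of prime ideals\<close>

lemma topspace_zariski:
  assumes "ring A"
  shows "topspace (zariski A) = {p. primeideal p A}"
proof
  show "topspace (zariski A) \<subseteq> {p. primeideal p A}"
    using openin_topspace[of "zariski A"] unfolding openin_zariski by auto
  have "openin (zariski A) {p. primeideal p A}"
    unfolding openin_zariski
  proof (intro exI conjI)
    show "{p. primeideal p A} = {p. primeideal p A \<and> \<not> carrier A \<subseteq> p}"
      using primeideal.I_notcarr additive_subgroup.a_subset ideal.axioms(1) primeideal.axioms(1) by blast
  qed simp
  then show "{p. primeideal p A} \<subseteq> topspace (zariski A)"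
    by (rule openin_subset)
qed

text \<open>Covers Proj and the closure of a point in it. The last assumption says that generic
  points exist: the intersection of an irreducible set of points is prime and has to be a point
  again.\<close>

locale prime_space =
  fixes A :: "('a, 'b) ring_scheme" and PP :: "'a set set"
  assumes cring: "cring A"
    and primes: "p \<in> PP \<Longrightarrow> primeideal p A"
    and Inter: "Z \<subseteq> PP \<Longrightarrow> Z \<noteq> {} \<Longrightarrow> primeideal (\<Inter>Z) A \<Longrightarrow> \<Inter>Z \<in> PP"
begin

abbreviation "X \<equiv> subtopology (zariski A) PP"

lemma topspace: "topspace X = PP"
  using primes topspace_zariski[OF cring.axioms(1)[OF cring]] by auto

lemma subset_carrier: "p \<in> PP \<Longrightarrow> p \<subseteq> carrier A"
  using primes by (meson additive_subgroup.a_subset ideal_def primeideal_def)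

lemma openin_iff: "openin X U \<longleftrightarrow> (\<exists>E \<subseteq> carrier A. U = {p \<in> PP. \<not> E \<subseteq> p})"
proof
  assume "openin X U"
  then obtain E where "E \<subseteq> carrier A" "U = {p. primeideal p A \<and> \<not> E \<subseteq> p} \<inter> PP"
    unfolding openin_subtopology openin_zariski by blast
  then show "\<exists>E \<subseteq> carrier A. U = {p \<in> PP. \<not> E \<subseteq> p}"
    using primes by (intro exI[of _ E]) auto
next
  assume "\<exists>E \<subseteq> carrier A. U = {p \<in> PP. \<not> E \<subseteq> p}"
  then obtain E where "E \<subseteq> carrier A" "U = {p \<in> PP. \<not> E \<subseteq> p}"
    by blast
  then show "openin X U"
    unfolding openin_subtopology openin_zariski using primes
    by (intro exI[of _ "{p. primeideal p A \<and> \<not> E \<subseteq> p}"]) auto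
qed

lemma closedin_iff: "closedin X C \<longleftrightarrow> (\<exists>E \<subseteq> carrier A. C = {p \<in> PP. E \<subseteq> p})"
proof
  assume "closedin X C"
  then obtain E where "C \<subseteq> PP" "E \<subseteq> carrier A" "PP - C = {p \<in> PP. \<not> E \<subseteq> p}"
    unfolding closedin_def topspace openin_iff by blast
  then show "\<exists>E \<subseteq> carrier A. C = {p \<in> PP. E \<subseteq> p}"
    by (intro exI[of _ E]) auto
next
  assume "\<exists>E \<subseteq> carrier A. C = {p \<in> PP. E \<subseteq> p}"
  then obtain E where E: "E \<subseteq> carrier A" "C = {p \<in> PP. E \<subseteq> p}"
    by blast
  then have "PP - C = {p \<in> PP. \<not> E \<subseteq> p}"
    by auto
  then show "closedin X C"
    unfolding closedin_def topspace openin_iff using E by auto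
qed

text \<open>If \<open>a * b\<close> lies in every member of \<open>Z\<close>, then \<open>Z\<close>
  is covered by the zero sets of \<open>a\<close> and \<open>b\<close>, and irreducibility picks one
  of them.\<close>

lemma irreducible_Inter:
  assumes "irreducible_subset X Z"
  shows "\<Inter>Z \<in> PP"
proof (rule Inter)
  show Z: "Z \<subseteq> PP" "Z \<noteq> {}"
    using assms unfolding irreducible_subset_def topspace by auto
  interpret cring A by (rule cring)
  have id: "ideal (\<Inter>Z) A"
    using Z primes by (intro i_Intersect) (auto dest: primeideal.axioms(1))
  obtain p where p: "p \<in> Z"
    using Z by blast
  show "primeideal (\<Inter>Z) A"
  proof (rule primeidealI[OF id cring])
    show "carrier A \<noteq> \<Inter>Z"
    proof
      assume "carrier A = \<Inter>Z"
      then have "carrier A = p"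
        using p subset_carrier Z by blast
      then show False
        using primeideal.I_notcarr p primes Z by blast
    qed
    fix a b
    assume ab: "a \<in> carrier A" "b \<in> carrier A" "a \<otimes>\<^bsub>A\<^esub> b \<in> \<Inter>Z"
    let ?V = "\<lambda>a. {p \<in> PP. {a} \<subseteq> p}"
    have "Z \<subseteq> ?V a \<union> ?V b"
    proof
      fix p assume "p \<in> Z"
      then show "p \<in> ?V a \<union> ?V b"
        using ab primeideal.I_prime[of p A a b] primes Z by blast
    qed
    moreover have "closedin X (?V a)" "closedin X (?V b)"
      unfolding closedin_iff using ab by blast+
    ultimately have "Z \<subseteq> ?V a \<or> Z \<subseteq> ?V b"
      using assms unfolding irreducible_subset_def by blast
    then show "a \<in> \<Inter>Z \<or> b \<in> \<Inter>Z"
      by blast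
  qed
qed

lemma closed_irreducible:
  assumes "p \<in> PP"
  shows "closedin X {q \<in> PP. p \<subseteq> q}" "irreducible_subset X {q \<in> PP. p \<subseteq> q}"
proof -
  show "closedin X {q \<in> PP. p \<subseteq> q}"
    unfolding closedin_iff using subset_carrier[OF assms] by blast
  show "irreducible_subset X {q \<in> PP. p \<subseteq> q}"
    unfolding irreducible_subset_def topspace
  proof (intro conjI allI impI)
    fix C D
    assume *: "closedin X C \<and> closedin X D \<and> {q \<in> PP. p \<subseteq> q} \<subseteq> C \<union> D"
    have up: "{q \<in> PP. p \<subseteq> q} \<subseteq> C" if C: "closedin X C" "p \<in> C" for C
      using C unfolding closedin_iff by blast
    have "p \<in> C \<union> D"
      using * assms by blast
    then show "{q \<in> PP. p \<subseteq> q} \<subseteq> C \<or> {q \<in> PP. p \<subseteq> q} \<subseteq> D"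
      using * up by blast
  qed (use assms in auto)
qed

lemma closed_irreducible_eq:
  assumes "closedin X Z" "irreducible_subset X Z"
  shows "Z = {q \<in> PP. \<Inter>Z \<subseteq> q}"
proof -
  obtain E where "Z = {p \<in> PP. E \<subseteq> p}"
    using assms(1) unfolding closedin_iff by blast
  then show ?thesis
    by blast
qed

text \<open>Closed irreducible sets and points correspond by taking the generic point and the
  closure, with inclusions reversed.\<close>

lemma space_dim: "space_dim X = chain_dim PP"
proof (rule antisym)
  show "space_dim X \<le> chain_dim PP"
    unfolding space_dim_def
  proof (rule chain_dim_le[where f = "\<lambda>Z. \<Inter>Z"], goal_cases)
    case 2
    show ?case
    proof (intro disjI2 ballI impI)
      fix Y Z
      assume "Y \<in> {Z. closedin X Z \<and> irreducible_subset X Z}"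
        "Z \<in> {Z. closedin X Z \<and> irreducible_subset X Z}" "Y \<subset> Z"
      then show "\<Inter>Z \<subset> \<Inter>Y"
        using closed_irreducible_eq[of Y] closed_irreducible_eq[of Z] by auto
    qed
  qed (use irreducible_Inter in auto)
  show "chain_dim PP \<le> space_dim X"
    unfolding space_dim_def
    by (rule chain_dim_le[where f = "\<lambda>p. {q \<in> PP. p \<subseteq> q}"]) (use closed_irreducible in auto)
qed

lemma space_dim_closure:
  assumes "p \<in> PP"
  shows "space_dim (subtopology X {q \<in> PP. p \<subseteq> q}) = chain_dim {q \<in> PP. p \<subseteq> q}"
proof -
  interpret V: prime_space A "{q \<in> PP. p \<subseteq> q}"
  proof (rule prime_space.intro[OF cring])
    fix Z assume "Z \<subseteq> {q \<in> PP. p \<subseteq> q}" "Z \<noteq> {}" "primeideal (\<Inter>Z) A"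
    then show "\<Inter>Z \<in> {q \<in> PP. p \<subseteq> q}"
      using Inter[of Z] by auto
  qed (use primes in auto)
  have "PP \<inter> {q \<in> PP. p \<subseteq> q} = {q \<in> PP. p \<subseteq> q}"
    by auto
  then show ?thesis
    using V.space_dim by (simp add: subtopology_subtopology)
qed

text \<open>The generic point of a larger irreducible set is contained in \<open>p\<close>, so
  minimality identifies the two.\<close>

lemma irreducible_component_minimal:
  assumes p: "p \<in> PP" and min: "\<And>q. q \<in> PP \<Longrightarrow> q \<subseteq> p \<Longrightarrow> q = p"
  shows "irreducible_component X {q \<in> PP. p \<subseteq> q}"
  unfolding irreducible_component_def
proof (intro conjI allI impI)
  fix W
  assume W: "irreducible_subset X W \<and> {q \<in> PP. p \<subseteq> q} \<subseteq> W"
  then have "\<Inter>W \<in> PP" "\<Inter>W \<subseteq> p" "W \<subseteq> PP"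
    using irreducible_Inter p by (auto simp: irreducible_subset_def topspace)
  with min have "\<Inter>W = p" "W \<subseteq> PP"
    by blast+
  then show "W = {q \<in> PP. p \<subseteq> q}"
    using W by auto
qed (rule closed_irreducible[OF p])

end

section \<open>Proj of a quotient\<close>

text \<open>Identifies Proj of the quotient with the points of Proj that contain \<open>J\<close>,
  respecting inclusion, so that the fiber can be studied inside the Rees algebra.\<close>

locale graded_quotient =
  fixes A :: "('a, 'b) ring_scheme" and G :: "nat \<Rightarrow> 'a set" and J :: "'a set"
  assumes cring: "cring A" and G: "G n \<subseteq> carrier A" and J: "homogeneous_ideal A G J"
begin

sublocale A: cring A by (rule cring)

lemma ideal_J: "ideal J A"
  using J unfolding homogeneous_ideal_def by blast

sublocale J: ideal J A by (rule ideal_J)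

abbreviation "B \<equiv> A Quot J"
abbreviation "GB \<equiv> quotient_grading A G J"
abbreviation "\<pi> a \<equiv> J +>\<^bsub>A\<^esub> a"

sublocale B: cring B
  by (rule J.quotient_is_cring[OF cring])

sublocale \<pi>: ring_hom_ring A B "\<pi>"
  by (rule J.rcos_ring_hom_ring)

lemma carrier_B: "carrier B = \<pi> ` carrier A"
  unfolding FactRing_def A_RCOSETS_def' by auto

lemma \<pi>_mem_image:
  assumes "ideal P A" "J \<subseteq> P" "a \<in> carrier A" "\<pi> a \<in> \<pi> ` P"
  shows "a \<in> P"
proof -
  obtain b where b: "b \<in> P" "\<pi> a = \<pi> b"
    using assms(4) by blast
  interpret P: ideal P A by (rule assms(1))
  have "b \<in> carrier A"
    using b P.a_Hcarr by blast
  have "a \<ominus>\<^bsub>A\<^esub> b \<in> J"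
    using b(2) A.quotient_eq_iff_same_a_r_cos[OF ideal_J assms(3) \<open>b \<in> carrier A\<close>] by simp
  then have "a \<ominus>\<^bsub>A\<^esub> b \<oplus>\<^bsub>A\<^esub> b \<in> P"
    using assms(2) b P.a_closed by blast
  then show ?thesis
    using assms(3) \<open>b \<in> carrier A\<close> by (simp add: A.minus_eq A.a_assoc A.l_neg)
qed

lemma preimage_ideal:
  assumes "ideal p B"
  shows "ideal {a \<in> carrier A. \<pi> a \<in> p} A" "J \<subseteq> {a \<in> carrier A. \<pi> a \<in> p}"
    "\<pi> ` {a \<in> carrier A. \<pi> a \<in> p} = p"
proof -
  interpret p: ideal p B by (rule assms)
  show "ideal {a \<in> carrier A. \<pi> a \<in> p} A"
    by (rule \<pi>.ideal_vimage[OF assms])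
  show "J \<subseteq> {a \<in> carrier A. \<pi> a \<in> p}"
  proof
    fix a assume "a \<in> J"
    then have "a \<in> carrier A" "\<pi> a = \<zero>\<^bsub>B\<^esub>"
      using J.a_Hcarr J.a_rcos_const unfolding FactRing_def by simp_all
    then show "a \<in> {a \<in> carrier A. \<pi> a \<in> p}"
      using p.zero_closed by simp
  qed
  show "\<pi> ` {a \<in> carrier A. \<pi> a \<in> p} = p"
    using p.a_subset unfolding carrier_B by blast
qed

lemma image_ideal:
  assumes "ideal P A"
  shows "ideal (\<pi> ` P) B"
proof -
  interpret P: ideal P A by (rule assms)
  have sub: "P \<subseteq> carrier A"
    by (rule P.a_subset)
  show ?thesis
  proof (rule idealI[OF B.ring_axioms])
    show "subgroup (\<pi> ` P) (add_monoid B)"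
      by (intro group_hom.subgroup_img_is_subgroup[OF \<pi>.a_group_hom] P.a_subgroup)
    fix a x assume "a \<in> \<pi> ` P" "x \<in> carrier B"
    then obtain b y where "b \<in> P" "a = \<pi> b" "y \<in> carrier A" "x = \<pi> y"
      unfolding carrier_B by blast
    moreover from this have "b \<in> carrier A"
      using sub by blast
    ultimately have "x \<otimes>\<^bsub>B\<^esub> a = \<pi> (y \<otimes>\<^bsub>A\<^esub> b)" "a \<otimes>\<^bsub>B\<^esub> x = \<pi> (b \<otimes>\<^bsub>A\<^esub> y)"
      "y \<otimes>\<^bsub>A\<^esub> b \<in> P" "b \<otimes>\<^bsub>A\<^esub> y \<in> P"
      using \<open>b \<in> P\<close> P.I_l_closed P.I_r_closed \<pi>.hom_mult by simp_all
    then show "x \<otimes>\<^bsub>B\<^esub> a \<in> \<pi> ` P" "a \<otimes>\<^bsub>B\<^esub> x \<in> \<pi> ` P"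
      by simp_all
  qed
qed

lemma image_preimage_prime:
  assumes "primeideal p B"
  shows "primeideal {a \<in> carrier A. \<pi> a \<in> p} A"
  by (rule \<pi>.primeideal_vimage[OF cring assms])

lemma image_prime:
  assumes "primeideal P A" "J \<subseteq> P"
  shows "primeideal (\<pi> ` P) B"
proof (rule primeidealI[OF image_ideal B.is_cring])
  show "ideal P A"
    using assms by (simp add: primeideal_def)
  note mem = \<pi>_mem_image[OF this assms(2)]
  show "carrier B \<noteq> \<pi> ` P"
  proof
    assume "carrier B = \<pi> ` P"
    then have "\<one>\<^bsub>A\<^esub> \<in> P"
      using mem[OF A.one_closed] \<pi>.hom_closed[OF A.one_closed] by simp
    then show False
      using ideal.one_imp_carrier[OF primeideal.axioms(1)[OF assms(1)]]
        primeideal.I_notcarr[OF assms(1)] by simp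
  qed
  fix x y assume *: "x \<in> carrier B" "y \<in> carrier B" "x \<otimes>\<^bsub>B\<^esub> y \<in> \<pi> ` P"
  then obtain a b where ab: "a \<in> carrier A" "x = \<pi> a" "b \<in> carrier A" "y = \<pi> b"
    unfolding carrier_B by blast
  then have "a \<otimes>\<^bsub>A\<^esub> b \<in> P"
    using * mem[OF A.m_closed[OF ab(1,3)]] \<pi>.hom_mult[OF ab(1,3)] by simp
  then show "x \<in> \<pi> ` P \<or> y \<in> \<pi> ` P"
    using ab primeideal.I_prime[OF assms(1)] by blast
qed

lemma GB: "GB n = \<pi> ` G n"
  by (simp add: quotient_grading_def)

lemma image_homogeneous:
  assumes "homogeneous_ideal A G P"
  shows "homogeneous_ideal B GB (\<pi> ` P)"
proof -
  have P: "ideal P A" "P = Idl\<^bsub>A\<^esub> (P \<inter> (\<Union>n. G n))"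
    using assms unfolding homogeneous_ideal_def by blast+
  interpret P: ideal P A by (rule P)
  have id: "ideal (\<pi> ` P) B"
    by (rule image_ideal[OF P(1)])
  let ?E = "\<pi> ` P \<inter> (\<Union>n. GB n)"
  have E: "?E \<subseteq> carrier B"
    using ideal.Icarr[OF id] by blast
  let ?K = "Idl\<^bsub>B\<^esub> ?E"
  have K: "ideal ?K B"
    by (rule B.genideal_ideal[OF E])
  have "P \<inter> (\<Union>n. G n) \<subseteq> {a \<in> carrier A. \<pi> a \<in> ?K}"
    using B.genideal_self[OF E] P.Icarr by (auto simp: GB)
  then have "P \<subseteq> {a \<in> carrier A. \<pi> a \<in> ?K}"
    by (subst P(2)) (rule A.genideal_minimal[OF preimage_ideal(1)[OF K]])
  moreover have "?K \<subseteq> \<pi> ` P"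
    by (rule B.genideal_minimal[OF id]) blast
  ultimately have "\<pi> ` P = ?K"
    by blast
  then show ?thesis
    using id unfolding homogeneous_ideal_def by blast
qed

text \<open>As \<open>J\<close> is generated by homogeneous elements, it lies in the ideal
  \<open>?K\<close> generated by the homogeneous elements of the preimage. Hence \<open>?K\<close>
  is determined by its image in the quotient, and it suffices to compare images.\<close>

lemma preimage_homogeneous:
  assumes "homogeneous_ideal B GB p"
  shows "homogeneous_ideal A G {a \<in> carrier A. \<pi> a \<in> p}"
proof -
  define P where "P = {a \<in> carrier A. \<pi> a \<in> p}"
  have p: "ideal p B" "p = Idl\<^bsub>B\<^esub> (p \<inter> (\<Union>n. GB n))"
    using assms unfolding homogeneous_ideal_def by blast+
  have P: "ideal P A" "J \<subseteq> P" "\<pi> ` P = p"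
    unfolding P_def by (rule preimage_ideal[OF p(1)])+
  let ?E = "P \<inter> (\<Union>n. G n)"
  have E: "?E \<subseteq> carrier A"
    by (auto simp: P_def)
  let ?K = "Idl\<^bsub>A\<^esub> ?E"
  have K: "ideal ?K A"
    by (rule A.genideal_ideal[OF E])
  have "J \<inter> (\<Union>n. G n) \<subseteq> ?K"
    using A.genideal_self[OF E] P(2) by blast
  then have JK: "J \<subseteq> ?K"
    using J A.genideal_minimal[OF K] by (metis homogeneous_ideal_def)
  have "p \<inter> (\<Union>n. GB n) \<subseteq> \<pi> ` ?K"
  proof
    fix x assume "x \<in> p \<inter> (\<Union>n. GB n)"
    then obtain g n where "g \<in> G n" "x = \<pi> g" "\<pi> g \<in> p"
      by (auto simp: GB)
    then have "g \<in> ?E"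
      using G by (auto simp: P_def)
    then show "x \<in> \<pi> ` ?K"
      using A.genideal_self[OF E] \<open>x = \<pi> g\<close> by blast
  qed
  then have "p \<subseteq> \<pi> ` ?K"
    using B.genideal_minimal[OF image_ideal[OF K]] p(2) by metis
  then have "P \<subseteq> ?K"
    using \<pi>_mem_image[OF K JK] by (auto simp: P_def)
  moreover have "?K \<subseteq> P"
    by (rule A.genideal_minimal[OF P(1)]) blast
  ultimately show ?thesis
    using P(1) unfolding P_def[symmetric] homogeneous_ideal_def by blast
qed

lemma image_proj_points:
  assumes "P \<in> proj_points A G" "J \<subseteq> P"
  shows "\<pi> ` P \<in> proj_points B GB"
proof -
  have P: "primeideal P A" "homogeneous_ideal A G P" "\<not> (\<Union>n\<in>{0<..}. G n) \<subseteq> P"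
    using assms by (auto simp: proj_points_def)
  then obtain n g where "n > 0" "g \<in> G n" "g \<notin> P"
    by auto
  then have "\<pi> g \<notin> \<pi> ` P" "\<pi> g \<in> GB n"
    using \<pi>_mem_image[OF primeideal.axioms(1)[OF P(1)] assms(2)] G by (auto simp: GB)
  then show ?thesis
    using P \<open>n > 0\<close> image_prime[OF P(1) assms(2)] image_homogeneous
    by (auto simp: proj_points_def)
qed

lemma preimage_proj_points:
  assumes "p \<in> proj_points B GB"
  shows "{a \<in> carrier A. \<pi> a \<in> p} \<in> proj_points A G"
  using assms image_preimage_prime preimage_homogeneous
  by (fastforce simp: proj_points_def GB)

lemma preimage_image:
  assumes "P \<in> proj_points A G" "J \<subseteq> P"
  shows "{a \<in> carrier A. \<pi> a \<in> \<pi> ` P} = P"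
proof -
  have P: "ideal P A"
    using assms primeideal.axioms(1) unfolding proj_points_def by blast
  show ?thesis
    using \<pi>_mem_image[OF P assms(2)] ideal.Icarr[OF P] by auto
qed

lemma proj_points_ideal: "p \<in> proj_points B GB \<Longrightarrow> ideal p B"
  unfolding proj_points_def using primeideal.axioms(1) by blast

lemma proj_points_image_iff:
  "p \<in> proj_points B GB \<longleftrightarrow> (\<exists>P \<in> proj_points A G. J \<subseteq> P \<and> p = \<pi> ` P)"
proof
  assume p: "p \<in> proj_points B GB"
  then show "\<exists>P \<in> proj_points A G. J \<subseteq> P \<and> p = \<pi> ` P"
    using preimage_proj_points[OF p] preimage_ideal[OF proj_points_ideal[OF p]]
    by (intro bexI[of _ "{a \<in> carrier A. \<pi> a \<in> p}"]) auto
qed (use image_proj_points in blast)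

lemma image_subset_iff:
  assumes "P \<in> proj_points A G" "J \<subseteq> P" "Q \<in> proj_points A G" "J \<subseteq> Q"
  shows "\<pi> ` P \<subseteq> \<pi> ` Q \<longleftrightarrow> P \<subseteq> Q"
proof
  assume "\<pi> ` P \<subseteq> \<pi> ` Q"
  then have "{a \<in> carrier A. \<pi> a \<in> \<pi> ` P} \<subseteq> {a \<in> carrier A. \<pi> a \<in> \<pi> ` Q}"
    by (intro Collect_mono) auto
  then show "P \<subseteq> Q"
    unfolding preimage_image[OF assms(1,2)] preimage_image[OF assms(3,4)] .
qed (rule image_mono)

lemma prime_space_quotient:
  assumes "prime_space A (proj_points A G)"
  shows "prime_space B (proj_points B GB)"
proof (rule prime_space.intro[OF B.is_cring])
  fix Z assume Z: "Z \<subseteq> proj_points B GB" "Z \<noteq> {}" "primeideal (\<Inter>Z) B"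
  let ?f = "\<lambda>p. {a \<in> carrier A. \<pi> a \<in> p}"
  have "?f (\<Inter>Z) = \<Inter>(?f ` Z)"
    using Z(2) by auto
  moreover have "\<Inter>(?f ` Z) \<in> proj_points A G"
  proof (rule prime_space.Inter[OF assms])
    show "?f ` Z \<subseteq> proj_points A G"
      using preimage_proj_points subsetD[OF Z(1)] by (intro image_subsetI) simp
    show "primeideal (\<Inter>(?f ` Z)) A"
      using image_preimage_prime[OF Z(3)] \<open>?f (\<Inter>Z) = \<Inter>(?f ` Z)\<close> by simp
  qed (use Z in auto)
  ultimately have "?f (\<Inter>Z) \<in> proj_points A G"
    by simp
  from image_proj_points[OF this preimage_ideal(2)[OF primeideal.axioms(1)[OF Z(3)]]]
  show "\<Inter>Z \<in> proj_points B GB"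
    unfolding preimage_ideal(3)[OF primeideal.axioms(1)[OF Z(3)]] .
qed (simp add: proj_points_def)

end

section \<open>Rings represented inside a type of class \<open>comm_ring_1\<close>\<close>

text \<open>Ideals of a subring \<open>T\<close> as plain sets in a type, so that type class
  arithmetic applies. Closure under subtraction follows once \<open>-1\<close> lies in
  \<open>T\<close>.\<close>

definition ideal_in :: "'a::comm_ring_1 set \<Rightarrow> 'a set \<Rightarrow> bool" where
  "ideal_in T P \<longleftrightarrow> P \<subseteq> T \<and> 0 \<in> P \<and> (\<forall>a\<in>P. \<forall>b\<in>P. a + b \<in> P) \<and> (\<forall>a\<in>T. \<forall>b\<in>P. a * b \<in> P)"

definition prime_in :: "'a::comm_ring_1 set \<Rightarrow> 'a set \<Rightarrow> bool" where
  "prime_in T P \<longleftrightarrow> ideal_in T P \<and> 1 \<notin> P \<and> (\<forall>a\<in>T. \<forall>b\<in>T. a * b \<in> P \<longrightarrow> a \<in> P \<or> b \<in> P)"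

lemma ideal_inD:
  assumes "ideal_in T P"
  shows "P \<subseteq> T" "0 \<in> P" "a \<in> P \<Longrightarrow> b \<in> P \<Longrightarrow> a + b \<in> P" "a \<in> T \<Longrightarrow> b \<in> P \<Longrightarrow> a * b \<in> P"
    "a \<in> T \<Longrightarrow> b \<in> P \<Longrightarrow> b * a \<in> P"
  using assms by (auto simp: ideal_in_def mult.commute)

lemma ideal_in_sum: "ideal_in T P \<Longrightarrow> (\<And>i. i \<in> S \<Longrightarrow> f i \<in> P) \<Longrightarrow> sum f S \<in> P"
  by (induction S rule: infinite_finite_induct) (auto dest: ideal_inD)

lemma prime_inD:
  assumes "prime_in T P"
  shows "ideal_in T P" "1 \<notin> P" "a \<in> T \<Longrightarrow> b \<in> T \<Longrightarrow> a * b \<in> P \<Longrightarrow> a \<in> P \<or> b \<in> P"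
  using assms by (auto simp: prime_in_def)

text \<open>Transfers ideals and primes between a ring with carrier and a subring of a type. Its two
  instances are the power series ring, with \<open>id\<close>, and the Rees algebra inside the
  polynomials over it, with \<open>coeff\<close>.\<close>

locale concrete_ring =
  fixes A :: "('b, 'c) ring_scheme" and \<phi> :: "'a::comm_ring_1 \<Rightarrow> 'b" and T :: "'a set"
  assumes inj: "inj \<phi>"
    and carrier: "carrier A = \<phi> ` T"
    and T: "0 \<in> T" "1 \<in> T" "x \<in> T \<Longrightarrow> y \<in> T \<Longrightarrow> x + y \<in> T" "x \<in> T \<Longrightarrow> y \<in> T \<Longrightarrow> x * y \<in> T"
      "x \<in> T \<Longrightarrow> - x \<in> T"
    and \<phi>: "\<zero>\<^bsub>A\<^esub> = \<phi> 0" "\<one>\<^bsub>A\<^esub> = \<phi> 1" "x \<in> T \<Longrightarrow> y \<in> T \<Longrightarrow> \<phi> x \<oplus>\<^bsub>A\<^esub> \<phi> y = \<phi> (x + y)"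
      "x \<in> T \<Longrightarrow> y \<in> T \<Longrightarrow> \<phi> x \<otimes>\<^bsub>A\<^esub> \<phi> y = \<phi> (x * y)"
begin

lemma mem_iff [simp]: "\<phi> x \<in> \<phi> ` P \<longleftrightarrow> x \<in> P"
  using inj by (auto simp: inj_def)

lemma T_power: "x \<in> T \<Longrightarrow> x ^ n \<in> T"
  by (induction n) (auto simp: T)

lemma T_diff: "x \<in> T \<Longrightarrow> y \<in> T \<Longrightarrow> x - y \<in> T"
  using T(3)[of x "- y"] T(5)[of y] by simp

lemma ideal_diff:
  assumes "ideal_in T P" "a \<in> P" "b \<in> P"
  shows "a - b \<in> P"
proof -
  have "- b \<in> P"
    using ideal_inD(4)[OF assms(1), of "-1" b] T(2,5) assms by simp
  then show ?thesis
    using ideal_inD(3)[OF assms(1,2), of "-b"] by simp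
qed

lemma prime_power:
  assumes "prime_in T P" "a \<in> T" "a ^ n \<in> P"
  shows "a \<in> P"
  using assms(3)
proof (induction n)
  case (Suc n)
  then show ?case
    using prime_inD(3)[OF assms(1,2) T_power[OF assms(2)], of n] by auto
qed (use prime_inD(2)[OF assms(1)] in simp)

lemma cring: "cring A"
proof (rule cringI)
  show "abelian_group A"
  proof (rule abelian_groupI)
    fix x assume "x \<in> carrier A"
    then obtain a where "a \<in> T" "x = \<phi> a"
      unfolding carrier by blast
    then show "\<exists>y\<in>carrier A. y \<oplus>\<^bsub>A\<^esub> x = \<zero>\<^bsub>A\<^esub>"
      by (intro bexI[of _ "\<phi> (- a)"]) (auto simp: carrier \<phi> T)
  qed (auto simp: carrier \<phi> T ac_simps)
  show "Group.comm_monoid A"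
    by (rule comm_monoidI) (auto simp: carrier \<phi> T ac_simps)
qed (auto simp: carrier \<phi> T algebra_simps)

lemma ideal_iff: "ideal I A \<longleftrightarrow> (\<exists>P. ideal_in T P \<and> I = \<phi> ` P)"
proof
  assume "ideal I A"
  then interpret ideal I A .
  define P where "P = {a \<in> T. \<phi> a \<in> I}"
  have "I = \<phi> ` P"
    using a_subset by (auto simp: P_def carrier)
  moreover have "ideal_in T P"
    unfolding ideal_in_def
  proof (intro conjI ballI)
    show "0 \<in> P"
      using T additive_subgroup.zero_closed[OF additive_subgroup_axioms] by (simp add: P_def \<phi>)
    show "a + b \<in> P" if "a \<in> P" "b \<in> P" for a b
      using that T additive_subgroup.a_closed[OF additive_subgroup_axioms, of "\<phi> a" "\<phi> b"] by (simp add: P_def \<phi>)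
    show "a * b \<in> P" if "a \<in> T" "b \<in> P" for a b
      using that T I_l_closed[of "\<phi> b" "\<phi> a"] by (simp add: P_def \<phi> carrier)
  qed (auto simp: P_def)
  ultimately show "\<exists>P. ideal_in T P \<and> I = \<phi> ` P"
    by blast
next
  assume "\<exists>P. ideal_in T P \<and> I = \<phi> ` P"
  then obtain P where P: "ideal_in T P" and I: "I = \<phi> ` P"
    by blast
  note D = ideal_inD[OF P]
  interpret A: cring A by (rule cring)
  show "ideal I A"
  proof (rule idealI[OF A.ring_axioms])
    show "subgroup I (add_monoid A)"
    proof (rule A.add.subgroupI)
      fix x assume "x \<in> I"
      then obtain a where a: "a \<in> P" "x = \<phi> a"
        unfolding I by blast
      have "- a \<in> P"
        using ideal_diff[OF P D(2) a(1)] by simp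
      then have "\<phi> (- a) \<oplus>\<^bsub>A\<^esub> x = \<zero>\<^bsub>A\<^esub>" "\<phi> (- a) \<in> carrier A" "x \<in> carrier A"
        using a D(1) by (auto simp: \<phi> carrier subset_iff)
      then have "\<ominus>\<^bsub>A\<^esub> x = \<phi> (- a)"
        using A.minus_equality by blast
      then show "\<ominus>\<^bsub>A\<^esub> x \<in> I"
        using \<open>- a \<in> P\<close> by (simp add: I)
    next
      fix x y assume "x \<in> I" "y \<in> I"
      then show "x \<oplus>\<^bsub>A\<^esub> y \<in> I"
        using D by (auto simp: I \<phi> subset_iff)
    qed (use D in \<open>auto simp: I carrier\<close>)
    fix a x assume "a \<in> I" "x \<in> carrier A"
    then show "x \<otimes>\<^bsub>A\<^esub> a \<in> I" "a \<otimes>\<^bsub>A\<^esub> x \<in> I"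
      using D by (auto simp: I \<phi> carrier subset_iff)
  qed
qed

lemma ideal_image: "ideal (\<phi> ` P) A \<longleftrightarrow> ideal_in T P"
  unfolding ideal_iff using inj by (auto simp: inj_image_eq_iff)

lemma primeideal_image: "primeideal (\<phi> ` P) A \<longleftrightarrow> prime_in T P"
proof
  assume "primeideal (\<phi> ` P) A"
  then interpret primeideal "\<phi> ` P" A .
  show "prime_in T P"
    unfolding prime_in_def
  proof (intro conjI ballI impI)
    show "ideal_in T P"
      using is_ideal ideal_image by blast
    show "1 \<notin> P"
      using I_notcarr one_imp_carrier by (auto simp: \<phi>)
    show "a \<in> P \<or> b \<in> P" if "a \<in> T" "b \<in> T" "a * b \<in> P" for a b
      using I_prime[of "\<phi> a" "\<phi> b"] that by (simp add: carrier \<phi>)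
  qed
next
  assume P: "prime_in T P"
  show "primeideal (\<phi> ` P) A"
  proof (rule primeidealI[OF _ cring])
    show "ideal (\<phi> ` P) A"
      using prime_inD(1)[OF P] by (simp add: ideal_image)
    show "carrier A \<noteq> \<phi> ` P"
      using prime_inD(2)[OF P] T by (auto simp: carrier inj_image_eq_iff[OF inj])
    fix x y assume xy: "x \<in> carrier A" "y \<in> carrier A" "x \<otimes>\<^bsub>A\<^esub> y \<in> \<phi> ` P"
    then obtain a b where ab: "a \<in> T" "x = \<phi> a" "b \<in> T" "y = \<phi> b"
      unfolding carrier by blast
    then have "a * b \<in> P"
      using xy(3) by (simp add: \<phi>)
    then show "x \<in> \<phi> ` P \<or> y \<in> \<phi> ` P"
      using prime_inD(3)[OF P ab(1,3)] ab by simp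
  qed
qed

lemma primeideal_iff: "primeideal I A \<longleftrightarrow> (\<exists>P. prime_in T P \<and> I = \<phi> ` P)"
  using primeideal_image ideal_iff by (metis primeideal.axioms(1))

lemma genideal_subset_iff:
  assumes "E \<subseteq> T" "ideal_in T P"
  shows "Idl\<^bsub>A\<^esub> (\<phi> ` E) \<subseteq> \<phi> ` P \<longleftrightarrow> E \<subseteq> P"
proof -
  interpret A: cring A by (rule cring)
  have "\<phi> ` E \<subseteq> carrier A"
    using assms by (auto simp: carrier)
  then show ?thesis
    using A.genideal_self[of "\<phi> ` E"] A.genideal_minimal[of "\<phi> ` P" "\<phi> ` E"] assms(2)
    by (metis ideal_image inj inj_image_subset_iff order_trans)
qed

end

definition type_ring :: "'a::comm_ring_1 ring" where
  "type_ring = \<lparr>carrier = UNIV, mult = (*), one = 1, zero = 0, add = (+)\<rparr>"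

lemma type_ring_simps [simp]:
  "carrier type_ring = UNIV" "mult type_ring = (*)" "one type_ring = 1" "zero type_ring = 0"
  "add type_ring = (+)"
  by (simp_all add: type_ring_def)

global_interpretation type_ring: concrete_ring "type_ring :: 'a::comm_ring_1 ring" id UNIV
  by unfold_locales auto

lemma type_ring_pow [simp]: "a [^]\<^bsub>type_ring\<^esub> (n::nat) = a ^ n"
  by (induction n) (auto simp: nat_pow_def)

lemma type_ring_finsum [simp]: "finsum type_ring f S = sum f S"
proof -
  interpret cring "type_ring :: 'a ring" by (rule type_ring.cring)
  show ?thesis
    by (induction S rule: infinite_finite_induct) auto
qed

unbundle fps_syntax

section \<open>Power series in two variables over a field\<close>

text \<open>The outer variable is \<open>x\<close>, so \<open>f $ i $ j\<close> is the coefficient of \<open>x\<^sup>i y\<^sup>j\<close>.\<close>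

abbreviation fps_Y :: "'a::field fps fps" where "fps_Y \<equiv> fps_const fps_X"

definition max_ideal :: "'a::field fps fps set" where
  "max_ideal = {f. f $ 0 $ 0 = 0}"

lemma fps_head_tail: "f = fps_const (f $ 0) + fps_X * fps_shift 1 f" for f :: "'a::comm_ring_1 fps"
  by (rule fps_ext) auto

lemma fps_nth_0_eq_0_iff: "f $ 0 = 0 \<longleftrightarrow> (\<exists>g. f = fps_X * g)" for f :: "'a::comm_ring_1 fps"
  using fps_head_tail[of f] by auto

text \<open>Invertibility is inherited twice: from the scalar to the constant coefficient in
  \<open>k[[y]]\<close>, and from there to the series in \<open>x\<close>.\<close>

lemma unit_fps_fps:
  assumes "f \<notin> max_ideal"
  obtains g where "f * g = 1"
proof -
  have "f $ 0 * inverse (f $ 0) = 1"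
    using assms by (simp add: max_ideal_def inverse_mult_eq_1')
  then show ?thesis
    using fps_right_inverse that by blast
qed

lemma fps_field_factor:
  fixes f :: "'a::field fps"
  assumes "f \<noteq> 0"
  obtains u v where "f = fps_X ^ subdegree f * u" "u * v = 1"
proof
  show "f = fps_X ^ subdegree f * unit_factor f"
    using assms subdegree_decompose[of f] by (simp add: mult.commute)
  show "unit_factor f * inverse (unit_factor f) = 1"
    using assms by (intro inverse_mult_eq_1') simp
qed

section \<open>Ideals and primes of \<open>k[[x, y]]\<close>\<close>

lemma proper_ideal_subset_max_ideal:
  assumes "ideal_in UNIV P" "1 \<notin> P"
  shows "P \<subseteq> max_ideal"
proof
  fix f assume "f \<in> P"
  show "f \<in> max_ideal"
  proof (rule ccontr)
    assume "f \<notin> max_ideal"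
    then show False
      using unit_fps_fps ideal_inD(5)[OF assms(1)] \<open>f \<in> P\<close> assms(2) by (metis UNIV_I)
  qed
qed

lemma max_ideal_subset:
  assumes "ideal_in UNIV P" "fps_X \<in> P" "fps_Y \<in> P"
  shows "max_ideal \<subseteq> P"
proof
  fix f :: "'a fps fps"
  assume f: "f \<in> max_ideal"
  then obtain g where g: "f $ 0 = fps_X * g"
    using fps_nth_0_eq_0_iff[of "f $ 0"] by (auto simp: max_ideal_def)
  have "f = fps_Y * fps_const g + fps_X * fps_shift 1 f"
    using fps_head_tail[of f] unfolding g by simp
  then show "f \<in> P"
    using ideal_inD(3,5)[OF assms(1)] assms(2,3) by (metis UNIV_I)
qed

lemma prime_max_ideal: "prime_in UNIV max_ideal"
  by (auto simp: prime_in_def ideal_in_def max_ideal_def)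

lemma prime_fps_X: "prime_in UNIV {f :: 'a::field fps fps. f $ 0 = 0}"
  by (auto simp: prime_in_def ideal_in_def)

lemma prime_zero: "prime_in UNIV {0 :: 'a::idom}"
  by (auto simp: prime_in_def ideal_in_def)

text \<open>The quotients are the constant coefficients of successive remainders; completeness lets
  the division run forever.\<close>

lemma fps_division:
  fixes f :: "'a::comm_ring_1 fps"
  assumes U: "ideal_in UNIV U" and X: "\<And>h. fps_X * h \<in> U \<Longrightarrow> h \<in> U" and f: "f \<in> U"
    and dvd: "\<And>h. h \<in> U \<Longrightarrow> f $ 0 dvd h $ 0" and h: "h \<in> U"
  shows "f dvd h"
proof -
  define c where "c = (\<lambda>h. SOME c. h $ 0 = f $ 0 * c)"
  have c: "h $ 0 = f $ 0 * c h" if "h \<in> U" for h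
    using someI_ex[of "\<lambda>c. h $ 0 = f $ 0 * c"] dvd[OF that] by (auto simp: c_def dvd_def)
  define r where "r = (\<lambda>n. ((\<lambda>h. fps_shift 1 (h - fps_const (c h) * f)) ^^ n) h)"
  have r_step: "r n = fps_const (c (r n)) * f + fps_X * r (Suc n)" if "r n \<in> U" for n
    using fps_head_tail[of "r n - fps_const (c (r n)) * f"] c[OF that]
    by (simp add: r_def algebra_simps)
  have r: "r n \<in> U" for n
  proof (induction n)
    case (Suc n)
    have "fps_X * r (Suc n) = r n - fps_const (c (r n)) * f"
      using r_step[OF Suc] by (simp add: algebra_simps)
    also have "\<dots> \<in> U"
      using type_ring.ideal_diff[OF U Suc] ideal_inD(4)[OF U _ f] by blast
    finally show ?case
      by (rule X)
  qed (simp add: r_def h)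
  define q where "q = (\<lambda>n. \<Sum>i<n. fps_const (c (r i)) * fps_X ^ i)"
  have q: "h = q n * f + fps_X ^ n * r n" for n
  proof (induction n)
    case (Suc n)
    show ?case
      using Suc arg_cong[OF r_step[OF r[of n]], of "(*) (fps_X ^ n)"]
      by (simp add: q_def algebra_simps)
  qed (simp add: q_def r_def)
  \<comment> \<open>The limit of the partial quotients. It agrees with \<open>q (Suc n)\<close> up
    to degree \<open>n\<close>, and the remainder \<open>fps_X ^ Suc n * r (Suc n)\<close> begins
    above that degree.\<close>
  let ?q = "Abs_fps (\<lambda>n. c (r n))"
  have "q n $ i = ?q $ i" if "i < n" for n i
  proof -
    have "q n $ i = (\<Sum>j<n. if i = j then c (r j) else 0)"
      unfolding q_def fps_sum_nth by (intro sum.cong) (auto simp: fps_X_power_nth)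
    then show ?thesis
      using that by simp
  qed
  then have "(q (Suc n) * f) $ n = (?q * f) $ n" for n
    unfolding fps_mult_nth by (intro sum.cong) auto
  moreover have "h $ n = (q (Suc n) * f) $ n" for n
    by (subst q[of "Suc n"]) (simp add: fps_X_power_mult_nth del: power_Suc)
  ultimately have "h = f * ?q"
    by (simp add: fps_eq_iff mult.commute)
  then show ?thesis
    by simp
qed

text \<open>Modulo \<open>x\<close> the ring is the discrete valuation ring \<open>k[[y]]\<close>: a
  member with nonzero constant coefficient puts a power of \<open>y\<close>, hence the whole maximal
  ideal, into \<open>p\<close>.\<close>

lemma prime_contains_fps_X:
  assumes p: "prime_in UNIV p" and X: "fps_X \<in> p" and ne: "p \<noteq> max_ideal"
  shows "p = {f. f $ 0 = 0}"
proof
  note I = ideal_inD[OF prime_inD(1)[OF p]]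
  show "{f. f $ 0 = 0} \<subseteq> p"
    using I(5)[OF UNIV_I X] by (auto simp: fps_nth_0_eq_0_iff)
  show "p \<subseteq> {f. f $ 0 = 0}"
  proof (clarify, rule ccontr)
    fix f assume f: "f \<in> p" "f $ 0 \<noteq> 0"
    obtain u v where uv: "f $ 0 = fps_X ^ subdegree (f $ 0) * u" "u * v = 1"
      using fps_field_factor[OF f(2)] .
    have "fps_const (f $ 0) \<in> p"
      using type_ring.ideal_diff[OF prime_inD(1)[OF p] f(1) I(5)[OF UNIV_I X, of "fps_shift 1 f"]]
        fps_head_tail[of f] by (metis add_diff_cancel_right')
    then have "fps_const (f $ 0) * fps_const v \<in> p"
      by (rule I(5)[OF UNIV_I])
    moreover have "fps_const (f $ 0) * fps_const v = fps_Y ^ subdegree (f $ 0)"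
      using uv by (metis fps_const_mult fps_const_power mult.assoc mult.right_neutral)
    ultimately have "fps_Y \<in> p"
      using type_ring.prime_power[OF p UNIV_I] by metis
    then have "max_ideal \<subseteq> p"
      using max_ideal_subset[OF prime_inD(1)[OF p] X] by blast
    then show False
      using ne proper_ideal_subset_max_ideal[OF prime_inD(1,2)[OF p]] by blast
  qed
qed

text \<open>Divisibility in \<open>k[[y]]\<close> compares orders, so a constant coefficient of
  least order divides all others. This supplies the divisor for \<open>fps_division\<close>.\<close>

lemma ideal_min_subdegree:
  assumes U: "ideal_in UNIV U" and ex: "\<exists>h\<in>U. h $ 0 \<noteq> (0 :: 'a::field fps)"
  obtains f where "f \<in> U" "f $ 0 \<noteq> 0" "\<And>h. h \<in> U \<Longrightarrow> f $ 0 dvd h $ 0"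
proof -
  obtain f where f: "f \<in> U \<and> f $ 0 \<noteq> 0"
    and min: "\<And>h. h \<in> U \<and> h $ 0 \<noteq> 0 \<Longrightarrow> subdegree (f $ 0) \<le> subdegree (h $ 0)"
    using ex ex_has_least_nat[of "\<lambda>h. h \<in> U \<and> h $ 0 \<noteq> 0" _ "\<lambda>h. subdegree (h $ 0)"] by blast
  have "f $ 0 dvd h $ 0" if "h \<in> U" for h
    using min[of h] that f by (cases "h $ 0 = 0") (auto simp: fps_dvd_iff)
  then show ?thesis
    using that f by blast
qed

lemma fps_nonzero_factor:
  fixes f :: "'a::comm_ring_1 fps"
  assumes "f \<noteq> 0"
  obtains n g where "f = fps_X ^ n * g" "g $ 0 \<noteq> 0"
  using assms subdegree_decompose[of f] that[of "subdegree f" "fps_shift (subdegree f) f"]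
  by (simp add: mult.commute)

text \<open>A prime without \<open>x\<close> is closed under division by \<open>x\<close>, as
  \<open>fps_division\<close> demands; the same closure turns a nonzero member into one with nonzero
  constant coefficient.\<close>

lemma prime_principal:
  fixes p :: "'a::field fps fps set"
  assumes p: "prime_in UNIV p" and X: "fps_X \<notin> p" and ne: "p \<noteq> {0}"
  obtains f where "f \<in> p" "f $ 0 \<noteq> 0" "\<And>h. h \<in> p \<Longrightarrow> f dvd h"
proof -
  note I = prime_inD(1)[OF p]
  obtain f where f: "f \<in> p" "f \<noteq> 0"
    using ne ideal_inD(2)[OF I] by blast
  obtain n g where g: "f = fps_X ^ n * g" "g $ 0 \<noteq> 0"
    using fps_nonzero_factor[OF f(2)] .
  have "g \<in> p"
    using prime_inD(3)[OF p] f(1) g(1) X type_ring.prime_power[OF p] by (metis UNIV_I)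
  with g(2) obtain f where f: "f \<in> p" "f $ 0 \<noteq> 0" "\<And>h. h \<in> p \<Longrightarrow> f $ 0 dvd h $ 0"
    using ideal_min_subdegree[OF I] by blast
  moreover have "f dvd h" if "h \<in> p" for h
    by (rule fps_division[OF I _ f(1,3) that]) (use prime_inD(3)[OF p] X in blast)
  ultimately show ?thesis
    using that by blast
qed

text \<open>If neither prime contained \<open>x\<close> or were maximal, both would be principal,
  say with generators \<open>f\<close> and \<open>g\<close>. From \<open>f = g * h\<close> and
  \<open>g\<close> outside \<open>p\<close>, \<open>h\<close> is a multiple of \<open>f\<close>,
  which makes \<open>g\<close> a unit.\<close>

lemma prime_chain_max:
  fixes p q :: "'a::field fps fps set"
  assumes p: "prime_in UNIV p" "p \<noteq> {0}" and q: "prime_in UNIV q" and less: "p \<subset> q"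
  shows "q = max_ideal"
proof (rule ccontr)
  assume ne: "q \<noteq> max_ideal"
  have X: "fps_X \<notin> p"
  proof
    assume "fps_X \<in> p"
    moreover from this have "fps_X \<in> q"
      using less by blast
    moreover have "p \<noteq> max_ideal"
      using less proper_ideal_subset_max_ideal[OF prime_inD(1,2)[OF q]] by blast
    ultimately show False
      using prime_contains_fps_X[OF p(1)] prime_contains_fps_X[OF q] ne less by blast
  qed
  obtain f where f: "f \<in> p" "f $ 0 \<noteq> 0" "\<And>h. h \<in> p \<Longrightarrow> f dvd h"
    using prime_principal[OF p(1) X p(2)] by metis
  have "fps_X \<notin> q"
    using prime_contains_fps_X[OF q] ne f less by blast
  moreover have "q \<noteq> {0}"
    using ideal_inD(2)[OF prime_inD(1)[OF p(1)]] less by blast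
  ultimately obtain g where g: "g \<in> q" "\<And>h. h \<in> q \<Longrightarrow> g dvd h"
    using prime_principal[OF q] by metis
  obtain h where h: "f = g * h"
    using f(1) less g(2) by (metis dvdE psubsetD)
  have "g \<notin> p"
  proof
    assume "g \<in> p"
    then have "q \<subseteq> p"
      using g(2) ideal_inD(5)[OF prime_inD(1)[OF p(1)]] by (metis UNIV_I dvdE subsetI)
    then show False
      using less by blast
  qed
  then have "h \<in> p"
    using prime_inD(3)[OF p(1), of g h] f(1) h by simp
  then obtain k where "h = f * k"
    using f(3) by (metis dvdE)
  then have "f * (g * k) = f * 1"
    using h by (simp add: ac_simps)
  then have "g * k = 1"
    using f(2) by (metis fps_zero_nth mult_left_cancel)
  then show False
    using ideal_inD(5)[OF prime_inD(1)[OF q] UNIV_I g(1), of k] prime_inD(2)[OF q] by simp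
qed

text \<open>The quotients \<open>U j\<close> of \<open>I\<close> by \<open>x^j\<close> increase, and
  their union is closed under division by \<open>x\<close>, hence principal. Its generator lies in
  some \<open>U J\<close>, so one element generates the part of \<open>I\<close> divisible by
  \<open>x^J\<close>; finitely many steps recover the rest. Generation is expressed by the ideals
  that contain \<open>E\<close>.\<close>

lemma fps_fps_finite_generation:
  fixes I :: "'a::field fps fps set"
  assumes I: "ideal_in UNIV I"
  shows "\<exists>E. finite E \<and> E \<subseteq> I \<and> (\<forall>P. ideal_in UNIV P \<and> E \<subseteq> P \<longrightarrow> I \<subseteq> P)"
proof (cases "I = {0}")
  case True
  then show ?thesis
    by (intro exI[of _ "{}"]) (auto dest: ideal_inD)
next
  case False
  define U where "U = (\<lambda>j. {h. fps_X ^ j * h \<in> I})"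
  have U: "ideal_in UNIV (U j)" for j
    using ideal_inD[OF I] unfolding ideal_in_def U_def
    by (auto simp: distrib_left mult.left_commute)
  have mono: "U j \<subseteq> U k" if "j \<le> k" for j k
  proof
    fix h assume "h \<in> U j"
    then have "fps_X ^ (k - j) * (fps_X ^ j * h) \<in> I"
      using ideal_inD(4)[OF I] by (simp add: U_def)
    then show "h \<in> U k"
      using that by (simp add: U_def mult.assoc[symmetric] power_add[symmetric])
  qed
  have V: "ideal_in UNIV (\<Union>j. U j)"
    unfolding ideal_in_def
  proof (intro conjI ballI)
    fix a b assume "a \<in> (\<Union>j. U j)" "b \<in> (\<Union>j. U j)"
    then obtain j k where "a \<in> U j" "b \<in> U k"
      by blast
    then have "a \<in> U (max j k)" "b \<in> U (max j k)"
      using mono[of j "max j k"] mono[of k "max j k"] by auto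
    then show "a + b \<in> (\<Union>j. U j)"
      using ideal_inD(3)[OF U] by blast
  qed (use ideal_inD(2,4)[OF U] in blast)+
  obtain g where g: "g \<in> I" "g \<noteq> 0"
    using False ideal_inD(2)[OF I] by blast
  obtain n g' where "g = fps_X ^ n * g'" "g' $ 0 \<noteq> 0"
    using fps_nonzero_factor[OF g(2)] .
  then have "\<exists>h\<in>\<Union>j. U j. h $ 0 \<noteq> 0"
    using g(1) by (auto simp: U_def)
  then obtain f where f: "f \<in> (\<Union>j. U j)" "f $ 0 \<noteq> 0" "\<And>h. h \<in> (\<Union>j. U j) \<Longrightarrow> f $ 0 dvd h $ 0"
    using ideal_min_subdegree[OF V] by metis
  have f_dvd: "f dvd h" if "h \<in> (\<Union>j. U j)" for h
  proof (rule fps_division[OF V _ f(1,3) that])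
    fix h :: "'a fps fps"
    assume "fps_X * h \<in> (\<Union>j. U j)"
    then obtain j where "fps_X ^ Suc j * h \<in> I"
      by (auto simp: U_def ac_simps)
    then show "h \<in> (\<Union>j. U j)"
      unfolding U_def by blast
  qed
  obtain J where J: "f \<in> U J"
    using f(1) by blast
  \<comment> \<open>Descent from \<open>x^J\<close> to \<open>x^0\<close>: each step adds at most
    one generator, whose quotient by the power of \<open>x\<close> has a constant coefficient of
    least order. Subtracting a multiple of it leaves an element divisible by one more
    \<open>x\<close>.\<close>
  have "\<exists>E. finite E \<and> E \<subseteq> I \<and>
    (\<forall>P. ideal_in UNIV P \<and> E \<subseteq> P \<longrightarrow> (\<forall>h\<in>U (J - j). fps_X ^ (J - j) * h \<in> P))" for j
  proof (induction j)
    case 0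
    have *: "fps_X ^ J * h \<in> P" if "ideal_in UNIV P" "fps_X ^ J * f \<in> P" "h \<in> U J" for P h
    proof -
      obtain q where "h = f * q"
        using f_dvd \<open>h \<in> U J\<close> by blast
      then show ?thesis
        using ideal_inD(5)[OF that(1) UNIV_I that(2)] by (simp add: mult.assoc)
    qed
    show ?case
    proof (intro exI[of _ "{fps_X ^ J * f}"] conjI allI impI ballI)
      show "{fps_X ^ J * f} \<subseteq> I"
        using J by (simp add: U_def)
      fix P h assume "ideal_in UNIV P \<and> {fps_X ^ J * f} \<subseteq> P" "h \<in> U (J - 0)"
      then show "fps_X ^ (J - 0) * h \<in> P"
        using *[of P h] by simp
    qed simp
  next
    case (Suc j)
    from Suc.IH obtain E where E: "finite E" "E \<subseteq> I" and gen:
      "\<forall>P. ideal_in UNIV P \<and> E \<subseteq> P \<longrightarrow> (\<forall>h\<in>U (J - j). fps_X ^ (J - j) * h \<in> P)"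
      by (elim exE conjE)
    show ?case
    proof (cases "j < J")
      case False
      then have "J - Suc j = J - j"
        by simp
      then show ?thesis
        using Suc by simp
    next
      case True
      define i where "i = J - Suc j"
      have i: "J - j = Suc i"
        using True by (simp add: i_def)
      have tail: "fps_X ^ i * h \<in> P"
        if P: "ideal_in UNIV P" "E \<subseteq> P" "h \<in> U i" "h $ 0 = 0" for P h
      proof -
        obtain g where g: "h = fps_X * g"
          using P(4) fps_nth_0_eq_0_iff by blast
        then have "g \<in> U (J - j)"
          using P(3) by (simp add: U_def i ac_simps)
        then show ?thesis
          using gen[rule_format, of P g] P(1,2) g by (simp add: i ac_simps)
      qed
      show ?thesis
      proof (cases "\<exists>h\<in>U i. h $ 0 \<noteq> 0")
        case False
        show ?thesis
          unfolding i_def[symmetric]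
        proof (intro exI[of _ E] conjI allI impI ballI)
          fix P h assume "ideal_in UNIV P \<and> E \<subseteq> P" "h \<in> U i"
          then show "fps_X ^ i * h \<in> P"
            using tail[of P h] False by simp
        qed (use E in simp_all)
      next
        case True
        obtain f where f: "f \<in> U i" "\<And>h. h \<in> U i \<Longrightarrow> f $ 0 dvd h $ 0"
          using ideal_min_subdegree[OF U True] by metis
        have *: "fps_X ^ i * h \<in> P"
          if P: "ideal_in UNIV P" "insert (fps_X ^ i * f) E \<subseteq> P" "h \<in> U i" for P h
        proof -
          obtain q where q: "h $ 0 = f $ 0 * q"
            using f(2)[OF P(3)] by blast
          have "f * fps_const q \<in> U i"
            using ideal_inD(5)[OF U UNIV_I f(1)] .
          then have "h - f * fps_const q \<in> U i"
            using type_ring.ideal_diff[OF U P(3)] by blast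
          then have "fps_X ^ i * (h - f * fps_const q) \<in> P"
            using tail that q by simp
          moreover have "fps_X ^ i * f * fps_const q \<in> P"
            using ideal_inD(5)[OF P(1)] P(2) by blast
          ultimately show ?thesis
            using ideal_inD(3)[OF P(1)] by (fastforce simp: algebra_simps)
        qed
        show ?thesis
          unfolding i_def[symmetric]
        proof (intro exI[of _ "insert (fps_X ^ i * f) E"] conjI allI impI ballI)
          show "insert (fps_X ^ i * f) E \<subseteq> I"
            using f(1) E by (simp add: U_def)
          fix P h assume "ideal_in UNIV P \<and> insert (fps_X ^ i * f) E \<subseteq> P" "h \<in> U i"
          then show "fps_X ^ i * h \<in> P"
            using *[of P h] by simp
        qed (use E in simp)
      qed
    qed
  qed
  from this[of J] show ?thesis
    by (auto simp: U_def subset_iff)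
qed

section \<open>The power series ring is regular local of dimension two\<close>

abbreviation power_series_ring :: "'a::field fps fps ring" where
  "power_series_ring \<equiv> type_ring"

lemma ideal_power_series_iff: "ideal I power_series_ring \<longleftrightarrow> ideal_in UNIV I"
  using type_ring.ideal_image[of I] by simp

lemma primeideal_power_series_iff: "primeideal I power_series_ring \<longleftrightarrow> prime_in UNIV I"
  using type_ring.primeideal_image[of I] by simp

lemma ideal_max_ideal: "ideal_in UNIV max_ideal"
  using prime_max_ideal by (rule prime_inD(1))

lemma maximalideal_iff: "maximalideal n power_series_ring \<longleftrightarrow> n = max_ideal"
proof
  assume "maximalideal n power_series_ring"
  then interpret maximalideal n power_series_ring .
  have n: "ideal_in UNIV n"
    using is_ideal by (simp add: ideal_power_series_iff)
  moreover have "1 \<notin> n"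
    using I_notcarr one_imp_carrier by auto
  ultimately have "n \<subseteq> max_ideal"
    by (rule proper_ideal_subset_max_ideal)
  then show "n = max_ideal"
    using I_maximal[of max_ideal] ideal_max_ideal prime_inD(2)[OF prime_max_ideal]
    by (auto simp: ideal_power_series_iff)
next
  assume n: "n = max_ideal"
  show "maximalideal n power_series_ring"
    unfolding n
  proof (rule maximalidealI)
    show "ideal max_ideal power_series_ring"
      by (simp add: ideal_power_series_iff ideal_max_ideal)
    show "carrier power_series_ring \<noteq> max_ideal"
      using prime_inD(2)[OF prime_max_ideal] by auto
    fix J assume J: "ideal J power_series_ring" "max_ideal \<subseteq> J" "J \<subseteq> carrier power_series_ring"
    show "J = max_ideal \<or> J = carrier power_series_ring"
    proof (cases "1 \<in> J")
      case True
      then show ?thesis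
        using ideal.one_imp_carrier[OF J(1)] by simp
    next
      case False
      then show ?thesis
        using proper_ideal_subset_max_ideal J by (auto simp: ideal_power_series_iff)
    qed
  qed
qed

text \<open>The chain is \<open>0\<close>, \<open>(x)\<close>, \<open>(x, y)\<close>. In a chain
  with four members the last two lie strictly above nonzero primes, so both would be
  maximal.\<close>

lemma ring_dim_power_series: "ring_dim power_series_ring = 2"
proof -
  have "chain_dim {p. primeideal p (power_series_ring :: 'a fps fps ring)} = ereal (real 2)"
  proof (rule chain_dim_eqI)
    let ?c = "\<lambda>i::nat. if i = 0 then {0 :: 'a fps fps} else if i = 1 then {f. f $ 0 = 0} else max_ideal"
    show "\<forall>i\<le>2. ?c i \<in> {p. primeideal p power_series_ring}"
      by (simp add: primeideal_power_series_iff prime_zero prime_fps_X prime_max_ideal)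
    have "fps_X \<in> {f :: 'a fps fps. f $ 0 = 0}" "fps_X \<notin> {0 :: 'a fps fps}"
      "fps_Y \<in> max_ideal" "fps_Y \<notin> {f :: 'a fps fps. f $ 0 = 0}"
      by (simp_all add: max_ideal_def)
    moreover have "{0} \<subseteq> {f :: 'a fps fps. f $ 0 = 0}" "{f :: 'a fps fps. f $ 0 = 0} \<subseteq> max_ideal"
      by (auto simp: max_ideal_def)
    ultimately have "{0} \<subset> {f :: 'a fps fps. f $ 0 = 0}" "{f :: 'a fps fps. f $ 0 = 0} \<subset> max_ideal"
      by blast+
    then show "\<forall>i<2. ?c i \<subset> ?c (Suc i)"
      by (auto simp: less_Suc_eq numeral_2_eq_2)
  next
    fix d
    assume "\<forall>i\<le>Suc 2. d i \<in> {p. primeideal p (power_series_ring :: 'a fps fps ring)}"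
      and less: "\<forall>i<Suc 2. d i \<subset> d (Suc i)"
    then have p: "prime_in UNIV (d i)" if "i \<le> 3" for i
      using that by (simp add: primeideal_power_series_iff)
    have less: "d 0 \<subset> d 1" "d 1 \<subset> d 2" "d 2 \<subset> d 3"
      using less by (simp_all add: numeral_2_eq_2 numeral_3_eq_3)
    have nz: "d 1 \<noteq> {0}" "d 2 \<noteq> {0}"
      using less ideal_inD(2)[OF prime_inD(1)[OF p[of 0]]] by auto
    have "d 2 = max_ideal"
      using prime_chain_max[OF p nz(1) p less(2)] by simp
    moreover have "d 3 = max_ideal"
      using prime_chain_max[OF p nz(2) p less(3)] by simp
    ultimately show False
      using less by simp
  qed
  then show ?thesis
    by (simp add: ring_dim_def)
qed

lemma noetherian_power_series: "noetherian_ring (power_series_ring :: 'a::field fps fps ring)"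
proof -
  interpret R: cring "power_series_ring :: 'a fps fps ring"
    by (rule type_ring.cring)
  show ?thesis
  proof (rule R.noetherian_ringI)
    fix I assume I: "ideal I (power_series_ring :: 'a fps fps ring)"
    then obtain E where E: "finite E" "E \<subseteq> I" "\<And>P. ideal_in UNIV P \<Longrightarrow> E \<subseteq> P \<Longrightarrow> I \<subseteq> P"
      using fps_fps_finite_generation[of I] by (auto simp: ideal_power_series_iff)
    have "ideal_in UNIV (Idl\<^bsub>power_series_ring\<^esub> E)"
      using R.genideal_ideal[of E] by (simp add: ideal_power_series_iff)
    then have "I = Idl\<^bsub>power_series_ring\<^esub> E"
      using E(3) R.genideal_minimal[OF I E(2)] R.genideal_self[of E] by auto
    then show "\<exists>A\<subseteq>carrier power_series_ring. finite A \<and> I = Idl\<^bsub>power_series_ring\<^esub> A"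
      using E(1) by auto
  qed
qed

lemma regular_local_power_series:
  "regular_local_ring (power_series_ring :: 'a::field fps fps ring) max_ideal"
  unfolding regular_local_ring_def local_ring_def
proof (intro conjI)
  interpret R: cring "power_series_ring :: 'a fps fps ring"
    by (rule type_ring.cring)
  show "cring (power_series_ring :: 'a fps fps ring)"
    by (rule type_ring.cring)
  show "{n. maximalideal n (power_series_ring :: 'a fps fps ring)} = {max_ideal}"
    by (simp add: maximalideal_iff)
  show "noetherian_ring (power_series_ring :: 'a fps fps ring)"
    by (rule noetherian_power_series)
  let ?E = "{fps_X, fps_Y} :: 'a fps fps set"
  have "ideal_in UNIV (Idl\<^bsub>power_series_ring\<^esub> ?E)" "?E \<subseteq> Idl\<^bsub>power_series_ring\<^esub> ?E"
    using R.genideal_ideal[of ?E] R.genideal_self[of ?E] by (simp_all add: ideal_power_series_iff)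
  then have "max_ideal \<subseteq> Idl\<^bsub>power_series_ring\<^esub> ?E"
    by (intro max_ideal_subset) simp_all
  moreover have "Idl\<^bsub>power_series_ring\<^esub> ?E \<subseteq> max_ideal"
    using R.genideal_minimal[of max_ideal ?E] ideal_max_ideal
    by (simp add: ideal_power_series_iff max_ideal_def)
  moreover have "(fps_X :: 'a fps fps) $ 0 \<noteq> fps_Y $ 0"
    by simp
  then have "fps_X \<noteq> (fps_Y :: 'a fps fps)"
    by metis
  then have "card ?E = 2"
    by simp
  ultimately show "\<exists>X\<subseteq>carrier power_series_ring. finite X \<and> (max_ideal :: 'a fps fps set) = Idl\<^bsub>power_series_ring\<^esub> X \<and>
    ereal (real (card X)) = ring_dim (power_series_ring :: 'a fps fps ring)"
    by (intro exI[of _ ?E]) (simp add: ring_dim_power_series)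
qed

hide_const (open) up_ring.coeff up_ring.monom

section \<open>A filtration by monomial ideals\<close>

text \<open>The edges of the polygon \<open>{(s, t). t \<ge> 1 - 2\<^sup>-\<^sup>k - k s for all k}\<close> have the slopes \<open>- k\<close>; its vertices
  \<open>(2\<^sup>-\<^sup>k, 1 - (k + 1) 2\<^sup>-\<^sup>k)\<close> for \<open>k \<ge> 1\<close> accumulate at \<open>(0, 1)\<close>. The monomial \<open>x\<^sup>i y\<^sup>j\<close> lies in \<open>I\<^sub>n\<close> iff
  \<open>(i / n, j / n)\<close> lies in the polygon; the inequalities are multiplied by \<open>2\<^sup>k n\<close> and arranged so that
  they contain no subtraction. Edge \<open>0\<close> is the unbounded one on the \<open>s\<close>-axis; the vertex \<open>k \<ge> 1\<close> joins
  the edges \<open>k - 1\<close> and \<open>k\<close>.\<close>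

definition adm :: "nat \<Rightarrow> nat \<Rightarrow> nat \<Rightarrow> bool" where
  "adm i j n \<longleftrightarrow> (\<forall>k. 2 ^ k * n \<le> 2 ^ k * (j + k * i) + n)"

definition on_edge :: "nat \<Rightarrow> nat \<Rightarrow> nat \<Rightarrow> nat \<Rightarrow> bool" where
  "on_edge k i j n \<longleftrightarrow> 2 ^ k * n = 2 ^ k * (j + k * i) + n"

definition filt :: "nat \<Rightarrow> 'a::field fps fps set" where
  "filt n = {f. \<forall>i j. f $ i $ j \<noteq> 0 \<longrightarrow> adm i j n}"

lemma admD: "adm i j n \<Longrightarrow> 2 ^ k * n \<le> 2 ^ k * (j + k * i) + n"
  by (simp add: adm_def)

lemma adm_add: "adm i j n \<Longrightarrow> adm i' j' n' \<Longrightarrow> adm (i + i') (j + j') (n + n')"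
  unfolding adm_def
proof
  fix k assume "\<forall>k. 2 ^ k * n \<le> 2 ^ k * (j + k * i) + n" "\<forall>k. 2 ^ k * n' \<le> 2 ^ k * (j' + k * i') + n'"
  then have "2 ^ k * n + 2 ^ k * n' \<le> (2 ^ k * (j + k * i) + n) + (2 ^ k * (j' + k * i') + n')"
    by (intro add_mono) blast+
  then show "2 ^ k * (n + n') \<le> 2 ^ k * (j + j' + k * (i + i')) + (n + n')"
    by (simp add: algebra_simps)
qed

lemma adm_0 [simp]: "adm i j 0"
  by (simp add: adm_def)

lemma adm_Suc: "adm i j (Suc n) \<Longrightarrow> adm i j n"
  unfolding adm_def
proof
  fix k assume *: "\<forall>k. 2 ^ k * Suc n \<le> 2 ^ k * (j + k * i) + Suc n"
  have "(1::nat) \<le> 2 ^ k"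
    by simp
  then show "2 ^ k * n \<le> 2 ^ k * (j + k * i) + n"
    using spec[OF *, of k] unfolding mult_Suc_right by linarith
qed

lemma adm_Y [simp]: "adm 0 n n"
  by (simp add: adm_def)

lemma adm_X [simp]: "adm n 0 n"
  unfolding adm_def
proof
  show "2 ^ k * n \<le> 2 ^ k * (0 + k * n) + n" for k
    by (cases k) (auto simp: trans_le_add1)
qed

lemma adm_mono: "adm i j n \<Longrightarrow> i \<le> i' \<Longrightarrow> j \<le> j' \<Longrightarrow> adm i' j' n"
  using adm_add[of i j n "i' - i" "j' - j" 0] by simp

lemma not_adm_0: "n > 0 \<Longrightarrow> \<not> adm 0 0 n"
  unfolding adm_def by (auto intro: exI[of _ 1])

text \<open>Two inequalities add up to an equality only if both are equalities; this makes an edge a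
  face of the cone.\<close>

lemma on_edge_add:
  assumes "adm i j n" "adm i' j' n'"
  shows "on_edge k (i + i') (j + j') (n + n') \<longleftrightarrow> on_edge k i j n \<and> on_edge k i' j' n'"
  using admD[OF assms(1), of k] admD[OF assms(2), of k] by (auto simp: on_edge_def algebra_simps)

lemma fps_fps_mult_nth:
  "(f * g) $ i $ j = (\<Sum>(a, b) \<in> {..i} \<times> {..j}. f $ a $ b * g $ (i - a) $ (j - b))"
  for f g :: "'a::comm_ring_1 fps fps"
  unfolding fps_mult_nth fps_sum_nth
  by (simp add: fps_mult_nth sum.cartesian_product atLeast0AtMost)

lemma fps_fps_monomial_nth:
  "(fps_X ^ i * fps_Y ^ j :: 'a::field fps fps) $ a $ b = (if a = i \<and> b = j then 1 else 0)"
proof -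
  have "fps_Y ^ j = (fps_const (fps_X ^ j) :: 'a fps fps)"
    by (simp add: fps_const_power)
  then show ?thesis
    by (simp add: fps_X_power_mult_nth fps_X_power_nth)
qed

lemma filt_mult:
  assumes "f \<in> filt m" "g \<in> filt n"
  shows "f * g \<in> filt (m + n)"
  unfolding filt_def
proof (intro CollectI allI impI)
  fix i j assume "(f * g) $ i $ j \<noteq> 0"
  then obtain a b where ab: "a \<le> i" "b \<le> j" "f $ a $ b \<noteq> 0" "g $ (i - a) $ (j - b) \<noteq> 0"
    unfolding fps_fps_mult_nth by (force elim: sum.not_neutral_contains_not_neutral)
  then have "adm (a + (i - a)) (b + (j - b)) (m + n)"
    using assms by (intro adm_add) (auto simp: filt_def)
  then show "adm i j (m + n)"
    using ab by simp
qed

lemma filt_0: "filt 0 = UNIV"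
  by (simp add: filt_def)

lemma ideal_filt: "ideal_in UNIV (filt n)"
  unfolding ideal_in_def
proof (intro conjI ballI)
  show "a + b \<in> filt n" if "a \<in> filt n" "b \<in> filt n" for a b :: "'a fps fps"
    unfolding filt_def
  proof (intro CollectI allI impI)
    fix i j assume "(a + b) $ i $ j \<noteq> 0"
    then have "a $ i $ j \<noteq> 0 \<or> b $ i $ j \<noteq> 0"
      by auto
    then show "adm i j n"
      using that by (auto simp: filt_def)
  qed
  show "a * b \<in> filt n" if "b \<in> filt n" for a b :: "'a fps fps"
    using filt_mult[of a 0 b n] that by (simp add: filt_0)
qed (auto simp: filt_def)

lemma zero_filt [simp]: "0 \<in> filt n"
  by (rule ideal_inD(2)[OF ideal_filt])

lemma monomial_filt: "adm i j n \<Longrightarrow> fps_X ^ i * fps_Y ^ j \<in> filt n"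
  unfolding filt_def mem_Collect_eq fps_fps_monomial_nth by auto

lemma graded_filtration_filt: "graded_filtration (type_ring :: 'a::field fps fps ring) filt"
  unfolding graded_filtration_def graded_family_def
proof (intro conjI allI)
  show "ideal (filt n) (type_ring :: 'a fps fps ring)" for n
    using type_ring.ideal_image[of "filt n"] by (simp add: ideal_filt)
  show "ideal_prod (type_ring :: 'a fps fps ring) (filt m) (filt n) \<subseteq> filt (m + n)" for m n
  proof
    fix f :: "'a fps fps"
    assume "f \<in> ideal_prod type_ring (filt m) (filt n)"
    then show "f \<in> filt (m + n)"
      by induction (auto simp: filt_mult intro: ideal_inD(3)[OF ideal_filt])
  qed
  show "(filt (Suc n) :: 'a fps fps set) \<subseteq> filt n" for n
    by (auto simp: filt_def intro: adm_Suc)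
qed (simp add: filt_0)

text \<open>Each term of the binomial expansion contains one of the two elements with exponent at
  least \<open>n\<close>.\<close>

lemma ideal_power_add:
  assumes P: "ideal_in UNIV P" and a: "a ^ n \<in> P" and b: "b ^ n \<in> P"
  shows "(a + b) ^ (2 * n) \<in> P"
  unfolding binomial_ring
proof (rule ideal_in_sum[OF P])
  fix k assume "k \<in> {..2 * n}"
  have *: "c ^ k \<in> P" if "c ^ n \<in> P" "n \<le> k" for c k
    using ideal_inD(5)[OF P _ that(1), of "c ^ (k - n)"] that(2) by (simp flip: power_add)
  show "of_nat (2 * n choose k) * a ^ k * b ^ (2 * n - k) \<in> P"
  proof (cases "n \<le> k")
    case True
    then show ?thesis
      using ideal_inD(4,5)[OF P UNIV_I] *[OF a] by blast
  next
    case False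
    then show ?thesis
      using ideal_inD(4)[OF P UNIV_I *[OF b]] by simp
  qed
qed

text \<open>The radical contains \<open>x\<close> and \<open>y\<close> because \<open>x^n\<close>
  and \<open>y^n\<close> lie in \<open>I_n\<close>; elements outside the maximal ideal are units and
  can be cancelled.\<close>

lemma primary_filt:
  assumes "n > 0"
  shows "primary_to (type_ring :: 'a::field fps fps ring) max_ideal (filt n)"
proof -
  have one: "1 \<notin> (filt n :: 'a fps fps set)"
    using not_adm_0[OF assms] by (auto simp: filt_def intro!: exI[of _ 0])
  have rad: "ideal_radical (type_ring :: 'a fps fps ring) (filt n) = max_ideal"
  proof (intro equalityI subsetI)
    fix f :: "'a fps fps"
    assume "f \<in> ideal_radical type_ring (filt n)"
    then obtain k where k: "f ^ k \<in> filt n"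
      by (auto simp: ideal_radical_def)
    have "filt n \<subseteq> (max_ideal :: 'a fps fps set)"
      by (rule proper_ideal_subset_max_ideal[OF ideal_filt one])
    then show "f \<in> max_ideal"
      using k type_ring.prime_power[OF prime_max_ideal] by blast
  next
    fix f :: "'a fps fps"
    assume "f \<in> max_ideal"
    then obtain g where g: "f $ 0 = fps_X * g"
      using fps_nth_0_eq_0_iff[of "f $ 0"] by (auto simp: max_ideal_def)
    have f: "f = fps_Y * fps_const g + fps_X * fps_shift 1 f"
      using fps_head_tail[of f] unfolding g by simp
    have "(fps_Y :: 'a fps fps) ^ n \<in> filt n" "(fps_X :: 'a fps fps) ^ n \<in> filt n"
      using monomial_filt[OF adm_Y[of n]] monomial_filt[OF adm_X[of n]] by simp_all
    then have "(fps_Y * fps_const g) ^ n \<in> filt n" "(fps_X * fps_shift 1 f) ^ n \<in> filt n"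
      unfolding power_mult_distrib using ideal_inD(5)[OF ideal_filt UNIV_I] by blast+
    then have "f ^ (2 * n) \<in> filt n"
      by (subst f) (rule ideal_power_add[OF ideal_filt])
    then show "f \<in> ideal_radical type_ring (filt n)"
      by (auto simp: ideal_radical_def)
  qed
  have "a \<in> filt n" if "a * b \<in> filt n" "b \<notin> max_ideal" for a b :: "'a fps fps"
  proof -
    obtain c where "b * c = 1"
      using unit_fps_fps[OF \<open>b \<notin> max_ideal\<close>] .
    then show ?thesis
      using ideal_inD(5)[OF ideal_filt UNIV_I that(1), of c] by (simp add: mult.assoc)
  qed
  moreover have "ideal (filt n) (type_ring :: 'a fps fps ring)"
    using type_ring.ideal_image[of "filt n"] by (simp add: ideal_filt)
  ultimately show ?thesis
    using one unfolding primary_to_def primary_ideal_def rad by auto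
qed

section \<open>The Rees algebra as a ring of polynomials\<close>

abbreviation rees :: "('a::field fps fps, nat \<Rightarrow> 'a fps fps) up_ring" where
  "rees \<equiv> rees_algebra type_ring filt"

abbreviation rees_gr :: "nat \<Rightarrow> (nat \<Rightarrow> 'a::field fps fps) set" where
  "rees_gr \<equiv> rees_grading type_ring filt"

definition rees_poly :: "'a::field fps fps poly set" where
  "rees_poly = {p. \<forall>n. coeff p n \<in> filt n}"

lemma up_type_ring: "up (type_ring :: 'a::comm_ring_1 ring) = range coeff"
proof
  show "up (type_ring :: 'a ring) \<subseteq> range coeff"
  proof
    fix f assume "f \<in> up (type_ring :: 'a ring)"
    then obtain n where "bound 0 n f"
      by (auto simp: up_def)
    then have "\<forall>m>n. f m = 0"
      by (auto simp: bound_def)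
    then have "coeff (Abs_poly f) = f"
      by (intro coeff_Abs_poly) auto
    then show "f \<in> range coeff"
      by (metis rangeI)
  qed
  show "range coeff \<subseteq> up (type_ring :: 'a ring)"
    by (auto simp: up_def bound_def intro!: exI[of _ "degree _"] coeff_eq_0)
qed

lemma inj_coeff: "inj coeff"
  by (simp add: inj_def poly_eqI)

lemma carrier_rees: "carrier rees = coeff ` rees_poly"
  by (auto simp: rees_algebra_def UP_def up_type_ring rees_poly_def)

lemma monom_rees_poly_iff: "monom h n \<in> rees_poly \<longleftrightarrow> h \<in> filt n"
  by (auto simp: rees_poly_def)

global_interpretation rees: concrete_ring "rees :: ('a::field fps fps, nat \<Rightarrow> 'a fps fps) up_ring" coeff rees_poly
proof
  fix x y :: "'a fps fps poly"
  assume *: "x \<in> rees_poly" "y \<in> rees_poly"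
  show "x * y \<in> rees_poly"
    unfolding rees_poly_def
  proof (intro CollectI allI)
    fix n
    have "coeff x i * coeff y (n - i) \<in> filt n" if "i \<in> {..n}" for i
      using filt_mult[of "coeff x i" i "coeff y (n - i)" "n - i"] * that by (auto simp: rees_poly_def)
    then show "coeff (x * y) n \<in> filt n"
      unfolding coeff_mult by (rule ideal_in_sum[OF ideal_filt])
  qed
  show "x + y \<in> rees_poly"
    using * by (auto simp: rees_poly_def intro: ideal_inD(3)[OF ideal_filt])
  show "coeff x \<oplus>\<^bsub>rees\<^esub> coeff y = coeff (x + y)"
    by (rule ext) (simp add: rees_algebra_def UP_def up_type_ring)
  show "coeff x \<otimes>\<^bsub>rees\<^esub> coeff y = coeff (x * y)"
    by (rule ext) (simp add: rees_algebra_def UP_def up_type_ring coeff_mult)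
next
  fix x :: "'a fps fps poly"
  assume "x \<in> rees_poly"
  then show "- x \<in> rees_poly"
    by (auto simp: rees_poly_def filt_def)
next
  show "1 \<in> (rees_poly :: 'a fps fps poly set)"
    by (auto simp: rees_poly_def filt_0 coeff_1)
  show "carrier (rees :: ('a fps fps, nat \<Rightarrow> 'a fps fps) up_ring) = coeff ` rees_poly"
    by (rule carrier_rees)
qed (auto simp: inj_coeff rees_poly_def rees_algebra_def UP_def fun_eq_iff coeff_1)

lemma rees_gr: "rees_gr n = coeff ` {monom h n | h. h \<in> filt n}"
proof (intro equalityI subsetI)
  fix f :: "nat \<Rightarrow> 'a fps fps"
  assume f: "f \<in> rees_gr n"
  then obtain p where p: "p \<in> rees_poly" "f = coeff p"
    unfolding rees_grading_def carrier_rees by blast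
  then have "\<forall>k. k \<noteq> n \<longrightarrow> coeff p k = 0"
    using f by (simp add: rees_grading_def UP_def up_type_ring)
  then have "p = monom (coeff p n) n"
    by (intro poly_eqI) auto
  moreover have "coeff p n \<in> filt n"
    using p by (simp add: rees_poly_def)
  ultimately show "f \<in> coeff ` {monom h n | h. h \<in> filt n}"
    using p(2) by blast
next
  fix f :: "nat \<Rightarrow> 'a fps fps"
  assume "f \<in> coeff ` {monom h n | h. h \<in> filt n}"
  then obtain h where h: "h \<in> filt n" "f = coeff (monom h n)"
    by blast
  then have "f \<in> coeff ` rees_poly"
    by (simp only: rees.mem_iff monom_rees_poly_iff)
  then show "f \<in> rees_gr n"
    using h(2) by (simp add: rees_grading_def carrier_rees UP_def up_type_ring)
qed

lemma rees_gr_subset: "rees_gr n \<subseteq> carrier rees"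
  by (auto simp: rees_grading_def)

definition homogeneous_in :: "'a::field fps fps poly set \<Rightarrow> bool" where
  "homogeneous_in P \<longleftrightarrow> (\<forall>f\<in>P. \<forall>n. monom (coeff f n) n \<in> P)"

text \<open>The members of \<open>P\<close> whose components all lie in \<open>P\<close> form an
  ideal \<open>K\<close>, as components of a product are convolutions. It contains the homogeneous
  elements of \<open>P\<close>, hence everything they generate. Conversely a polynomial is the sum
  of its components.\<close>

lemma homogeneous_ideal_image:
  fixes P :: "'a::field fps fps poly set"
  assumes P: "ideal_in rees_poly P"
  shows "homogeneous_ideal rees rees_gr (coeff ` P) \<longleftrightarrow> homogeneous_in P"
proof -
  note D = ideal_inD[OF P]
  interpret S: cring "rees :: ('a fps fps, nat \<Rightarrow> 'a fps fps) up_ring"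
    by (rule rees.cring)
  define E where "E = {monom h n | h n. h \<in> filt n \<and> monom h n \<in> P}"
  have E: "coeff ` P \<inter> (\<Union>n. rees_gr n) = coeff ` E"
  proof -
    have "(\<Union>n. rees_gr n) = coeff ` {monom h n | (h :: 'a fps fps) n. h \<in> filt n}"
      unfolding rees_gr by blast
    then have "coeff ` P \<inter> (\<Union>n. rees_gr n) = coeff ` (P \<inter> {monom h n | h n. h \<in> filt n})"
      by (simp only: image_Int[OF inj_coeff])
    also have "P \<inter> {monom h n | h n. h \<in> filt n} = E"
      unfolding E_def by blast
    finally show ?thesis .
  qed
  have E_sub: "E \<subseteq> P" "E \<subseteq> rees_poly"
    using D(1) by (auto simp: E_def)
  have c: "coeff f n \<in> filt n" if "f \<in> P" for f n
    using that D(1) by (auto simp: rees_poly_def)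
  define K where "K = {f \<in> P. \<forall>n. monom (coeff f n) n \<in> P}"
  have K: "ideal_in rees_poly K"
    unfolding ideal_in_def
  proof (intro conjI ballI)
    show "a + b \<in> K" if "a \<in> K" "b \<in> K" for a b
      using that D(3) by (auto simp: K_def simp flip: add_monom)
    show "a * b \<in> K" if ab: "a \<in> rees_poly" "b \<in> K" for a b
    proof -
      have "monom (coeff (a * b) n) n \<in> P" for n
      proof -
        have "monom (coeff (a * b) n) n = (\<Sum>i\<le>n. monom (coeff a i) i * monom (coeff b (n - i)) (n - i))"
          by (simp add: coeff_mult mult_monom monom_sum)
        also have "\<dots> \<in> P"
          using ab by (intro ideal_in_sum[OF P] D(4)) (auto simp: K_def monom_rees_poly_iff rees_poly_def)
        finally show ?thesis .
      qed
      then show ?thesis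
        using ab D(4) by (auto simp: K_def)
    qed
  qed (use D in \<open>auto simp: K_def\<close>)
  have "coeff ` E \<subseteq> carrier rees"
    unfolding carrier_rees using E_sub by blast
  then have genE: "ideal (Idl\<^bsub>rees\<^esub> (coeff ` E)) (rees :: ('a fps fps, nat \<Rightarrow> 'a fps fps) up_ring)"
    "coeff ` E \<subseteq> Idl\<^bsub>rees\<^esub> (coeff ` E)"
    by (rule S.genideal_ideal, rule S.genideal_self)
  show ?thesis
  proof
    assume "homogeneous_ideal rees rees_gr (coeff ` P)"
    then have "coeff ` P = Idl\<^bsub>rees\<^esub> (coeff ` E)"
      unfolding homogeneous_ideal_def E by blast
    moreover have "E \<subseteq> K"
      using D(2) by (auto simp: E_def K_def)
    then have "Idl\<^bsub>rees\<^esub> (coeff ` E) \<subseteq> coeff ` K"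
      using rees.genideal_subset_iff[OF E_sub(2) K] by blast
    ultimately have "P \<subseteq> K"
      using inj_image_subset_iff[OF inj_coeff] by metis
    then show "homogeneous_in P"
      by (auto simp: homogeneous_in_def K_def)
  next
    assume hom: "homogeneous_in P"
    obtain L where L: "ideal_in rees_poly L" "Idl\<^bsub>rees\<^esub> (coeff ` E) = coeff ` L"
      using genE(1) unfolding rees.ideal_iff by blast
    have EL: "E \<subseteq> L"
      using genE(2) unfolding L(2) inj_image_subset_iff[OF inj_coeff] .
    have "P \<subseteq> L"
    proof
      fix f assume f: "f \<in> P"
      have "f = (\<Sum>i\<le>degree f. monom (coeff f i) i)"
        by (rule poly_as_sum_of_monoms[symmetric])
      also have "\<dots> \<in> L"
      proof (rule ideal_in_sum[OF L(1)])
        have "monom (coeff f i) i \<in> E" for i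
          using f hom c[OF f] unfolding homogeneous_in_def E_def by blast
        then show "monom (coeff f i) i \<in> L" for i
          using EL by blast
      qed
      finally show "f \<in> L" .
    qed
    moreover have "L \<subseteq> P"
      using rees.genideal_subset_iff[OF E_sub(2) P] E_sub(1) L(2) inj_image_subset_iff[OF inj_coeff]
      by metis
    ultimately have "coeff ` P = Idl\<^bsub>rees\<^esub> (coeff ` E)"
      using L(2) by simp
    then show "homogeneous_ideal rees rees_gr (coeff ` P)"
      unfolding homogeneous_ideal_def E rees.ideal_image using P by blast
  qed
qed

definition proj_in :: "'a::field fps fps poly set \<Rightarrow> bool" where
  "proj_in P \<longleftrightarrow> prime_in rees_poly P \<and> homogeneous_in P \<and> (\<exists>n>0. \<exists>h\<in>filt n. monom h n \<notin> P)"

lemma proj_inD: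
  assumes "proj_in P"
  shows "prime_in rees_poly P" "ideal_in rees_poly P" "homogeneous_in P"
    "f \<in> P \<Longrightarrow> monom (coeff f n) n \<in> P" "\<exists>n>0. \<exists>h\<in>filt n. monom h n \<notin> P"
  using assms prime_inD(1) by (auto simp: proj_in_def homogeneous_in_def)

lemma proj_points_image:
  fixes P :: "'a::field fps fps poly set"
  shows "coeff ` P \<in> proj_points rees rees_gr \<longleftrightarrow> proj_in P"
proof -
  have "(\<Union>n\<in>{0<..}. rees_gr n) = coeff ` {monom h n | (h :: 'a fps fps) n. 0 < n \<and> h \<in> filt n}"
    unfolding rees_gr by blast
  then have "(\<Union>n\<in>{0<..}. rees_gr n) \<subseteq> coeff ` P \<longleftrightarrow> (\<forall>n>0. \<forall>h\<in>filt n. monom h n \<in> P)"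
    by (simp only: inj_image_subset_iff[OF inj_coeff]) blast
  then show ?thesis
    unfolding proj_points_def proj_in_def mem_Collect_eq rees.primeideal_image
    using homogeneous_ideal_image[of P] prime_inD(1)[of rees_poly P] by blast
qed

lemma proj_points_rees: "proj_points rees rees_gr = (`) coeff ` {P. proj_in P}"
proof (intro equalityI subsetI)
  fix p :: "(nat \<Rightarrow> 'a fps fps) set"
  assume p: "p \<in> proj_points rees rees_gr"
  then have "primeideal p rees"
    by (simp add: proj_points_def)
  then obtain P where "p = coeff ` P"
    unfolding rees.primeideal_iff by blast
  then show "p \<in> (`) coeff ` {P. proj_in P}"
    using p proj_points_image by blast
qed (use proj_points_image in auto)

text \<open>Homogeneity passes to intersections component by component, and a positive degree
  element missing from one member is missing from the intersection.\<close>

lemma prime_space_rees: "prime_space (rees :: ('a::field fps fps, nat \<Rightarrow> 'a fps fps) up_ring) (proj_points rees rees_gr)"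
proof (rule prime_space.intro[OF rees.cring])
  fix Z :: "(nat \<Rightarrow> 'a fps fps) set set"
  assume Z: "Z \<subseteq> proj_points rees rees_gr" "Z \<noteq> {}" "primeideal (\<Inter>Z) rees"
  obtain Q where Q: "prime_in rees_poly Q" "\<Inter>Z = coeff ` Q"
    using Z(3) unfolding rees.primeideal_iff by blast
  have sub: "\<exists>P. p = coeff ` P \<and> proj_in P \<and> Q \<subseteq> P" if "p \<in> Z" for p
  proof -
    obtain P where "p = coeff ` P" "proj_in P"
      using \<open>p \<in> Z\<close> Z(1) unfolding proj_points_rees by blast
    moreover have "coeff ` Q \<subseteq> p"
      using Q(2) that by blast
    ultimately show ?thesis
      using inj_image_subset_iff[OF inj_coeff] by blast
  qed
  have "proj_in Q"
    unfolding proj_in_def homogeneous_in_def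
  proof (intro conjI ballI allI)
    fix f n assume f: "f \<in> Q"
    have "coeff (monom (coeff f n) n) \<in> p" if p: "p \<in> Z" for p
    proof -
      obtain P where "p = coeff ` P" "proj_in P" "Q \<subseteq> P"
        using sub[OF p] by blast
      then show ?thesis
        using f proj_inD(4) by blast
    qed
    then have "coeff (monom (coeff f n) n) \<in> coeff ` Q"
      using Q(2) by blast
    then show "monom (coeff f n) n \<in> Q"
      by (simp only: rees.mem_iff)
  next
    obtain p where "p \<in> Z"
      using Z(2) by blast
    then obtain P where "proj_in P" "Q \<subseteq> P"
      using sub by blast
    then show "\<exists>n>0. \<exists>h\<in>filt n. monom h n \<notin> Q"
      using proj_inD(5) by blast
  qed (rule Q)
  then show "\<Inter>Z \<in> proj_points rees rees_gr"
    unfolding Q(2) proj_points_image .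
qed (simp add: proj_points_def)

text \<open>Records what is used about the extended maximal ideal: the ideals that contain it, and
  its homogeneity, which holds because its generators have degree \<open>0\<close>.\<close>

lemma rees_extension_max_ideal:
  obtains K :: "'a::field fps fps poly set" where
    "rees_extension type_ring filt max_ideal = coeff ` K"
    "\<And>P. ideal_in rees_poly P \<Longrightarrow> K \<subseteq> P \<longleftrightarrow> (\<forall>a\<in>max_ideal. monom a 0 \<in> P)"
    "homogeneous_ideal rees rees_gr (coeff ` K)"
proof -
  interpret S: cring "rees :: ('a fps fps, nat \<Rightarrow> 'a fps fps) up_ring"
    by (rule rees.cring)
  let ?J = "rees_extension (type_ring :: 'a fps fps ring) filt max_ideal"
  define E where "E = {monom a 0 | a :: 'a fps fps. a \<in> max_ideal}"
  have E: "E \<subseteq> rees_poly"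
    by (auto simp: E_def monom_rees_poly_iff filt_0)
  have "up_ring.monom (UP type_ring) a 0 = coeff (monom a 0)" for a :: "'a fps fps"
    by (simp add: UP_def fun_eq_iff)
  then have J: "?J = Idl\<^bsub>rees\<^esub> (coeff ` E)"
    unfolding rees_extension_def E_def by (simp add: image_image setcompr_eq_image)
  have "coeff ` E \<subseteq> carrier rees"
    using E by (auto simp: carrier_rees)
  then have gen: "ideal ?J rees" "coeff ` E \<subseteq> ?J"
    unfolding J by (rule S.genideal_ideal, rule S.genideal_self)
  then obtain K where K: "?J = coeff ` K" "ideal_in rees_poly K"
    unfolding rees.ideal_iff by blast
  have K_sub: "K \<subseteq> P \<longleftrightarrow> E \<subseteq> P" if "ideal_in rees_poly P" for P
    using rees.genideal_subset_iff[OF E that] unfolding J[symmetric] K inj_image_subset_iff[OF inj_coeff] .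
  have "E \<subseteq> K"
    using K_sub[OF K(2)] by blast
  have "homogeneous_ideal rees rees_gr (coeff ` K)"
    unfolding homogeneous_ideal_def
  proof (intro conjI equalityI)
    show "ideal (coeff ` K) rees"
      using K(2) by (simp add: rees.ideal_image)
    define H where "H = coeff ` K \<inter> (\<Union>n. rees_gr n)"
    have H: "H \<subseteq> carrier rees"
      using rees_gr_subset unfolding H_def by blast
    show "Idl\<^bsub>rees\<^esub> (coeff ` K \<inter> (\<Union>n. rees_gr n)) \<subseteq> coeff ` K"
      using K(2) by (intro S.genideal_minimal) (auto simp: rees.ideal_image)
    have "coeff ` E \<subseteq> (\<Union>n. rees_gr n)"
      by (force simp: E_def rees_gr filt_0)
    then have "coeff ` E \<subseteq> Idl\<^bsub>rees\<^esub> H"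
      using S.genideal_self[OF H] \<open>E \<subseteq> K\<close> unfolding H_def by blast
    then have "Idl\<^bsub>rees\<^esub> (coeff ` E) \<subseteq> Idl\<^bsub>rees\<^esub> H"
      by (rule S.genideal_minimal[OF S.genideal_ideal[OF H]])
    then show "coeff ` K \<subseteq> Idl\<^bsub>rees\<^esub> (coeff ` K \<inter> (\<Union>n. rees_gr n))"
      by (simp only: K(1)[symmetric] J H_def)
  qed
  then show ?thesis
    using that[of K] K K_sub by (auto simp: E_def)
qed

section \<open>Monomials\<close>

definition mon :: "nat \<Rightarrow> nat \<Rightarrow> nat \<Rightarrow> 'a::field fps fps poly" where
  "mon i j n = monom (fps_X ^ i * fps_Y ^ j) n"

definition cst :: "'a::field \<Rightarrow> 'a fps fps poly" where
  "cst c = monom (fps_const (fps_const c)) 0"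

lemma coeff_mon: "coeff (mon i j n) n' $ a $ b = (if n' = n \<and> a = i \<and> b = j then 1 else 0)"
  by (simp add: mon_def fps_fps_monomial_nth)

lemma mon_mult: "mon i j n * mon i' j' n' = mon (i + i') (j + j') (n + n')"
  by (simp add: mon_def mult_monom power_add ac_simps)

lemma mon_0 [simp]: "mon 0 0 0 = 1"
  by (simp add: mon_def monom_0)

lemma mon_power: "mon i j n ^ p = mon (p * i) (p * j) (p * n)"
  by (induction p) (simp_all add: mon_mult)

lemma mon_rees_poly_iff [simp]: "mon i j n \<in> rees_poly \<longleftrightarrow> adm i j n"
proof -
  have "fps_X ^ i * fps_Y ^ j \<in> (filt n :: 'a fps fps set) \<longleftrightarrow> adm i j n"
    unfolding filt_def mem_Collect_eq fps_fps_monomial_nth by auto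
  then show ?thesis
    by (simp add: mon_def monom_rees_poly_iff)
qed

lemma cst_rees_poly [simp]: "cst c \<in> rees_poly"
  by (simp add: cst_def monom_rees_poly_iff filt_0)

lemma cst_simps: "cst 0 = 0" "cst 1 = 1" "cst (a + b) = cst a + cst b" "cst (a * b) = cst a * cst b"
  by (simp_all add: cst_def monom_0 add_monom mult_monom mult.commute)

lemma cst_power: "cst (a ^ n) = cst a ^ n"
  by (induction n) (simp_all add: cst_simps)

lemma cst_mult_mem_iff:
  assumes "ideal_in rees_poly P" "c \<noteq> 0"
  shows "cst c * f \<in> P \<longleftrightarrow> f \<in> P"
proof
  assume "cst c * f \<in> P"
  then have "cst (inverse c) * (cst c * f) \<in> P"
    by (rule ideal_inD(4)[OF assms(1) cst_rees_poly])
  moreover have "cst (inverse c) * (cst c * f) = f"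
    using assms(2) by (simp only: mult.assoc[symmetric] cst_simps(4)[symmetric]) (simp add: cst_simps)
  ultimately show "f \<in> P"
    by simp
qed (rule ideal_inD(4)[OF assms(1)], simp_all)

lemma poly_mem:
  assumes "ideal_in rees_poly P" "\<And>n. monom (coeff f n) n \<in> P"
  shows "f \<in> P"
proof -
  have "(\<Sum>i\<le>degree f. monom (coeff f i) i) \<in> P"
    by (rule ideal_in_sum[OF assms(1)]) (rule assms(2))
  then show ?thesis
    by (simp only: poly_as_sum_of_monoms)
qed

text \<open>For an ideal this says that it contains \<open>m R[I]\<close>; for a point of Proj, that
  it lies on the closed fiber.\<close>

definition over_max :: "'a::field fps fps poly set \<Rightarrow> bool" where
  "over_max P \<longleftrightarrow> (\<forall>a\<in>max_ideal. monom a 0 \<in> P)"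

lemma over_max_X: "over_max P \<Longrightarrow> monom fps_X 0 \<in> P"
  by (simp add: over_max_def max_ideal_def)

lemma over_max_Y: "over_max P \<Longrightarrow> monom fps_Y 0 \<in> P"
  by (simp add: over_max_def max_ideal_def)

lemma over_max_mono: "over_max P \<Longrightarrow> P \<subseteq> Q \<Longrightarrow> over_max Q"
  by (auto simp: over_max_def)

text \<open>The basic vanishing rule in the fiber: a monomial that is still admissible after
  division by \<open>x\<close> or \<open>y\<close> is a multiple of an element of the maximal ideal
  in degree \<open>0\<close>.\<close>

lemma mon_Suc_mem:
  assumes P: "ideal_in rees_poly P" and m: "over_max P" and adm: "adm i j n"
  shows "mon (Suc i) j n \<in> P" "mon i (Suc j) n \<in> P"
proof -
  have "monom fps_X 0 * mon i j n \<in> P" "monom fps_Y 0 * mon i j n \<in> P"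
    using adm by (intro ideal_inD(5)[OF P] over_max_X[OF m] over_max_Y[OF m]; simp)+
  then show "mon (Suc i) j n \<in> P" "mon i (Suc j) n \<in> P"
    by (simp_all add: mon_def mult_monom mult.left_commute mult.assoc del: fps_const_power fps_const_mult)
qed

lemma mon_big_mem:
  assumes "ideal_in rees_poly P" "over_max P" "n < i \<or> n < j"
  shows "mon i j n \<in> P"
  using assms(3)
proof
  assume "n < i"
  then obtain i' where "i = Suc i'" "n \<le> i'"
    by (cases i) auto
  then show ?thesis
    using mon_Suc_mem(1)[OF assms(1,2) adm_mono[OF adm_X[of n]]] by simp
next
  assume "n < j"
  then obtain j' where "j = Suc j'" "n \<le> j'"
    by (cases j) auto
  then show ?thesis
    using mon_Suc_mem(2)[OF assms(1,2) adm_mono[OF adm_Y[of n]]] by simp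
qed

lemma fps_split:
  fixes h :: "'a::comm_ring_1 fps"
  shows "h = (\<Sum>i<n. fps_X ^ i * fps_const (h $ i)) + fps_X ^ n * fps_shift n h"
proof (induction n)
  case (Suc n)
  have "fps_shift n h = fps_const (h $ n) + fps_X * fps_shift (Suc n) h"
    by (rule fps_ext) (auto simp: fps_X_mult_nth)
  then show ?case
    using Suc by (simp add: algebra_simps)
qed simp

text \<open>Modulo the maximal ideal only finitely many columns of a power series matter, since
  \<open>x\<^sup>n\<close> lies in \<open>I\<^sub>n\<close>.\<close>

lemma monom_mem:
  fixes h :: "'a::field fps fps"
  assumes P: "ideal_in rees_poly P" and m: "over_max P"
    and mem: "\<And>i j. h $ i $ j \<noteq> 0 \<Longrightarrow> mon i j n \<in> P"
  shows "monom h n \<in> P"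
proof -
  have const: "monom g 0 \<in> rees_poly" for g :: "'a fps fps"
    by (simp add: monom_rees_poly_iff filt_0)
  have "monom (fps_X ^ i * fps_const (h $ i)) n \<in> P" for i
  proof (cases "h $ i = 0")
    case True
    then show ?thesis
      using ideal_inD(2)[OF P] by simp
  next
    case False
    define d where "d = subdegree (h $ i)"
    have "h $ i = fps_X ^ d * fps_shift d (h $ i)"
      using subdegree_decompose[of "h $ i"] by (simp add: d_def mult.commute)
    then have "fps_const (h $ i) = fps_Y ^ d * fps_const (fps_shift d (h $ i))"
      by (metis fps_const_mult fps_const_power)
    then have "monom (fps_X ^ i * fps_const (h $ i)) n = mon i d n * monom (fps_const (fps_shift d (h $ i))) 0"
      by (simp add: mon_def mult_monom mult.assoc)
    moreover have "mon i d n \<in> P"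
      using False by (intro mem) (simp add: d_def)
    ultimately show ?thesis
      using ideal_inD(5)[OF P const] by simp
  qed
  then have A: "(\<Sum>i<Suc n. monom (fps_X ^ i * fps_const (h $ i)) n) \<in> P"
    by (intro ideal_in_sum[OF P])
  have B: "mon (Suc n) 0 n * monom (fps_shift (Suc n) h) 0 \<in> P"
    by (intro ideal_inD(5)[OF P const] mon_big_mem[OF P m]) simp
  have "monom h n = monom ((\<Sum>i<Suc n. fps_X ^ i * fps_const (h $ i)) +
      fps_X ^ Suc n * fps_shift (Suc n) h) n"
    using fps_split[of h "Suc n"] by (rule arg_cong)
  then have "monom h n = (\<Sum>i<Suc n. monom (fps_X ^ i * fps_const (h $ i)) n) +
      mon (Suc n) 0 n * monom (fps_shift (Suc n) h) 0"
    by (simp add: mon_def mult_monom monom_sum del: sum.lessThan_Suc power_Suc flip: add_monom)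
  then show ?thesis
    using ideal_inD(3)[OF P A B] by (simp only:)
qed

text \<open>Exponents beyond \<open>n\<close> vanish in degree \<open>n\<close> of the fiber, which
  turns a power series into a finite linear combination of monomials.\<close>

lemma monom_mem_sum:
  fixes h :: "'a::field fps fps"
  assumes P: "ideal_in rees_poly P" and m: "over_max P"
  shows "monom h n - (\<Sum>(i, j) \<in> {..n} \<times> {..n}. cst (h $ i $ j) * mon i j n) \<in> P"
proof -
  let ?s = "\<Sum>(i, j) \<in> {..n} \<times> {..n}. fps_const (fps_const (h $ i $ j)) * (fps_X ^ i * fps_Y ^ j)"
  have s: "?s $ a $ b = (if a \<le> n \<and> b \<le> n then h $ a $ b else 0)" for a b
  proof -
    have "?s $ a $ b = (\<Sum>p \<in> {..n} \<times> {..n}. if (a, b) = p then h $ a $ b else 0)"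
      unfolding fps_sum_nth
      by (intro sum.cong) (auto simp: fps_fps_monomial_nth split: if_splits simp del: fps_const_mult fps_const_power)
    then show ?thesis
      by simp
  qed
  have "monom (h - ?s) n \<in> P"
  proof (rule monom_mem[OF P m])
    fix i j assume "(h - ?s) $ i $ j \<noteq> 0"
    then have "n < i \<or> n < j"
      using s[of i j] by (auto split: if_splits)
    then show "mon i j n \<in> P"
      by (rule mon_big_mem[OF P m])
  qed
  moreover have "monom ?s n = (\<Sum>(i, j) \<in> {..n} \<times> {..n}. cst (h $ i $ j) * mon i j n)"
    unfolding monom_sum by (intro sum.cong) (auto simp: cst_def mon_def mult_monom)
  ultimately show ?thesis
    by (simp add: diff_monom[symmetric])
qed

section \<open>Primes from faces\<close>

text \<open>Among the admissible exponents, the complement of \<open>\<Phi>\<close> is a prime ideal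
  of the monoid; this is the algebraic form of a face of the cone.\<close>

definition face :: "(nat \<Rightarrow> nat \<Rightarrow> nat \<Rightarrow> bool) \<Rightarrow> bool" where
  "face \<Phi> \<longleftrightarrow> \<Phi> 0 0 0 \<and> (\<forall>i j n i' j' n'. adm i j n \<longrightarrow> adm i' j' n' \<longrightarrow>
     \<Phi> (i + i') (j + j') (n + n') = (\<Phi> i j n \<and> \<Phi> i' j' n'))"

text \<open>The kernel of keeping only the terms on the face. It is described by coefficients, since
  power series are not finite combinations of monomials.\<close>

definition face_prime :: "(nat \<Rightarrow> nat \<Rightarrow> nat \<Rightarrow> bool) \<Rightarrow> 'a::field fps fps poly set" where
  "face_prime \<Phi> = {f \<in> rees_poly. \<forall>i j n. \<Phi> i j n \<longrightarrow> coeff f n $ i $ j = 0}"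

lemma coeff_mult_nth_nth:
  "coeff (f * g) n $ i $ j = (\<Sum>(m, a, b) \<in> {..n} \<times> {..i} \<times> {..j}.
     coeff f m $ a $ b * coeff g (n - m) $ (i - a) $ (j - b))"
  for f g :: "'a::comm_ring_1 fps fps poly"
  unfolding coeff_mult fps_sum_nth fps_fps_mult_nth
  by (simp add: sum.cartesian_product case_prod_unfold)

lemma rees_poly_adm: "f \<in> rees_poly \<Longrightarrow> coeff f n $ i $ j \<noteq> 0 \<Longrightarrow> adm i j n"
  by (auto simp: rees_poly_def filt_def)

lemma lex_least:
  assumes "S n i j"
  obtains n i j :: nat where "S n i j" "\<And>n' i' j'. S n' i' j' \<Longrightarrow> n \<le> n'"
    "\<And>i' j'. S n i' j' \<Longrightarrow> i \<le> i'" "\<And>j'. S n i j' \<Longrightarrow> j \<le> j'"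
proof -
  define n where "n = (LEAST n. \<exists>i j. S n i j)"
  have n: "\<exists>i j. S n i j"
    unfolding n_def by (rule LeastI_ex) (use assms in blast)
  define i where "i = (LEAST i. \<exists>j. S n i j)"
  have i: "\<exists>j. S n i j"
    unfolding i_def by (rule LeastI_ex) (use n in blast)
  define j where "j = (LEAST j. S n i j)"
  have "S n i j"
    unfolding j_def by (rule LeastI_ex) (use i in blast)
  moreover have "n \<le> n'" if "S n' i' j'" for n' i' j'
    unfolding n_def by (rule Least_le) (use that in blast)
  moreover have "i \<le> i'" if "S n i' j'" for i' j'
    unfolding i_def by (rule Least_le) (use that in blast)
  moreover have "j \<le> j'" if "S n i j'" for j'
    unfolding j_def by (rule Least_le) (use that in blast)
  ultimately show ?thesis
    using that by blast
qed

text \<open>A product of terms lands on a face only if both factors do, so only the face parts of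
  \<open>f\<close> and \<open>g\<close> contribute to a coefficient there.\<close>

lemma coeff_mult_face:
  assumes face: "face \<Phi>" and f: "f \<in> rees_poly" and g: "g \<in> rees_poly" and \<Phi>: "\<Phi> i j n"
    and fg: "coeff f m $ a $ b * coeff g (n - m) $ (i - a) $ (j - b) \<noteq> 0" "m \<le> n" "a \<le> i" "b \<le> j"
  shows "\<Phi> a b m \<and> coeff f m $ a $ b \<noteq> 0 \<and>
    \<Phi> (i - a) (j - b) (n - m) \<and> coeff g (n - m) $ (i - a) $ (j - b) \<noteq> 0"
proof -
  have "\<Phi> (a + (i - a)) (b + (j - b)) (m + (n - m)) = (\<Phi> a b m \<and> \<Phi> (i - a) (j - b) (n - m))"
    using face fg rees_poly_adm[OF f, of m a b] rees_poly_adm[OF g, of "n - m" "i - a" "j - b"]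
    unfolding face_def by (metis mult_eq_0_iff)
  then show ?thesis
    using fg \<Phi> by auto
qed

text \<open>The product of the lexicographically least terms on the face cannot cancel.\<close>

lemma prime_face_prime:
  assumes face: "face \<Phi>"
  shows "prime_in rees_poly (face_prime \<Phi> :: 'a::field fps fps poly set)"
  unfolding prime_in_def ideal_in_def
proof (intro conjI ballI impI)
  have "coeff (1 :: 'a fps fps poly) 0 $ 0 $ 0 \<noteq> 0"
    by simp
  then show "1 \<notin> (face_prime \<Phi> :: 'a fps fps poly set)"
    using face unfolding face_prime_def face_def by blast
  show "a + b \<in> face_prime \<Phi>" if "a \<in> face_prime \<Phi>" "b \<in> face_prime \<Phi>" for a b :: "'a fps fps poly"
    using that rees.T(3) by (auto simp: face_prime_def)
  show "f * g \<in> face_prime \<Phi>" if f: "f \<in> rees_poly" and g: "g \<in> face_prime \<Phi>" for f g :: "'a fps fps poly"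
    unfolding face_prime_def
  proof (intro CollectI conjI allI impI)
    have g': "g \<in> rees_poly"
      using g by (simp add: face_prime_def)
    then show "f * g \<in> rees_poly"
      using f rees.T(4) by blast
    fix i j n assume \<Phi>: "\<Phi> i j n"
    show "coeff (f * g) n $ i $ j = 0"
      unfolding coeff_mult_nth_nth
    proof (intro sum.neutral ballI)
      fix p assume "p \<in> {..n} \<times> {..i} \<times> {..j}"
      then obtain m a b where p: "p = (m, a, b)" "m \<le> n" "a \<le> i" "b \<le> j"
        by auto
      have "coeff f m $ a $ b * coeff g (n - m) $ (i - a) $ (j - b) = 0"
        using coeff_mult_face[OF face f g' \<Phi>, of m a b] p(2-) g unfolding face_prime_def by auto
      then show "(case p of (m, a, b) \<Rightarrow> coeff f m $ a $ b * coeff g (n - m) $ (i - a) $ (j - b)) = 0"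
        by (simp add: p(1))
    qed
  qed
  show "f \<in> face_prime \<Phi> \<or> g \<in> face_prime \<Phi>"
    if f: "f \<in> rees_poly" and g: "g \<in> rees_poly" and fg: "f * g \<in> face_prime \<Phi>"
    for f g :: "'a fps fps poly"
  proof (rule ccontr)
    define S where "S = (\<lambda>(h :: 'a fps fps poly) n i j. \<Phi> i j n \<and> coeff h n $ i $ j \<noteq> 0)"
    assume "\<not> ?thesis"
    then obtain n0 i0 j0 n0' i0' j0' where "S f n0 i0 j0" "S g n0' i0' j0'"
      using f g by (auto simp: face_prime_def S_def)
    obtain n i j where *: "S f n i j" "\<And>n' i' j'. S f n' i' j' \<Longrightarrow> n \<le> n'"
      "\<And>i' j'. S f n i' j' \<Longrightarrow> i \<le> i'" "\<And>j'. S f n i j' \<Longrightarrow> j \<le> j'"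
      using lex_least[of "S f", OF \<open>S f n0 i0 j0\<close>] by metis
    obtain n' i' j' where **: "S g n' i' j'" "\<And>n i j. S g n i j \<Longrightarrow> n' \<le> n"
      "\<And>i j. S g n' i j \<Longrightarrow> i' \<le> i" "\<And>j. S g n' i' j \<Longrightarrow> j' \<le> j"
      using lex_least[of "S g", OF \<open>S g n0' i0' j0'\<close>] by metis
    have \<Phi>: "\<Phi> (i + i') (j + j') (n + n')"
      using face *(1) **(1) rees_poly_adm[OF f] rees_poly_adm[OF g] by (simp add: face_def S_def)
    let ?t = "\<lambda>(m, a, b). coeff f m $ a $ b * coeff g (n + n' - m) $ (i + i' - a) $ (j + j' - b)"
    \<comment> \<open>A nonzero contribution comes from two face terms with the same total exponent
      as the two least ones; comparing degree, then \<open>i\<close>, then \<open>j\<close>, it is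
      their product.\<close>
    have zero: "?t p = 0" if p: "p \<in> {..n + n'} \<times> {..i + i'} \<times> {..j + j'} - {(n, i, j)}" for p
    proof (rule ccontr)
      assume nz: "?t p \<noteq> 0"
      obtain m a b where mab: "p = (m, a, b)" "m \<le> n + n'" "a \<le> i + i'" "b \<le> j + j'"
        using p by auto
      then have S: "S f m a b" "S g (n + n' - m) (i + i' - a) (j + j' - b)"
        using coeff_mult_face[OF face f g \<Phi>, of m a b] nz by (simp_all add: S_def)
      have "m = n"
        using *(2)[OF S(1)] **(2)[OF S(2)] mab by simp
      moreover have "a = i"
        using *(3)[of a b] **(3)[of "i + i' - a" "j + j' - b"] S mab \<open>m = n\<close> by simp
      moreover have "b = j"
        using *(4)[of b] **(4)[of "j + j' - b"] S mab \<open>m = n\<close> \<open>a = i\<close> by simp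
      ultimately show False
        using p mab by simp
    qed
    have "coeff (f * g) (n + n') $ (i + i') $ (j + j') = ?t (n, i, j)"
      unfolding coeff_mult_nth_nth
      by (subst sum.remove[of _ "(n, i, j)"]) (use zero in \<open>auto simp: sum.neutral\<close>)
    also have "\<dots> \<noteq> 0"
      using *(1) **(1) by (simp add: S_def)
    finally show False
      using fg \<Phi> by (simp add: face_prime_def)
  qed
qed (auto simp: face_prime_def rees.T)

lemma mon_face_prime_iff: "mon i j n \<in> face_prime \<Phi> \<longleftrightarrow> adm i j n \<and> \<not> \<Phi> i j n"
  by (auto simp: face_prime_def coeff_mon)

lemma homogeneous_face_prime: "homogeneous_in (face_prime \<Phi>)"
  by (auto simp: homogeneous_in_def face_prime_def monom_rees_poly_iff) (auto simp: rees_poly_def)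

lemma proj_in_face_prime:
  assumes "face \<Phi>" "\<Phi> i j n" "adm i j n" "n > 0"
  shows "proj_in (face_prime \<Phi>)"
proof -
  have "fps_X ^ i * fps_Y ^ j \<in> filt n" "monom (fps_X ^ i * fps_Y ^ j) n \<notin> face_prime \<Phi>"
    using assms mon_face_prime_iff[of i j n \<Phi>] monomial_filt[of i j n] by (auto simp: mon_def)
  then show ?thesis
    using assms prime_face_prime homogeneous_face_prime unfolding proj_in_def by blast
qed

lemma over_max_face_prime:
  assumes "\<And>i j. \<Phi> i j 0 \<Longrightarrow> i = 0 \<and> j = 0"
  shows "over_max (face_prime \<Phi>)"
  using assms by (auto simp: over_max_def face_prime_def monom_rees_poly_iff filt_0 max_ideal_def)

lemma face_conj: "face \<Phi> \<Longrightarrow> face \<Psi> \<Longrightarrow> face (\<lambda>i j n. \<Phi> i j n \<and> \<Psi> i j n)"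
  unfolding face_def by blast

lemma face_on_edge: "face (on_edge k)"
  unfolding face_def using on_edge_add by (auto simp: on_edge_def)

section \<open>Vertices and edges\<close>

text \<open>The vertex \<open>(2^-k, 1 - (k + 1) 2^-k)\<close> scaled by \<open>2^k\<close>, which
  makes it integral; for instance \<open>vert 1\<close> is \<open>x t^2\<close>. The subtraction is
  not truncated, by \<open>Suc_le_power_2\<close>.\<close>

definition vert :: "nat \<Rightarrow> 'a::field fps fps poly" where
  "vert k = mon 1 (2 ^ k - 1 - k) (2 ^ k)"

text \<open>The element \<open>y t\<close> of the point \<open>(0, 1)\<close>, where the vertices
  accumulate and which lies on no edge.\<close>

definition limit_vert :: "'a::field fps fps poly" where
  "limit_vert = mon 0 1 1"

lemma Suc_le_power_2: "Suc k \<le> 2 ^ k"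
  by (induction k) auto

text \<open>The slack of vertex \<open>k\<close> in the inequality with index \<open>l\<close>, on
  either side of \<open>k\<close>. It vanishes for \<open>d = 0\<close> in the first formula and for
  \<open>d = 0\<close> and \<open>d = 1\<close> in the second: these are the two edges at the
  vertex.\<close>

lemma vert_power_2:
  "l = k + d \<Longrightarrow> 2 ^ l * (2 ^ k - 1 - k + l * 1) + 2 ^ k = 2 ^ l * 2 ^ k + (2 ^ k + 2 ^ l * d - 2 ^ l)"
  "k = l + d \<Longrightarrow> 2 ^ l * (2 ^ k - 1 - k + l * 1) + 2 ^ k = 2 ^ l * 2 ^ k + 2 ^ l * (2 ^ d - (1 + d))"
  for k l d :: nat
proof -
  obtain e where e: "2 ^ k = Suc k + e"
    using Suc_le_power_2[of k] le_Suc_ex by blast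
  have "2 ^ l \<le> 2 ^ k + 2 ^ l * d" if "l = k + d"
    using that by (cases d) auto
  then show "2 ^ l * (2 ^ k - 1 - k + l * 1) + 2 ^ k = 2 ^ l * 2 ^ k + (2 ^ k + 2 ^ l * d - 2 ^ l)"
    if "l = k + d"
    using that e by (simp add: algebra_simps)
  obtain e' where e': "2 ^ d = Suc d + e'"
    using Suc_le_power_2[of d] le_Suc_ex by blast
  show "2 ^ l * (2 ^ k - 1 - k + l * 1) + 2 ^ k = 2 ^ l * 2 ^ k + 2 ^ l * (2 ^ d - (1 + d))"
    if "k = l + d"
  proof -
    have "2 ^ k = 2 ^ l * (Suc d + e')"
      using that e' by (simp add: power_add)
    moreover have "2 ^ k - 1 - k + l * 1 = 2 ^ k - 1 - d"
      using e that by simp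
    moreover have "2 ^ l * (2 ^ k - 1 - d) = 2 ^ l * 2 ^ k - 2 ^ l * (1 + d)"
      by (simp add: diff_mult_distrib2)
    moreover have "2 ^ l * (1 + d) \<le> 2 ^ l * (2::nat) ^ k"
      using e that by (intro mult_left_mono) auto
    ultimately show ?thesis
      using e' by (simp add: algebra_simps)
  qed
qed

lemma adm_vert: "adm 1 (2 ^ k - 1 - k) (2 ^ k)"
  unfolding adm_def
proof
  fix l
  show "2 ^ l * 2 ^ k \<le> 2 ^ l * (2 ^ k - 1 - k + l * 1) + 2 ^ k"
  proof (cases "k \<le> l")
    case True
    then obtain d where "l = k + d"
      using le_Suc_ex by blast
    from vert_power_2(1)[OF this] show ?thesis
      by simp
  next
    case False
    then obtain d where "k = l + d"
      using le_Suc_ex by (metis nat_le_linear)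
    from vert_power_2(2)[OF this] show ?thesis
      by simp
  qed
qed

lemma on_edge_vert: "on_edge l 1 (2 ^ k - 1 - k) (2 ^ k) \<longleftrightarrow> l = k \<or> Suc l = k"
proof (cases "k \<le> l")
  case True
  then obtain d where d: "l = k + d"
    using le_Suc_ex by blast
  have "2 ^ k + 2 ^ l * d - 2 ^ l = (0::nat) \<longleftrightarrow> d = 0"
    using d by (cases d) auto
  then show ?thesis
    using d unfolding on_edge_def vert_power_2(1)[OF d] by auto
next
  case False
  then obtain d where d: "k = l + d" "d > 0"
    by (metis le_Suc_ex nat_le_linear neq0_conv add.right_neutral)
  have "Suc (Suc (Suc m)) < 2 ^ Suc (Suc m)" for m :: nat
    by (induction m) auto
  then have *: "(2::nat) ^ Suc (Suc m) - (1 + Suc (Suc m)) \<noteq> 0" for m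
    by (metis plus_1_eq_Suc zero_less_diff less_not_refl)
  have "2 ^ d - (1 + d) = 0 \<longleftrightarrow> d = 1"
  proof (cases "d = 1")
    case False
    then obtain m where "d = Suc (Suc m)"
      using d(2) by (metis One_nat_def not0_implies_Suc not_gr_zero)
    then show ?thesis
      using *[of m] by simp
  qed simp
  then show ?thesis
    using d unfolding on_edge_def vert_power_2(2)[OF d(1)] by auto
qed

lemma vert_rees_poly [simp]: "vert k \<in> rees_poly"
  unfolding vert_def mon_rees_poly_iff by (rule adm_vert)

lemma limit_vert_rees_poly [simp]: "limit_vert \<in> rees_poly"
  by (simp add: limit_vert_def)

text \<open>The semigroup of lattice points on the cone over an edge is free on its two vertices.\<close>

lemma on_edge_obtain:
  assumes adm: "adm i j n" and e: "on_edge k i j n" and k: "k \<ge> 1"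
  obtains r where "n = 2 ^ k * r" "r \<le> 2 * i" "i \<le> r" "j + k * i + r = 2 ^ k * r"
proof -
  have "2 ^ k dvd 2 ^ k * (j + k * i) + n"
    using e by (metis dvd_triv_left on_edge_def)
  then obtain r where r: "n = 2 ^ k * r"
    by (metis dvd_add_right_iff dvd_def dvd_triv_left)
  have e': "j + k * i + r = 2 ^ k * r"
  proof -
    have "2 ^ k * (j + k * i + r) = 2 ^ k * (2 ^ k * r)"
      using e unfolding on_edge_def r by (simp add: algebra_simps)
    then show ?thesis
      by simp
  qed
  \<comment> \<open>The inequalities of the neighbouring edges \<open>k + 1\<close> and
    \<open>k - 1\<close> confine the point between the two ends of edge \<open>k\<close>, giving
    \<open>r \<le> 2 * i\<close> and \<open>i \<le> r\<close>.\<close>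
  have "2 ^ k * (2 * (2 ^ k * r)) \<le> 2 ^ k * (2 * (j + k * i + i) + r)"
    using admD[OF adm, of "Suc k"] unfolding r by (simp add: algebra_simps)
  then have "2 * (2 ^ k * r) \<le> 2 * (j + k * i + i) + r"
    by simp
  then have "r \<le> 2 * i"
    using e' by simp
  obtain l where l: "k = Suc l"
    using k by (cases k) auto
  have "2 ^ l * (2 ^ k * r) \<le> 2 ^ l * (j + l * i + 2 * r)"
    using admD[OF adm, of l] unfolding r l by (simp add: algebra_simps)
  then have "2 ^ k * r \<le> j + l * i + 2 * r"
    by simp
  then have "i \<le> r"
    using e' l by simp
  with that r e' \<open>r \<le> 2 * i\<close> show ?thesis
    by blast
qed

text \<open>In the coordinates \<open>(i, r)\<close> the two vertices are \<open>(1, 1)\<close> and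
  \<open>(1, 2)\<close>, a lattice basis; the exponents solve \<open>i = p + q\<close> and
  \<open>r = p + 2 * q\<close>.\<close>

lemma mon_on_edge:
  assumes "n = 2 ^ k * r" "r \<le> 2 * i" "i \<le> r" "j + k * i + r = 2 ^ k * r"
  shows "mon i j n = vert k ^ (2 * i - r) * vert (Suc k) ^ (r - i)"
proof -
  obtain p q where pq: "2 * i = r + p" "r = i + q"
    using assms(2,3) le_Suc_ex by meson
  then have i: "i = p + q" "r = p + 2 * q"
    by auto
  obtain e where e: "2 ^ k = Suc k + e"
    using Suc_le_power_2[of k] le_Suc_ex by blast
  have "j = p * (2 ^ k - 1 - k) + q * (2 ^ Suc k - 1 - Suc k)"
    using assms(4) unfolding i by (simp add: e algebra_simps)
  moreover have "n = p * 2 ^ k + q * 2 ^ Suc k"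
    using assms(1) unfolding i by (simp add: algebra_simps)
  ultimately have "mon i j n = vert k ^ p * vert (Suc k) ^ q"
    unfolding vert_def mon_power mon_mult i by simp
  then show ?thesis
    using pq i by simp
qed

text \<open>If \<open>i > 0\<close> and the exponent lies on no edge of positive index, then some power of the monomial
  remains in the Rees algebra after division by \<open>x\<close>, hence it is nilpotent in the fiber cone.\<close>

lemma adm_power_pred:
  assumes adm: "adm i j n" and i: "i > 0" and ne: "\<And>k. k \<ge> 1 \<Longrightarrow> \<not> on_edge k i j n"
  obtains p where "p > 0" "adm (p * i - 1) (p * j) (p * n)"
proof
  \<comment> \<open>Lowering the exponent of \<open>x\<close> by one costs \<open>k * 2^k\<close> in
    inequality \<open>k\<close>. For \<open>0 < k \<le> 2 * n\<close> the slack is at least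
    \<open>1\<close>, so the factor \<open>2 * n * 2^(2 * n)\<close> pays; for larger
    \<open>k\<close> twice the slack already suffices, because \<open>i > 0\<close>.\<close>
  define p where "p = 2 + 2 * n * 2 ^ (2 * n)"
  show "p > 0"
    by (simp add: p_def)
  show "adm (p * i - 1) (p * j) (p * n)"
    unfolding adm_def
  proof
    fix k
    let ?A = "2 ^ k * (j + k * i) + n" and ?B = "2 ^ k * n"
    have le: "?B \<le> ?A"
      using admD[OF adm] .
    have key: "p * ?B + k * 2 ^ k \<le> p * ?A"
    proof (cases "k = 0")
      case True
      then show ?thesis
        by (simp add: algebra_simps)
    next
      case k0: False
      show ?thesis
      proof (cases "k \<le> 2 * n")
        case True
        have "?B + 1 \<le> ?A"
          using le ne[of k] k0 by (simp add: on_edge_def)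
        then have "p * (?B + 1) \<le> p * ?A"
          by (rule mult_le_mono2)
        moreover have "k * 2 ^ k \<le> (2 * n) * 2 ^ (2 * n)"
          using True by (intro mult_mono power_increasing) auto
        then have "k * 2 ^ k \<le> p"
          by (simp add: p_def)
        ultimately show ?thesis
          by (simp add: algebra_simps)
      next
        case False
        obtain t where "k * i = k + t"
          using i le_Suc_ex[of k "k * i"] by auto
        then have "2 * n + k \<le> 2 * (j + k * i)"
          using False by simp
        then have "2 ^ k * (2 * n + k) \<le> 2 ^ k * (2 * (j + k * i))"
          by (rule mult_le_mono2)
        then have *: "2 * ?B + k * 2 ^ k \<le> 2 * ?A"
          by (simp add: algebra_simps)
        have "(p - 2) * ?B \<le> (p - 2) * ?A"
          using le by (rule mult_le_mono2)
        then have "(2 + (p - 2)) * ?B + k * 2 ^ k \<le> (2 + (p - 2)) * ?A"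
          using * unfolding add_mult_distrib by linarith
        moreover have "2 + (p - 2) = p"
          by (simp add: p_def)
        ultimately show ?thesis
          by (simp only:)
      qed
    qed
    obtain t where t: "p * i = Suc t"
      using i by (cases "p * i") (auto simp: p_def)
    have "p * ?A = 2 ^ k * (p * j + k * t) + p * n + k * 2 ^ k"
    proof -
      have "p * ?A = 2 ^ k * (p * j + k * (p * i)) + p * n"
        by (simp add: algebra_simps)
      then show ?thesis
        unfolding t by (simp add: algebra_simps)
    qed
    then show "2 ^ k * (p * n) \<le> 2 ^ k * (p * j + k * (p * i - 1)) + p * n"
      using key unfolding t by (simp add: algebra_simps)
  qed
qed

section \<open>Primes over the maximal ideal\<close>

text \<open>Off the edges of positive index and with \<open>i > 0\<close>, some power of the
  monomial is divisible by \<open>x\<close> inside the Rees algebra. With \<open>i = 0\<close> only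
  powers of the limit vertex escape \<open>mon_big_mem\<close>.\<close>

lemma mon_notin_cases:
  assumes P: "prime_in rees_poly P" and m: "over_max P" and adm: "adm i j n" and ni: "mon i j n \<notin> P"
  shows "(\<exists>k\<ge>1. on_edge k i j n) \<or> (i = 0 \<and> j = n)"
proof (cases "i = 0")
  case True
  have "n \<le> j"
  proof (rule ccontr)
    assume "\<not> n \<le> j"
    then obtain d where d: "n = j + Suc d"
      using less_imp_Suc_add not_le by (metis add_Suc_right)
    \<comment> \<open>With \<open>i = 0\<close> inequality \<open>k\<close> reads
      \<open>j \<ge> n - n / 2^k\<close>; already \<open>k = n\<close> forces
      \<open>j \<ge> n\<close>, since \<open>n < 2^n\<close>.\<close>
    have "2 ^ n * Suc d \<le> n"
      using admD[OF adm, of n] True unfolding d by (simp add: algebra_simps)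
    moreover have "n < 2 ^ n * Suc d"
      using Suc_le_power_2[of n] by simp
    ultimately show False
      by simp
  qed
  then show ?thesis
    using mon_big_mem[OF prime_inD(1)[OF P] m, of n i j] ni True by fastforce
next
  case False
  show ?thesis
  proof (rule ccontr)
    assume "\<not> ?thesis"
    then obtain p where p: "p > 0" "adm (p * i - 1) (p * j) (p * n)"
      using adm_power_pred[OF adm] False by blast
    have "p * i = Suc (p * i - 1)"
      using p(1) False by simp
    then have "mon i j n ^ p \<in> P"
      using mon_Suc_mem(1)[OF prime_inD(1)[OF P] m p(2)] by (simp add: mon_power)
    then show False
      using rees.prime_power[OF P] adm ni by simp
  qed
qed

text \<open>The product with \<open>vert k\<close> stays outside the prime, hence lies on an edge of
  positive index, and this edge contains both factors.\<close>

lemma mon_notin_edge: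
  assumes P: "prime_in rees_poly P" and m: "over_max P" and adm: "adm i j n" and ni: "mon i j n \<notin> P"
    and v: "vert k \<notin> P"
  shows "\<exists>l\<ge>1. on_edge l i j n \<and> (l = k \<or> Suc l = k)"
proof -
  have "mon i j n * vert k \<notin> P"
    using prime_inD(3)[OF P, of "mon i j n" "vert k"] adm ni v by auto
  then have "mon (i + 1) (j + (2 ^ k - 1 - k)) (n + 2 ^ k) \<notin> P"
    by (simp add: vert_def mon_mult)
  from mon_notin_cases[OF P m adm_add[OF adm adm_vert] this]
  obtain l where "l \<ge> 1" "on_edge l (i + 1) (j + (2 ^ k - 1 - k)) (n + 2 ^ k)"
    by auto
  then show ?thesis
    using on_edge_add[OF adm adm_vert] on_edge_vert by blast
qed

section \<open>Edge primes and vertex primes\<close>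

abbreviation edge_prime :: "nat \<Rightarrow> 'a::field fps fps poly set" where
  "edge_prime k \<equiv> face_prime (on_edge k)"

text \<open>For \<open>k \<ge> 1\<close> the face is the ray through vertex \<open>k\<close>, cut
  out by the two edges that meet there.\<close>

abbreviation vert_prime :: "nat \<Rightarrow> 'a::field fps fps poly set" where
  "vert_prime k \<equiv> face_prime (\<lambda>i j n. on_edge k i j n \<and> on_edge (k - 1) i j n)"

lemma vert_in_edge_prime: "vert l \<in> edge_prime k \<longleftrightarrow> l \<noteq> k \<and> l \<noteq> Suc k"
  unfolding vert_def mon_face_prime_iff on_edge_vert using adm_vert by auto

lemma vert_in_vert_prime: "k \<ge> 1 \<Longrightarrow> vert l \<in> vert_prime k \<longleftrightarrow> l \<noteq> k"
  unfolding vert_def mon_face_prime_iff on_edge_vert using adm_vert by auto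

lemma limit_vert_in_vert_prime: "limit_vert \<in> vert_prime k"
  unfolding limit_vert_def mon_face_prime_iff by (simp add: on_edge_def)

lemma on_edge_0: "k \<ge> 1 \<Longrightarrow> on_edge k i j 0 \<Longrightarrow> i = 0 \<and> j = 0"
  by (simp add: on_edge_def)

lemma edge_prime:
  assumes "k \<ge> 1"
  shows "proj_in (edge_prime k)" "over_max (edge_prime k)"
proof -
  show "proj_in (edge_prime k)"
    by (rule proj_in_face_prime[OF face_on_edge _ adm_vert[of k]]) (unfold on_edge_vert, simp_all)
  show "over_max (edge_prime k)"
    by (rule over_max_face_prime) (use on_edge_0 assms in blast)
qed

lemma vert_prime:
  assumes "k \<ge> 1"
  shows "proj_in (vert_prime k)" "over_max (vert_prime k)"
proof -
  show "proj_in (vert_prime k)"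
    by (rule proj_in_face_prime[OF face_conj[OF face_on_edge face_on_edge] _ adm_vert[of k]])
      (unfold on_edge_vert, use assms in auto)
  show "over_max (vert_prime k)"
    by (rule over_max_face_prime) (use on_edge_0 assms in blast)
qed

lemma edge_prime_less_vert_prime:
  assumes "k \<ge> 1"
  shows "edge_prime k \<subset> (vert_prime k :: 'a::field fps fps poly set)"
proof
  show "edge_prime k \<subseteq> (vert_prime k :: 'a fps fps poly set)"
    by (auto simp: face_prime_def)
  have "(vert (Suc k) :: 'a fps fps poly) \<in> vert_prime k" "(vert (Suc k) :: 'a fps fps poly) \<notin> edge_prime k"
    using vert_in_vert_prime[OF assms, of "Suc k"] vert_in_edge_prime[of "Suc k" k] by simp_all
  then show "edge_prime k \<noteq> (vert_prime k :: 'a fps fps poly set)"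
    by blast
qed

text \<open>A surviving monomial times \<open>vert k\<close> shares an edge with
  \<open>vert (Suc k)\<close>, and the only edge through both vertices is edge \<open>k\<close>. So
  all monomials off that edge lie in \<open>P\<close>.\<close>

lemma edge_prime_least:
  fixes P :: "'a::field fps fps poly set"
  assumes P: "prime_in rees_poly P" and m: "over_max P" and v: "vert k \<notin> P" "vert (Suc k) \<notin> P"
  shows "edge_prime k \<subseteq> P"
proof
  fix f :: "'a fps fps poly" assume f: "f \<in> edge_prime k"
  note I = prime_inD(1)[OF P]
  show "f \<in> P"
  proof (rule poly_mem[OF I])
    fix n
    show "monom (coeff f n) n \<in> P"
    proof (rule monom_mem[OF I m], rule ccontr)
      fix i j assume ij: "coeff f n $ i $ j \<noteq> 0" "mon i j n \<notin> P"
      then have adm: "adm i j n" and ne: "\<not> on_edge k i j n"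
        using f rees_poly_adm by (auto simp: face_prime_def)
      have "mon i j n * vert k \<notin> P"
        using prime_inD(3)[OF P, of "mon i j n" "vert k"] adm ij v by auto
      then have "mon (i + 1) (j + (2 ^ k - 1 - k)) (n + 2 ^ k) \<notin> P"
        by (simp add: vert_def mon_mult)
      from mon_notin_edge[OF P m adm_add[OF adm adm_vert] this v(2)]
      obtain l where "on_edge l i j n" "l = k \<or> Suc l = k" "l = Suc k \<or> l = k"
        using on_edge_add[OF adm adm_vert] on_edge_vert by auto
      then show False
        using ne by auto
    qed
  qed
qed

lemma minimal_edge_prime:
  assumes "k \<ge> 1" "prime_in rees_poly P" "over_max P" "P \<subseteq> edge_prime k"
  shows "P = edge_prime k"
proof -
  have "vert k \<notin> P" "vert (Suc k) \<notin> P"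
    using assms(4) vert_in_edge_prime[of k k] vert_in_edge_prime[of "Suc k" k] by auto
  then show ?thesis
    using edge_prime_least[OF assms(2,3)] assms(4) by blast
qed

section \<open>Closed points of the fiber\<close>

lemma cst_sum: "cst (sum f S) = (\<Sum>i\<in>S. cst (f i))"
  by (induction S rule: infinite_finite_induct) (simp_all add: cst_simps)

text \<open>The Proj of a graded domain spanned by powers of one element is a single point.\<close>

definition spanned_by_powers :: "'a::field fps fps poly set \<Rightarrow> 'a fps fps poly \<Rightarrow> bool" where
  "spanned_by_powers P w \<longleftrightarrow> (\<exists>p. (\<forall>n>0. p n > 0) \<and>
     (\<forall>i j n. adm i j n \<longrightarrow> (\<exists>c. mon i j n - cst c * w ^ p n \<in> P)))"

text \<open>A homogeneous element of \<open>Q\<close> outside \<open>P\<close> is, modulo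
  \<open>P\<close>, a nonzero scalar times a power of \<open>w\<close>, so \<open>w\<close> lies in
  \<open>Q\<close>. Since the exponents \<open>p n\<close> are positive for \<open>n > 0\<close>,
  all elements of positive degree would follow.\<close>

lemma spanned_by_powers_maximal:
  fixes P Q :: "'a::field fps fps poly set"
  assumes P: "proj_in P" and Q: "proj_in Q" and sub: "P \<subseteq> Q" and m: "over_max P"
    and w: "w \<in> rees_poly" and span: "spanned_by_powers P w"
  shows "P = Q"
proof (rule ccontr)
  note IP = proj_inD(2)[OF P] and IQ = proj_inD(2)[OF Q]
  assume "P \<noteq> Q"
  then obtain f where f: "f \<in> Q" "f \<notin> P"
    using sub by blast
  obtain p where p: "\<And>n. n > 0 \<Longrightarrow> p n > 0"
    "\<And>i j n. adm i j n \<Longrightarrow> \<exists>c. mon i j n - cst c * w ^ p n \<in> P"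
    using span unfolding spanned_by_powers_def by blast
  have span: "\<exists>c. monom h n - cst c * w ^ p n \<in> P" if h: "h \<in> filt n" for h n
  proof -
    have summand: "\<exists>c. cst (h $ i $ j) * mon i j n - cst c * w ^ p n \<in> P" for i j
    proof (cases "h $ i $ j = 0")
      case True
      then show ?thesis
        using ideal_inD(2)[OF IP] by (intro exI[of _ 0]) (simp add: cst_simps)
    next
      case False
      then have "adm i j n"
        using h by (simp add: filt_def)
      then obtain c where "mon i j n - cst c * w ^ p n \<in> P"
        using p(2) by blast
      then have "cst (h $ i $ j) * (mon i j n - cst c * w ^ p n) \<in> P"
        by (rule ideal_inD(4)[OF IP cst_rees_poly])
      then show ?thesis
        by (intro exI[of _ "h $ i $ j * c"]) (simp add: cst_simps algebra_simps)
    qed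
    then obtain c where c: "\<And>i j. cst (h $ i $ j) * mon i j n - cst (c i j) * w ^ p n \<in> P"
      by metis
    let ?S = "{..n} \<times> {..n}"
    have "(\<Sum>(i, j) \<in> ?S. cst (h $ i $ j) * mon i j n - cst (c i j) * w ^ p n) \<in> P"
      by (rule ideal_in_sum[OF IP]) (use c in auto)
    from ideal_inD(3)[OF IP monom_mem_sum[OF IP m, of h n] this]
    have "monom h n - (\<Sum>(i, j) \<in> ?S. cst (c i j)) * w ^ p n \<in> P"
      by (simp add: sum_subtractf case_prod_unfold sum_distrib_right)
    moreover have "(\<Sum>(i, j) \<in> ?S. cst (c i j)) = cst (\<Sum>(i, j) \<in> ?S. c i j)"
      by (simp add: cst_sum case_prod_unfold)
    ultimately show ?thesis
      by metis
  qed
  obtain n where n: "monom (coeff f n) n \<notin> P"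
    using poly_mem[OF IP] f(2) by blast
  have "f \<in> rees_poly"
    using f(1) ideal_inD(1)[OF IQ] by blast
  then have "coeff f n \<in> filt n"
    by (simp add: rees_poly_def)
  then obtain c where c: "monom (coeff f n) n - cst c * w ^ p n \<in> P"
    using span by blast
  have "c \<noteq> 0"
    using c n by (auto simp: cst_simps)
  have "monom (coeff f n) n \<in> Q"
    using proj_inD(4)[OF Q f(1)] .
  then have "monom (coeff f n) n - (monom (coeff f n) n - cst c * w ^ p n) \<in> Q"
    by (rule rees.ideal_diff[OF IQ]) (use c sub in blast)
  then have "w ^ p n \<in> Q"
    using cst_mult_mem_iff[OF IQ \<open>c \<noteq> 0\<close>] by simp
  then have wQ: "w \<in> Q"
    by (rule rees.prime_power[OF proj_inD(1)[OF Q] w])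
  have "monom h n \<in> Q" if "n > 0" "h \<in> filt n" for h n
  proof -
    obtain c where c: "monom h n - cst c * w ^ p n \<in> Q"
      using span[OF \<open>h \<in> filt n\<close>] sub by blast
    have "w ^ p n = w ^ (p n - 1) * w"
      using p(1)[OF \<open>n > 0\<close>] by (simp add: power_eq_if mult.commute)
    then have "w ^ p n \<in> Q"
      using ideal_inD(4)[OF IQ rees.T_power[OF w] wQ] by simp
    then have "cst c * w ^ p n \<in> Q"
      by (rule ideal_inD(4)[OF IQ cst_rees_poly])
    from ideal_inD(3)[OF IQ c this] show ?thesis
      by simp
  qed
  then show False
    using proj_inD(5)[OF Q] by blast
qed

text \<open>Binary forms over \<open>\<complex>\<close> split into linear factors, so a prime containing a nonzero form in \<open>a\<close>, \<open>b\<close> contains one of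
  the factors.\<close>

lemma prime_contains_linear_factor:
  fixes P :: "complex fps fps poly set"
  assumes P: "prime_in rees_poly P" and a: "a \<in> rees_poly" and b: "b \<in> rees_poly" "b \<notin> P"
    and q: "q \<noteq> 0" "degree q \<le> s" and mem: "(\<Sum>i\<le>s. cst (coeff q i) * a ^ i * b ^ (s - i)) \<in> P"
  shows "\<exists>c. a - cst c * b \<in> P"
  using q mem
proof (induction s arbitrary: q)
  case 0
  then obtain c where c: "q = [:c:]" "c \<noteq> 0"
    using degree_0_id[of q] by (metis le_zero_eq pCons_0_0)
  then have "cst c * 1 \<in> P"
    using 0 by simp
  then show ?case
    using cst_mult_mem_iff[OF prime_inD(1)[OF P] c(2)] prime_inD(2)[OF P] by blast
next
  case (Suc s)
  note I = prime_inD(1)[OF P]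
  show ?case
  proof (cases "degree q = 0")
    case True
    then obtain c where c: "q = [:c:]" "c \<noteq> 0"
      using degree_0_id[of q] Suc.prems(1) by (metis pCons_0_0)
    \<comment> \<open>The order of the form may exceed the degree of \<open>q\<close>; for constant
      \<open>q\<close> the form is a pure power of \<open>b\<close>, which \<open>P\<close> cannot
      contain.\<close>
    have "(\<Sum>i\<le>Suc s. cst (coeff q i) * a ^ i * b ^ (Suc s - i)) = cst c * b ^ Suc s"
      unfolding c(1) by (subst sum.atMost_Suc_shift) (simp add: cst_simps)
    then have "b ^ Suc s \<in> P"
      using Suc.prems(3) cst_mult_mem_iff[OF I c(2)] by simp
    then show ?thesis
      using rees.prime_power[OF P b(1)] b(2) by blast
  next
    case False
    \<comment> \<open>A root \<open>z\<close> splits off the factor \<open>a - cst z * b\<close>;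
      the cofactor is the form of order \<open>s\<close> belonging to \<open>q'\<close>.\<close>
    then obtain z where "poly q z = 0"
      using fundamental_theorem_of_algebra[of q] by (auto simp: constant_degree)
    then obtain q' where q': "q = [:- z, 1:] * q'"
      by (metis dvdE poly_eq_0_iff_dvd)
    have "q' \<noteq> 0"
      using Suc.prems(1) q' by auto
    then have "degree q = Suc (degree q')"
      unfolding q' by (subst degree_mult_eq) auto
    then have deg: "degree q' \<le> s"
      using Suc.prems(2) by simp
    have z: "coeff q' (Suc s) = 0"
      using deg by (simp add: coeff_eq_0)
    let ?F = "\<lambda>s q. \<Sum>i\<le>s. cst (coeff q i) * a ^ i * b ^ (s - i)"
    have "?F (Suc s) q = (\<Sum>i\<le>Suc s. (cst (coeff (pCons 0 q') i) - cst z * cst (coeff q' i)) * a ^ i * b ^ (Suc s - i))"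
    proof (rule sum.cong[OF refl])
      fix i
      have "cst (coeff q i) + cst z * cst (coeff q' i) = cst (coeff (pCons 0 q') i)"
        unfolding q' cst_simps(3,4)[symmetric] by simp
      then have "cst (coeff q i) = cst (coeff (pCons 0 q') i) - cst z * cst (coeff q' i)"
        by (simp add: eq_diff_eq)
      then show "cst (coeff q i) * a ^ i * b ^ (Suc s - i) =
        (cst (coeff (pCons 0 q') i) - cst z * cst (coeff q' i)) * a ^ i * b ^ (Suc s - i)"
        by (simp only:)
    qed
    also have "\<dots> = (\<Sum>i\<le>Suc s. cst (coeff (pCons 0 q') i) * a ^ i * b ^ (Suc s - i)) -
        cst z * (\<Sum>i\<le>Suc s. cst (coeff q' i) * a ^ i * b ^ (Suc s - i))"
      by (simp add: left_diff_distrib sum_subtractf sum_distrib_left mult.assoc del: sum.atMost_Suc)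
    also have "(\<Sum>i\<le>Suc s. cst (coeff (pCons 0 q') i) * a ^ i * b ^ (Suc s - i)) = a * ?F s q'"
      by (subst sum.atMost_Suc_shift) (simp add: cst_simps sum_distrib_left ac_simps)
    also have "(\<Sum>i\<le>Suc s. cst (coeff q' i) * a ^ i * b ^ (Suc s - i)) = b * ?F s q'"
    proof -
      have "b ^ (Suc s - i) = b * b ^ (s - i)" if "i \<le> s" for i
        using that by (simp add: Suc_diff_le)
      then show ?thesis
        using z by (simp add: cst_simps sum_distrib_left ac_simps)
    qed
    also have "a * ?F s q' - cst z * (b * ?F s q') = (a - cst z * b) * ?F s q'"
      by (simp only: left_diff_distrib mult.assoc)
    finally have "(a - cst z * b) * ?F s q' \<in> P"
      using Suc.prems(3) by (simp only:)
    moreover have "?F s q' \<in> rees_poly"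
      by (intro ideal_in_sum[of rees_poly] rees.T(4) rees.T_power a b cst_rees_poly)
        (simp add: ideal_in_def rees.T)
    moreover have "a - cst z * b \<in> rees_poly"
      by (intro rees.T_diff rees.T(4) a b cst_rees_poly)
    ultimately show ?thesis
      using prime_inD(3)[OF P] Suc.IH[OF \<open>q' \<noteq> 0\<close> deg] by blast
  qed
qed

text \<open>Such a \<open>P\<close> is a closed point of the line of edge \<open>k\<close> away from
  its two vertices: a form on the edge lying in \<open>P\<close> has a linear factor there.\<close>

lemma edge_prime_form:
  fixes P :: "complex fps fps poly set"
  assumes P: "proj_in P" and m: "over_max P" and k: "k \<ge> 1"
    and v: "vert k \<notin> P" "vert (Suc k) \<notin> P" and ne: "P \<noteq> edge_prime k"
  obtains c where "vert k ^ 2 - cst c * vert (Suc k) \<in> P"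
proof -
  note I = proj_inD(2)[OF P]
  have sub: "edge_prime k \<subseteq> P"
    by (rule edge_prime_least[OF proj_inD(1)[OF P] m v])
  then obtain f where f: "f \<in> P" "f \<notin> edge_prime k"
    using ne by blast
  have fT: "f \<in> rees_poly"
    using f(1) ideal_inD(1)[OF I] by blast
  then obtain i0 j0 n where f0: "coeff f n $ i0 $ j0 \<noteq> 0" "on_edge k i0 j0 n"
    using f(2) by (auto simp: face_prime_def)
  obtain r where r: "n = 2 ^ k * r"
    using on_edge_obtain[OF rees_poly_adm[OF fT f0(1)] f0(2) k] by metis
  define g where "g = monom (coeff f n) n"
  have g: "g \<in> P" "g \<in> rees_poly" "g \<notin> edge_prime k"
  proof -
    show "g \<in> P"
      unfolding g_def by (rule proj_inD(4)[OF P f(1)])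
    then show "g \<in> rees_poly"
      using ideal_inD(1)[OF I] by blast
    have "coeff g n $ i0 $ j0 \<noteq> 0"
      using f0 by (simp add: g_def)
    then show "g \<notin> edge_prime k"
      using f0 unfolding face_prime_def by blast
  qed
  txt \<open>Squaring makes the degree an even multiple of \<open>2\<^sup>k\<close>, so that the edge part is a form in
    \<open>vert k ^ 2\<close> and \<open>vert (Suc k)\<close>.\<close>
  define h where "h = coeff f n * coeff f n"
  have gg: "g * g = monom h (2 * n)"
    by (simp add: g_def h_def mult_monom mult_2)
  have "g * g \<notin> edge_prime k"
    using prime_inD(3)[OF prime_face_prime[OF face_on_edge] g(2) g(2)] g(3) by blast
  then obtain i1 j1 where h1: "h $ i1 $ j1 \<noteq> 0" "on_edge k i1 j1 (2 * n)"
    using rees.T(4)[OF g(2) g(2)] by (auto simp: gg face_prime_def split: if_splits)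
  have hP: "monom h (2 * n) \<in> P"
    using ideal_inD(4)[OF I g(2) g(1)] by (simp add: gg)
  have adm: "adm i j (2 * n)" if "h $ i $ j \<noteq> 0" for i j
    using rees_poly_adm[OF rees.T(4)[OF g(2) g(2)], of "2 * n" i j] that by (simp add: gg)
  \<comment> \<open>The exponent of \<open>y\<close> that puts \<open>x^(r + q)\<close> on edge
    \<open>k\<close> in degree \<open>2 * n\<close>; it solves the edge equation
    \<open>j + k * i + r' = 2^k * r'\<close> for \<open>r' = 2 * r\<close>.\<close>
  define e where "e = (\<lambda>q. 2 ^ k * (2 * r) - 2 * r - k * (r + q))"
  have edge: "\<exists>q\<le>r. i = r + q \<and> j = e q" if ij: "adm i j (2 * n)" "on_edge k i j (2 * n)" for i j
  proof -
    obtain r' where r': "2 * n = 2 ^ k * r'" "r' \<le> 2 * i" "i \<le> r'" "j + k * i + r' = 2 ^ k * r'"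
      using on_edge_obtain[OF ij k] by metis
    have "r' = 2 * r"
      using r'(1) r by simp
    moreover from this obtain q where "i = r + q"
      using r'(2) le_Suc_ex[of r i] by auto
    moreover have "j = 2 ^ k * r' - r' - k * i"
      using r'(4) by simp
    ultimately show ?thesis
      using r'(3) by (intro exI[of _ q]) (auto simp: e_def)
  qed
  have kr: "k * (r + q) + 2 * r \<le> 2 ^ k * (2 * r)" if "q \<le> r" for q
  proof -
    have "k * (r + q) + 2 * r \<le> k * (2 * r) + 2 * r"
      using that by simp
    also have "\<dots> = Suc k * (2 * r)"
      by simp
    also have "\<dots> \<le> 2 ^ k * (2 * r)"
      by (rule mult_le_mono1[OF Suc_le_power_2])
    finally show ?thesis .
  qed
  have mon_e: "mon (r + q) (e q) (2 * n) = (vert k ^ 2) ^ q * (vert (Suc k) :: complex fps fps poly) ^ (r - q)"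
    if q: "q \<le> r" for q
  proof -
    have "mon (r + q) (e q) (2 * n) =
        vert k ^ (2 * (r + q) - 2 * r) * (vert (Suc k) :: complex fps fps poly) ^ (2 * r - (r + q))"
      using q kr[OF q] by (intro mon_on_edge) (auto simp: r e_def)
    then show ?thesis
      by (simp add: power_mult)
  qed
  \<comment> \<open>The part of \<open>h\<close> on the edge. All other terms of \<open>h\<close>
    lie in \<open>edge_prime k\<close>, hence in \<open>P\<close>, so that \<open>?s\<close> in
    degree \<open>2 * n\<close> lies in \<open>P\<close> too.\<close>
  let ?s = "\<Sum>q\<le>r. fps_const (fps_const (h $ (r + q) $ e q)) * (fps_X ^ (r + q) * fps_Y ^ e q)"
  have s: "?s $ a $ b = (if \<exists>q\<le>r. a = r + q \<and> b = e q then h $ a $ b else 0)" for a b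
  proof -
    have "?s $ a $ b = (\<Sum>q\<le>r. if q = a - r then (if r \<le> a \<and> b = e q then h $ a $ b else 0) else 0)"
      unfolding fps_sum_nth
      by (intro sum.cong) (auto simp: fps_fps_monomial_nth simp del: fps_const_mult fps_const_power)
    also have "\<dots> = (if \<exists>q\<le>r. a = r + q \<and> b = e q then h $ a $ b else 0)"
      by auto
    finally show ?thesis .
  qed
  have "monom (h - ?s) (2 * n) \<in> P"
  proof (rule monom_mem[OF I m])
    fix i j assume nz: "(h - ?s) $ i $ j \<noteq> 0"
    then have nq: "h $ i $ j \<noteq> 0" "\<not> (\<exists>q\<le>r. i = r + q \<and> j = e q)"
      using s[of i j] by (auto split: if_splits)
    then have "mon i j (2 * n) \<in> edge_prime k"
      unfolding mon_face_prime_iff using adm edge by blast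
    then show "mon i j (2 * n) \<in> P"
      using sub by blast
  qed
  with hP have "monom h (2 * n) - monom (h - ?s) (2 * n) \<in> P"
    by (rule rees.ideal_diff[OF I])
  then have "monom ?s (2 * n) \<in> P"
    by (simp add: diff_monom)
  moreover have "monom ?s (2 * n) = (\<Sum>q\<le>r. cst (h $ (r + q) $ e q) * (vert k ^ 2) ^ q * vert (Suc k) ^ (r - q))"
    unfolding monom_sum
  proof (intro sum.cong refl)
    fix q assume "q \<in> {..r}"
    then have q: "q \<le> r"
      by simp
    show "monom (fps_const (fps_const (h $ (r + q) $ e q)) * (fps_X ^ (r + q) * fps_Y ^ e q)) (2 * n) =
      cst (h $ (r + q) $ e q) * (vert k ^ 2) ^ q * vert (Suc k) ^ (r - q)"
      unfolding mult.assoc mon_e[OF q, symmetric] by (simp add: cst_def mon_def mult_monom)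
  qed
  moreover define p where "p = (\<Sum>q\<le>r. monom (h $ (r + q) $ e q) q)"
  have p: "coeff p q = (if q \<le> r then h $ (r + q) $ e q else 0)" for q
    by (simp add: p_def coeff_sum)
  ultimately have "(\<Sum>q\<le>r. cst (coeff p q) * (vert k ^ 2) ^ q * vert (Suc k) ^ (r - q)) \<in> P"
    by simp
  moreover have "p \<noteq> 0"
  proof -
    obtain q where "q \<le> r" "i1 = r + q" "j1 = e q"
      using edge[OF adm[OF h1(1)] h1(2)] by blast
    then have "coeff p q \<noteq> 0"
      using h1(1) by (simp add: p)
    then show ?thesis
      by auto
  qed
  moreover have "degree p \<le> r"
    by (rule degree_le) (simp add: p)
  ultimately show ?thesis
    using prime_contains_linear_factor[OF proj_inD(1)[OF P] rees.T_power[OF vert_rees_poly] vert_rees_poly v(2)]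
      that by blast
qed

lemma power_diff_mem:
  assumes P: "ideal_in rees_poly P" and a: "a \<in> rees_poly" and b: "b \<in> rees_poly" and d: "a - b \<in> P"
  shows "a ^ n - b ^ n \<in> P"
proof (induction n)
  case (Suc n)
  have "(a - b) * a ^ n + b * (a ^ n - b ^ n) \<in> P"
    using ideal_inD(5)[OF P rees.T_power[OF a] d] ideal_inD(4)[OF P b Suc] ideal_inD(3)[OF P] by blast
  then show ?case
    by (simp add: algebra_simps)
qed (simp add: ideal_inD(2)[OF P])

lemma spanned_by_powersI:
  fixes P :: "'a::field fps fps poly set"
  assumes P: "prime_in rees_poly P" and m: "over_max P" and k: "k \<ge> 1"
    and span: "\<And>i j n. adm i j n \<Longrightarrow> mon i j n \<notin> P \<Longrightarrow>
      \<exists>r c. n = 2 ^ k * r \<and> mon i j n - cst c * vert k ^ r \<in> P"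
  shows "spanned_by_powers P (vert k)"
proof -
  \<comment> \<open>In degrees not divisible by \<open>2^k\<close> every monomial lies in
    \<open>P\<close> and the scalar is \<open>0\<close>; the value \<open>1\<close> only keeps the
    exponent positive.\<close>
  define p :: "nat \<Rightarrow> nat" where "p = (\<lambda>n. if 2 ^ k dvd n then n div 2 ^ k else 1)"
  have "\<exists>c. mon i j n - cst c * vert k ^ p n \<in> P" if adm: "adm i j n" for i j n
  proof (cases "mon i j n \<in> P")
    case True
    then show ?thesis
      by (intro exI[of _ 0]) (simp add: cst_simps)
  next
    case False
    then show ?thesis
      using span[OF adm] by (auto simp: p_def)
  qed
  moreover have "p n > 0" if "n > 0" for n
    using that by (auto simp: p_def dvd_def)
  ultimately show ?thesis
    unfolding spanned_by_powers_def by blast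
qed

lemma mon_vert:
  assumes adm: "adm i j n" and e: "on_edge l i j n" and l: "l \<ge> 1"
  obtains r where "n = 2 ^ l * r" "r \<le> 2 * i" "i \<le> r"
    "mon i j n = vert l ^ (2 * i - r) * vert (Suc l) ^ (r - i)"
proof -
  obtain r where "n = 2 ^ l * r" "r \<le> 2 * i" "i \<le> r" "j + l * i + r = 2 ^ l * r"
    using on_edge_obtain[OF adm e l] .
  then show ?thesis
    using that mon_on_edge by blast
qed

lemma vert_power_notin:
  assumes I: "ideal_in rees_poly P" and ni: "vert l ^ p * vert l' ^ q \<notin> P"
  shows "p = 0 \<or> vert l \<notin> P" "q = 0 \<or> vert l' \<notin> P"
proof -
  have pow: "v ^ p \<in> P" if "v \<in> P" "p \<noteq> 0" "v \<in> rees_poly" for v p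
  proof -
    have "v ^ p = v * v ^ (p - 1)"
      using \<open>p \<noteq> 0\<close> by (simp add: power_eq_if)
    then show ?thesis
      using ideal_inD(5)[OF I rees.T_power[OF \<open>v \<in> rees_poly\<close>] \<open>v \<in> P\<close>] by simp
  qed
  show "p = 0 \<or> vert l \<notin> P"
    using ni pow[of "vert l" p] ideal_inD(5)[OF I rees.T_power[OF vert_rees_poly]] vert_rees_poly
    by blast
  show "q = 0 \<or> vert l' \<notin> P"
    using ni pow[of "vert l'" q] ideal_inD(4)[OF I rees.T_power[OF vert_rees_poly]] vert_rees_poly
    by blast
qed

text \<open>Some monomial of positive degree is outside \<open>P\<close>. It is a product of the two
  vertices of an edge, or a power of the limit vertex, and the latter is excluded.\<close>

lemma ex_vert_notin:
  fixes P :: "'a::field fps fps poly set"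
  assumes P: "proj_in P" and m: "over_max P" and lim: "limit_vert \<in> P"
  shows "\<exists>k\<ge>1. vert k \<notin> P"
proof -
  note I = proj_inD(2)[OF P] and pr = proj_inD(1)[OF P]
  obtain n h where nh: "n > 0" "h \<in> filt n" "monom h n \<notin> P"
    using proj_inD(5)[OF P] by blast
  then obtain i j where ij: "h $ i $ j \<noteq> 0" "mon i j n \<notin> P"
    using monom_mem[OF I m] by blast
  then have adm: "adm i j n"
    using nh(2) by (simp add: filt_def)
  from mon_notin_cases[OF pr m adm ij(2)] show ?thesis
  proof (elim disjE exE conjE)
    fix l assume l: "1 \<le> l" "on_edge l i j n"
    obtain r where r: "n = 2 ^ l * r" "r \<le> 2 * i" "i \<le> r"
      "mon i j n = (vert l ^ (2 * i - r) * vert (Suc l) ^ (r - i) :: 'a fps fps poly)"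
      using mon_vert[OF adm l(2,1)] by blast
    have "2 * i - r \<noteq> 0 \<or> r - i \<noteq> 0"
      using r(1-3) nh(1) by (cases r) auto
    then show ?thesis
      using vert_power_notin[OF I, of l "2 * i - r" "Suc l" "r - i"] ij(2) l(1) unfolding r(4)
      by (metis le_SucI)
  next
    assume "i = 0" "j = n"
    then have "mon i j n = limit_vert * (mon 0 (n - 1) (n - 1) :: 'a fps fps poly)"
      using nh(1) by (simp add: limit_vert_def mon_mult)
    then show ?thesis
      using ideal_inD(5)[OF I _ lim, of "mon 0 (n - 1) (n - 1)"] ij(2) by simp
  qed
qed

text \<open>The points of the fiber by the vertices they miss: the limit vertex gives the limit
  point, two neighbours give the generic point of a line or a closed point between its ends, and an
  isolated one gives the vertex point.\<close>

lemma proj_over_max_cases: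
  fixes P :: "complex fps fps poly set"
  assumes P: "proj_in P" and m: "over_max P"
  shows "(\<exists>k\<ge>1. P = edge_prime k) \<or> (\<exists>w\<in>rees_poly. spanned_by_powers P w)"
proof -
  note I = proj_inD(2)[OF P] and pr = proj_inD(1)[OF P]
  note power = rees.prime_power[OF pr]
  show ?thesis
  proof (cases "limit_vert \<in> P")
    case False
    have "\<exists>c. mon i j n - cst c * limit_vert ^ n \<in> P" if adm: "adm i j n" for i j n
    proof (cases "mon i j n \<in> P")
      case True
      then show ?thesis
        by (intro exI[of _ 0]) (simp add: cst_simps)
    next
      case ni: False
      have "adm 0 1 1"
        by (rule adm_Y)
      have "mon i j n * limit_vert \<notin> P"
        using prime_inD(3)[OF pr, of "mon i j n" limit_vert] adm ni False by auto
      then have "mon (i + 0) (j + 1) (n + 1) \<notin> P"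
        by (simp add: limit_vert_def mon_mult)
      from mon_notin_cases[OF pr m adm_add[OF adm \<open>adm 0 1 1\<close>] this]
      have "i = 0" "j = n"
        using on_edge_add[OF adm \<open>adm 0 1 1\<close>] by (auto simp: on_edge_def)
      then show ?thesis
        using ideal_inD(2)[OF I] by (intro exI[of _ 1]) (simp add: cst_simps limit_vert_def mon_power)
    qed
    then have "spanned_by_powers P limit_vert"
      unfolding spanned_by_powers_def by (intro exI[of _ "\<lambda>n. n"]) simp
    then show ?thesis
      using limit_vert_rees_poly by blast
  next
    case True
    obtain k0 where k0: "k0 \<ge> 1" "vert k0 \<notin> P"
      using ex_vert_notin[OF P m True] by blast
    show ?thesis
    proof (cases "\<exists>k\<ge>1. vert k \<notin> P \<and> vert (Suc k) \<notin> P")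
      case True
      then obtain k where k: "k \<ge> 1" and v: "vert k \<notin> P" "vert (Suc k) \<notin> P"
        by blast
      show ?thesis
      proof (cases "P = edge_prime k")
        case False
        obtain c where c: "vert k ^ 2 - cst c * vert (Suc k) \<in> P"
          using edge_prime_form[OF P m k v False] .
        \<comment> \<open>Because \<open>vert k\<close> is outside \<open>P\<close>, the relation
          can be solved for \<open>vert (Suc k)\<close>, and monomials on the edge reduce to scalars
          times powers of \<open>vert k\<close>.\<close>
        have "c \<noteq> 0"
        proof
          assume "c = 0"
          then have "vert k ^ 2 \<in> P"
            using c by (simp add: cst_simps)
          then show False
            using power[OF vert_rees_poly] v(1) by blast
        qed
        then have "cst (inverse c) * (cst c * vert (Suc k) - vert k ^ 2) = vert (Suc k) - cst (inverse c) * vert k ^ 2"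
          by (simp only: right_diff_distrib mult.assoc[symmetric] cst_simps(4)[symmetric])
            (simp add: cst_simps)
        moreover have "cst c * vert (Suc k) - vert k ^ 2 \<in> P"
          using rees.ideal_diff[OF I ideal_inD(2)[OF I] c] by simp
        ultimately have v2: "vert (Suc k) - cst (inverse c) * vert k ^ 2 \<in> P"
          using ideal_inD(4)[OF I cst_rees_poly] by metis
        have "spanned_by_powers P (vert k)"
        proof (rule spanned_by_powersI[OF pr m k])
          fix i j n assume adm: "adm i j n" and ni: "mon i j n \<notin> P"
          have "on_edge k i j n"
            using ni edge_prime_least[OF pr m v] adm mon_face_prime_iff[of i j n "on_edge k"] by blast
          from mon_vert[OF adm this k] obtain r where r: "n = 2 ^ k * r" "r \<le> 2 * i" "i \<le> r"
            "mon i j n = vert k ^ (2 * i - r) * (vert (Suc k) :: complex fps fps poly) ^ (r - i)"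
            by blast
          have "vert (Suc k) ^ (r - i) - (cst (inverse c) * vert k ^ 2) ^ (r - i) \<in> P"
            by (rule power_diff_mem[OF I _ _ v2]) (intro vert_rees_poly rees.T(4) cst_rees_poly rees.T_power)+
          then have "vert k ^ (2 * i - r) * (vert (Suc k) ^ (r - i) - (cst (inverse c) * vert k ^ 2) ^ (r - i)) \<in> P"
            by (rule ideal_inD(4)[OF I rees.T_power[OF vert_rees_poly]])
          moreover have "vert k ^ (2 * i - r) * (cst (inverse c) * vert k ^ 2) ^ (r - i) =
              cst (inverse c ^ (r - i)) * vert k ^ r"
          proof -
            have "2 * i - r + 2 * (r - i) = r"
              using r by simp
            then have "vert k ^ (2 * i - r) * (vert k ^ 2) ^ (r - i) = (vert k ^ r :: complex fps fps poly)"
              by (simp flip: power_mult power_add)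
            then show ?thesis
              by (simp add: power_mult_distrib cst_power mult.left_commute)
          qed
          ultimately show "\<exists>r c. n = 2 ^ k * r \<and> mon i j n - cst c * vert k ^ r \<in> P"
            using r(1,4) by (metis right_diff_distrib)
        qed
        then show ?thesis
          using vert_rees_poly by blast
      qed (use k in blast)
    next
      case False
      \<comment> \<open>The neighbouring vertices of positive index lie in \<open>P\<close>, so a
        surviving monomial on an edge through vertex \<open>k0\<close> is a pure power of
        \<open>vert k0\<close>.\<close>
      have "spanned_by_powers P (vert k0)"
      proof (rule spanned_by_powersI[OF pr m k0(1)])
        fix i j n assume adm: "adm i j n" and ni: "mon i j n \<notin> P"
        obtain l where l: "l \<ge> 1" "on_edge l i j n" "l = k0 \<or> Suc l = k0"
          using mon_notin_edge[OF pr m adm ni k0(2)] by blast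
        obtain r where r: "n = 2 ^ l * r" "r \<le> 2 * i" "i \<le> r"
          "mon i j n = vert l ^ (2 * i - r) * (vert (Suc l) :: complex fps fps poly) ^ (r - i)"
          using mon_vert[OF adm l(2,1)] by blast
        have pr': "(2 * i - r = 0 \<or> vert l \<notin> P) \<and> (r - i = 0 \<or> vert (Suc l) \<notin> P)"
          using vert_power_notin[OF I] ni unfolding r(4) by blast
        have "\<exists>r. n = 2 ^ k0 * r \<and> mon i j n = (vert k0 :: complex fps fps poly) ^ r"
          using l(3)
        proof
          assume "l = k0"
          then have "r = i"
            using pr' False k0 r(3) by auto
          then show ?thesis
            using r(1,4) \<open>l = k0\<close> by (intro exI[of _ r]) simp
        next
          assume "Suc l = k0"
          then have "r = 2 * i"
            using pr' False k0 l(1) r(2) by auto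
          then show ?thesis
            using r(1,4) \<open>Suc l = k0\<close>[symmetric] by (intro exI[of _ i]) simp
        qed
        then show "\<exists>r c. n = 2 ^ k0 * r \<and> mon i j n - cst c * vert k0 ^ r \<in> P"
          using ideal_inD(2)[OF I] by (metis cancel_comm_monoid_add_class.diff_cancel cst_simps(2) mult_1)
      qed
      then show ?thesis
        using vert_rees_poly by blast
    qed
  qed
qed

lemma proj_over_max_chain:
  fixes P Q :: "complex fps fps poly set"
  assumes "proj_in P" "over_max P" "proj_in Q" "P \<subset> Q"
  shows "\<exists>k\<ge>1. P = edge_prime k"
  using proj_over_max_cases[OF assms(1,2)] spanned_by_powers_maximal[OF assms(1,3) _ assms(2)] assms(4) by blast

section \<open>Primes not over the maximal ideal\<close>

text \<open>The image of the point in Spec of the power series ring.\<close>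

definition contraction :: "'a::field fps fps poly set \<Rightarrow> 'a fps fps set" where
  "contraction P = {a. monom a 0 \<in> P}"

lemma prime_contraction:
  assumes P: "prime_in rees_poly P"
  shows "prime_in UNIV (contraction P)"
  unfolding prime_in_def ideal_in_def
proof (intro conjI ballI impI)
  note I = ideal_inD[OF prime_inD(1)[OF P]]
  show "0 \<in> contraction P" "1 \<notin> contraction P"
    using I(2) prime_inD(2)[OF P] by (simp_all add: contraction_def monom_0 flip: one_pCons)
  show "a + b \<in> contraction P" if "a \<in> contraction P" "b \<in> contraction P" for a b
    using that I(3) by (auto simp: contraction_def simp flip: add_monom)
  have const: "monom a 0 \<in> rees_poly" for a :: "'a fps fps"
    by (simp add: monom_rees_poly_iff filt_0)
  have mult: "monom (a * b) 0 = monom a 0 * monom b 0" for a b :: "'a fps fps"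
    by (simp add: mult_monom)
  show "a * b \<in> contraction P" if "b \<in> contraction P" for a b
    using that I(4)[OF const] by (auto simp: contraction_def mult)
  show "a \<in> contraction P \<or> b \<in> contraction P" if "a * b \<in> contraction P" for a b
    using that prime_inD(3)[OF P const const] by (auto simp: contraction_def mult)
qed simp

lemma over_max_iff: "over_max P \<longleftrightarrow> max_ideal \<subseteq> contraction P"
  by (auto simp: over_max_def contraction_def)

text \<open>One of \<open>x\<close>, \<open>y\<close> is outside the contraction, and the
  \<open>n\<close>-th powers of both lie in \<open>I_n\<close>. So each \<open>I_n\<close> becomes
  the unit ideal after localization at the contraction.\<close>

lemma contraction_power_notin:
  fixes P :: "'a::field fps fps poly set"
  assumes P: "prime_in rees_poly P" and m: "\<not> over_max P"
  obtains b where "b \<in> filt n" "b \<notin> contraction P"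
proof -
  have pr: "prime_in UNIV (contraction P)"
    by (rule prime_contraction[OF P])
  have "fps_X \<notin> contraction P \<or> fps_Y \<notin> contraction P"
    using m max_ideal_subset[OF prime_inD(1)[OF pr]] unfolding over_max_iff by blast
  then have "fps_X ^ n \<notin> contraction P \<or> fps_Y ^ n \<notin> contraction P"
    using type_ring.prime_power[OF pr UNIV_I] by blast
  moreover have "(fps_X :: 'a fps fps) ^ n \<in> filt n" "(fps_Y :: 'a fps fps) ^ n \<in> filt n"
    using monomial_filt[OF adm_X[of n]] monomial_filt[OF adm_Y[of n]] by simp_all
  ultimately show ?thesis
    using that by blast
qed

text \<open>Outside the closed fiber a point of Proj is determined by its image in Spec. If
  \<open>h\<close> is in the contraction, then \<open>b * (h t^n) = h * (b t^n)\<close> with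
  \<open>b\<close> in \<open>I_n\<close> outside the contraction puts \<open>h t^n\<close> into
  \<open>P\<close>.\<close>

lemma mem_iff_contraction:
  fixes P :: "'a::field fps fps poly set"
  assumes P: "proj_in P" and m: "\<not> over_max P" and f: "f \<in> rees_poly"
  shows "f \<in> P \<longleftrightarrow> (\<forall>n. coeff f n \<in> contraction P)"
proof -
  note pr = proj_inD(1)[OF P] and I = proj_inD(2)[OF P]
  note cpr = prime_contraction[OF pr]
  have const: "monom a 0 \<in> rees_poly" for a :: "'a fps fps"
    by (simp add: monom_rees_poly_iff filt_0)
  have monom: "monom h n \<in> P \<longleftrightarrow> h \<in> contraction P" if h: "h \<in> filt n" for h n
  proof
    assume "h \<in> contraction P"
    obtain b where b: "b \<in> filt n" "b \<notin> contraction P"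
      using contraction_power_notin[OF pr m] .
    have "monom h 0 * monom b n \<in> P"
      using \<open>h \<in> contraction P\<close> b(1)
      by (intro ideal_inD(5)[OF I]) (simp_all add: contraction_def monom_rees_poly_iff)
    moreover have "monom h 0 * monom b n = monom b 0 * monom h n"
      by (simp add: mult_monom mult.commute)
    ultimately show "monom h n \<in> P"
      using prime_inD(3)[OF pr const, of "monom h n" b] b(2) h
      by (simp add: contraction_def monom_rees_poly_iff)
  next
    assume hP: "monom h n \<in> P"
    \<comment> \<open>For the converse, \<open>c^n * (h t^n)^N = h^N * (c t^N)^n\<close>, and
      \<open>c t^N\<close> is outside \<open>P\<close>, so \<open>h^N\<close> in degree
      \<open>0\<close> must lie in \<open>P\<close>.\<close>
    obtain N c where c: "N > 0" "c \<in> filt N" "monom c N \<notin> P"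
      using proj_inD(5)[OF P] by blast
    have pow: "monom a k ^ l = monom (a ^ l) (k * l)" for a :: "'a fps fps" and k l
      by (induction l) (simp_all add: mult_monom monom_0)
    have mem: "monom h n \<in> rees_poly" "monom c N \<in> rees_poly"
      using h c by (simp_all add: monom_rees_poly_iff)
    have "monom h n ^ N = monom h n * monom h n ^ (N - 1)"
      using c(1) by (simp add: power_eq_if)
    then have "monom (h ^ N) (n * N) \<in> P"
      using ideal_inD(5)[OF I rees.T_power[OF mem(1)] hP] by (simp add: pow)
    then have "monom (c ^ n) 0 * monom (h ^ N) (n * N) \<in> P"
      by (rule ideal_inD(4)[OF I const])
    then have "monom (h ^ N) 0 * monom c N ^ n \<in> P"
      by (simp add: pow mult_monom mult.commute)
    moreover have "monom c N ^ n \<notin> P"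
      using rees.prime_power[OF pr mem(2)] c(3) by blast
    ultimately have "h ^ N \<in> contraction P"
      using prime_inD(3)[OF pr const rees.T_power[OF mem(2)]] by (auto simp: contraction_def)
    then show "h \<in> contraction P"
      by (rule type_ring.prime_power[OF cpr UNIV_I])
  qed
  have "f \<in> P \<longleftrightarrow> (\<forall>n. monom (coeff f n) n \<in> P)"
    using proj_inD(4)[OF P] poly_mem[OF I] by blast
  also have "\<dots> \<longleftrightarrow> (\<forall>n. coeff f n \<in> contraction P)"
    using monom f by (simp add: rees_poly_def)
  finally show ?thesis .
qed

lemma contraction_less:
  assumes P: "proj_in P" "\<not> over_max P" and Q: "proj_in Q" "\<not> over_max Q" and less: "P \<subset> Q"
  shows "contraction P \<subset> contraction Q"
proof
  show "contraction P \<subseteq> contraction Q"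
    using less by (auto simp: contraction_def)
  show "contraction P \<noteq> contraction Q"
  proof
    assume "contraction P = contraction Q"
    then have "f \<in> P \<longleftrightarrow> f \<in> Q" if "f \<in> rees_poly" for f
      using mem_iff_contraction[OF P that] mem_iff_contraction[OF Q that] by simp
    then have "P = Q"
      using ideal_inD(1)[OF proj_inD(2)[OF P(1)]] ideal_inD(1)[OF proj_inD(2)[OF Q(1)]] by blast
    then show False
      using less by blast
  qed
qed

text \<open>For \<open>k \<ge> 1\<close>, edge \<open>k\<close> in degree \<open>2^k * 4 * N\<close>
  has \<open>x\<close>-exponents from \<open>2 * N\<close> to \<open>4 * N\<close>, with midpoint
  \<open>3 * N\<close>. The value \<open>v\<close> carries monomials of weight
  \<open>j + k * i = e\<close> onto the edge; \<open>e \<le> N\<close> leaves room for the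
  inequalities of the other edges.\<close>

lemma adm_shift:
  assumes e: "e \<le> j + k * i" "e \<le> N" and v: "v + e + k * (3 * N) + 4 * N = 2 ^ k * (4 * N)"
  shows "adm (i + 3 * N) (j + v) (2 ^ k * (4 * N))"
  unfolding adm_def
proof
  fix l
  show "2 ^ l * (2 ^ k * (4 * N)) \<le> 2 ^ l * (j + v + l * (i + 3 * N)) + 2 ^ k * (4 * N)"
  proof (cases "k \<le> l")
    case True
    then obtain d where d: "l = k + d"
      using le_Suc_ex by blast
    \<comment> \<open>Times \<open>2^k * N\<close>, this is what inequality \<open>k + d\<close>
      still demands after the exponent \<open>3 * N\<close> has contributed
      \<open>3 * d * N\<close>.\<close>
    have d4: "2 ^ d * (4::nat) \<le> 2 ^ d * (3 * d) + 4"
    proof (cases "d \<le> 1")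
      case False
      then show ?thesis
        by (intro trans_le_add1 mult_le_mono2) simp
    qed (cases d, auto)
    have "2 ^ k * (4 * N) + 3 * d * N \<le> j + v + l * (i + 3 * N) + 4 * N"
      using e(1) v unfolding d by (simp add: algebra_simps)
    then have "2 ^ l * (2 ^ k * (4 * N) + 3 * d * N) \<le> 2 ^ l * (j + v + l * (i + 3 * N) + 4 * N)"
      by (rule mult_le_mono2)
    then have 1: "2 ^ l * (2 ^ k * (4 * N)) + 2 ^ l * (3 * d * N) \<le> 2 ^ l * (j + v + l * (i + 3 * N)) + 2 ^ l * (4 * N)"
      by (simp only: distrib_left)
    have "(2 ^ k * N) * (2 ^ d * 4) \<le> (2 ^ k * N) * (2 ^ d * (3 * d) + 4)"
      using d4 by (rule mult_le_mono2)
    then have "2 ^ l * (4 * N) \<le> 2 ^ l * (3 * d * N) + 2 ^ k * (4 * N)"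
      unfolding d by (simp add: power_add algebra_simps)
    with 1 show ?thesis
      by linarith
  next
    case False
    then obtain d where d: "k = l + d"
      using le_Suc_ex by (metis nat_le_linear)
    \<comment> \<open>For index \<open>k - d\<close> the loss is at most \<open>N\<close> from
      \<open>e\<close>, \<open>3 * d * N\<close> from the flatter slope and \<open>4 * N\<close>
      from the edge equation; the inequality tolerates \<open>2^d * 4 * N\<close>.\<close>
    have d5: "5 + 3 * d \<le> 2 ^ d * (4::nat)" if "d > 0" for d :: nat
      using that
    proof (induction d)
      case (Suc d)
      then show ?case
        by (cases "d = 0") auto
    qed simp
    have "2 ^ k * (4 * N) \<le> j + v + l * (i + 3 * N) + (5 + 3 * d) * N"
      using e(2) v unfolding d by (simp add: algebra_simps)
    also have "\<dots> \<le> j + v + l * (i + 3 * N) + (2 ^ d * 4) * N"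
      using d5[of d] False d by (intro add_left_mono mult_le_mono1) simp
    finally have "2 ^ l * (2 ^ k * (4 * N)) \<le> 2 ^ l * (j + v + l * (i + 3 * N) + (2 ^ d * 4) * N)"
      by (rule mult_le_mono2)
    then show ?thesis
      by (simp add: d power_add algebra_simps)
  qed
qed

lemma fps_fps_monomial_mult_nth:
  "(fps_X ^ u * fps_Y ^ v * f) $ a $ b = (if u \<le> a \<and> v \<le> b then f $ (a - u) $ (b - v) else 0)"
  for f :: "'a::field fps fps"
proof -
  have "fps_X ^ u * fps_Y ^ v * f = fps_X ^ u * (fps_const (fps_X ^ v) * f)"
    by (simp only: mult.assoc fps_const_power)
  then show ?thesis
    by (simp only: fps_X_power_mult_nth fps_mult_left_const_nth) (auto simp: fps_X_power_mult_nth)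
qed

text \<open>A suitable monomial multiple moves the initial form of \<open>f\<close> with respect to the weight of an
  edge into the interior of that edge, so the local ring at an edge prime is the discrete valuation
  ring of this weight.\<close>

lemma multiple_notin_edge_prime:
  fixes f :: "'a::field fps fps"
  assumes f: "f \<noteq> 0" and k: "k \<ge> 1"
  obtains g n where "g * f \<in> filt n" "monom (g * f) n \<notin> edge_prime k"
proof -
  obtain i0 j0 where "f $ i0 $ j0 \<noteq> 0"
    using f by (metis fps_ext fps_zero_nth)
  then obtain i1 j1 where ij1: "f $ i1 $ j1 \<noteq> 0"
    and min: "\<And>i j. f $ i $ j \<noteq> 0 \<Longrightarrow> j1 + k * i1 \<le> j + k * i"
    using ex_has_least_nat[of "\<lambda>(i, j). f $ i $ j \<noteq> 0" "(i0, j0)" "\<lambda>(i, j). j + k * i"] by auto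
  define e where "e = j1 + k * i1"
  define N where "N = e + 1"
  have "e + k * (3 * N) + 4 * N \<le> Suc k * (4 * N)"
  proof -
    have "e \<le> k * N"
      using mult_le_mono1[OF k, of N] by (simp add: N_def)
    then show ?thesis
      by (simp add: algebra_simps)
  qed
  also have "\<dots> \<le> 2 ^ k * (4 * N)"
    by (rule mult_le_mono1[OF Suc_le_power_2])
  finally obtain v where v: "v + e + k * (3 * N) + 4 * N = 2 ^ k * (4 * N)"
    using le_Suc_ex by (metis add.assoc add.commute)
  let ?g = "fps_X ^ (3 * N) * fps_Y ^ v :: 'a fps fps" and ?n = "2 ^ k * (4 * N)"
  have adm: "adm (i + 3 * N) (j + v) ?n" if "f $ i $ j \<noteq> 0" for i j
    using min[OF that] by (intro adm_shift[OF _ _ v]) (simp_all add: e_def N_def)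
  have "?g * f \<in> filt ?n"
    unfolding filt_def
  proof (intro CollectI allI impI)
    fix a b assume "(?g * f) $ a $ b \<noteq> 0"
    then have "3 * N \<le> a" "v \<le> b" "f $ (a - 3 * N) $ (b - v) \<noteq> 0"
      unfolding fps_fps_monomial_mult_nth by (auto split: if_splits)
    then show "adm a b ?n"
      using adm[of "a - 3 * N" "b - v"] by simp
  qed
  moreover have "monom (?g * f) ?n \<notin> edge_prime k"
  proof -
    have "on_edge k (i1 + 3 * N) (j1 + v) ?n"
    proof -
      have "j1 + v + k * (i1 + 3 * N) + 4 * N = 2 ^ k * (4 * N)"
        using v by (simp add: e_def algebra_simps)
      then have "2 ^ k * (j1 + v + k * (i1 + 3 * N) + 4 * N) = 2 ^ k * (2 ^ k * (4 * N))"
        by (simp only:)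
      then show ?thesis
        unfolding on_edge_def by (simp only: distrib_left)
    qed
    moreover have "(?g * f) $ (i1 + 3 * N) $ (j1 + v) \<noteq> 0"
      unfolding fps_fps_monomial_mult_nth using ij1 by simp
    then have "coeff (monom (?g * f) ?n) ?n $ (i1 + 3 * N) $ (j1 + v) \<noteq> 0"
      by (simp only: coeff_monom if_True simp_thms)
    ultimately show ?thesis
      unfolding face_prime_def by blast
  qed
  ultimately show ?thesis
    using that by blast
qed

text \<open>Take a nonzero coefficient of a member of \<open>P\<close>: a multiple of it escapes the
  edge prime in some degree, yet lies in \<open>P\<close>, because \<open>P\<close> is determined by
  its contraction.\<close>

lemma subset_edge_prime:
  fixes P :: "'a::field fps fps poly set"
  assumes P: "proj_in P" and m: "\<not> over_max P" and sub: "P \<subseteq> edge_prime k" and k: "k \<ge> 1"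
  shows "P = {0}"
proof (rule ccontr)
  assume "P \<noteq> {0}"
  then obtain p where p: "p \<in> P" "p \<noteq> 0"
    using ideal_inD(2)[OF proj_inD(2)[OF P]] by blast
  then obtain n0 where "coeff p n0 \<noteq> 0"
    by (metis leading_coeff_0_iff)
  then obtain g n where gn: "g * coeff p n0 \<in> filt n" "monom (g * coeff p n0) n \<notin> edge_prime k"
    using multiple_notin_edge_prime[OF _ k] by blast
  have "p \<in> rees_poly"
    using p(1) ideal_inD(1)[OF proj_inD(2)[OF P]] by blast
  then have "coeff p n0 \<in> contraction P"
    using mem_iff_contraction[OF P m] p(1) by blast
  then have "g * coeff p n0 \<in> contraction P"
    using ideal_inD(4)[OF prime_inD(1)[OF prime_contraction[OF proj_inD(1)[OF P]]]] by blast
  moreover have "0 \<in> contraction P"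
    using ideal_inD(2)[OF prime_inD(1)[OF prime_contraction[OF proj_inD(1)[OF P]]]] .
  ultimately have "monom (g * coeff p n0) n \<in> P"
    using mem_iff_contraction[OF P m, of "monom (g * coeff p n0) n"] gn(1)
    by (auto simp: monom_rees_poly_iff)
  then show False
    using gn(2) sub by blast
qed

section \<open>Dimensions\<close>

text \<open>The middle point has a larger point above it and is therefore an edge prime, but edge
  primes are minimal over the maximal ideal.\<close>

lemma over_max_no_chain:
  fixes d :: "nat \<Rightarrow> complex fps fps poly set"
  assumes "\<And>i. i \<le> 2 \<Longrightarrow> proj_in (d i)" "over_max (d 0)" "d 0 \<subset> d 1" "d 1 \<subset> d 2"
  shows False
proof -
  have "over_max (d 1)"
    using over_max_mono[OF assms(2)] assms(3) by blast
  then obtain k where k: "k \<ge> 1" "d 1 = edge_prime k"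
    using proj_over_max_chain[of "d 1" "d 2"] assms(1,4) by auto
  then have "d 0 = edge_prime k"
    using minimal_edge_prime[OF k(1), of "d 0"] proj_inD(1) assms(1-3) by auto
  then show False
    using k assms(3) by blast
qed

text \<open>Applied to the whole fiber and to the closure of a single edge point.\<close>

lemma chain_dim_fiber:
  fixes F :: "complex fps fps poly set set"
  assumes "\<And>P. P \<in> F \<Longrightarrow> proj_in P \<and> over_max P" "k \<ge> 1" "edge_prime k \<in> F" "vert_prime k \<in> F"
  shows "chain_dim F = 1"
proof -
  have "chain_dim F = ereal (real 1)"
  proof (rule chain_dim_eqI[where c = "\<lambda>i. if i = 0 then edge_prime k else vert_prime k"])
    fix d :: "nat \<Rightarrow> complex fps fps poly set"
    assume d: "\<forall>i\<le>Suc 1. d i \<in> F" "\<forall>i<Suc 1. d i \<subset> d (Suc i)"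
    show False
    proof (rule over_max_no_chain[of d])
      show "proj_in (d i)" if "i \<le> 2" for i
        using d(1) assms(1) that by simp
      show "over_max (d 0)"
        using d(1) assms(1) by simp
      show "d 0 \<subset> d 1" "d 1 \<subset> d 2"
        using d(2) by (auto simp: numeral_2_eq_2)
    qed
  qed (use assms edge_prime_less_vert_prime[OF assms(2)] in auto)
  then show ?thesis
    by simp
qed

text \<open>The zero ideal is the prime of the improper face.\<close>

lemma proj_in_zero: "proj_in ({0} :: 'a::field fps fps poly set)"
proof -
  have "face_prime (\<lambda>_ _ _. True) = ({0} :: 'a fps fps poly set)"
    by (auto simp: face_prime_def rees.T intro!: poly_eqI fps_ext)
  moreover have "proj_in (face_prime (\<lambda>_ _ _. True) :: 'a fps fps poly set)"
    by (rule proj_in_face_prime[OF _ _ adm_X[of 1]]) (auto simp: face_def)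
  ultimately show ?thesis
    by simp
qed

text \<open>In a chain of four points the second is off the fiber. If the third is off it too,
  contraction turns the first three into a chain of non-maximal primes of the power series ring;
  otherwise the third is an edge prime and the second is zero.\<close>

lemma chain_dim_proj: "chain_dim {P :: complex fps fps poly set. proj_in P} = 2"
proof -
  have "chain_dim {P :: complex fps fps poly set. proj_in P} = ereal (real 2)"
  proof (rule chain_dim_eqI)
    let ?c = "\<lambda>i::nat. if i = 0 then {0 :: complex fps fps poly} else if i = 1 then edge_prime 1 else vert_prime 1"
    show "\<forall>i\<le>2. ?c i \<in> {P. proj_in P}"
      using proj_in_zero edge_prime(1)[of 1] vert_prime(1)[of 1] by auto
    have "vert 3 \<in> (edge_prime 1 :: complex fps fps poly set)"
      by (simp add: vert_in_edge_prime)
    moreover have "(vert 3 :: complex fps fps poly) \<noteq> 0"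
      using coeff_mon[of 1 "2 ^ 3 - 1 - 3" "2 ^ 3" "2 ^ 3" 1 "2 ^ 3 - 1 - 3"]
      unfolding vert_def by (metis coeff_0 fps_zero_nth zero_neq_one)
    moreover have "0 \<in> (edge_prime 1 :: complex fps fps poly set)"
      by (rule ideal_inD(2)[OF proj_inD(2)[OF edge_prime(1)]]) simp
    ultimately have "{0 :: complex fps fps poly} \<subset> edge_prime 1"
      by blast
    moreover have "edge_prime 1 \<subset> (vert_prime 1 :: complex fps fps poly set)"
      by (rule edge_prime_less_vert_prime) simp
    ultimately show "\<forall>i<2. ?c i \<subset> ?c (Suc i)"
      by (auto simp only: less_Suc_eq numeral_2_eq_2 One_nat_def split: if_splits)
  next
    fix d :: "nat \<Rightarrow> complex fps fps poly set"
    assume "\<forall>i\<le>Suc 2. d i \<in> {P. proj_in P}" and less: "\<forall>i<Suc 2. d i \<subset> d (Suc i)"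
    then have d: "proj_in (d i)" if "i \<le> 3" for i
      using that by simp
    have less: "d 0 \<subset> d 1" "d 1 \<subset> d 2" "d 2 \<subset> d 3"
      using less by (simp_all add: numeral_2_eq_2 numeral_3_eq_3)
    have m1: "\<not> over_max (d 1)"
    proof
      assume "over_max (d 1)"
      then show False
        using over_max_no_chain[of "\<lambda>i. d (Suc i)"] d less
        by (simp add: numeral_2_eq_2 numeral_3_eq_3)
    qed
    then have m0: "\<not> over_max (d 0)"
      using over_max_mono less(1) by blast
    show False
    proof (cases "over_max (d 2)")
      case False
      have *: "contraction (d 0) \<subset> contraction (d 1)" "contraction (d 1) \<subset> contraction (d 2)"
        using contraction_less[OF d m0 d m1 less(1)] contraction_less[OF d m1 d False less(2)] by simp_all
      have pr: "prime_in UNIV (contraction (d i))" if "i \<le> 3" for i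
        using prime_contraction[OF proj_inD(1)[OF d[OF that]]] .
      have "contraction (d 1) \<noteq> {0}"
        using *(1) ideal_inD(2)[OF prime_inD(1)[OF pr[of 0]]] by auto
      then have "contraction (d 2) = max_ideal"
        using prime_chain_max[OF pr _ pr *(2)] by simp
      then show False
        using False by (simp add: over_max_iff)
    next
      case True
      then obtain k where k: "k \<ge> 1" "d 2 = edge_prime k"
        using proj_over_max_chain[of "d 2" "d 3"] d less(3) by auto
      then have "d 1 = {0}"
        using subset_edge_prime[OF d m1, of k] less(2) by auto
      then show False
        using less(1) ideal_inD(2)[OF proj_inD(2)[OF d[of 0]]] by auto
    qed
  qed
  then show ?thesis
    by simp
qed

section \<open>Quasi-compactness fails\<close>

text \<open>On the fiber this is \<open>ex_vert_notin\<close>. Elsewhere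
  \<open>limit_vert = y t\<close> and \<open>vert 1 = x t^2\<close> suffice, as \<open>x\<close> or
  \<open>y\<close> is outside the contraction.\<close>

lemma ex_vertex:
  fixes P :: "'a::field fps fps poly set"
  assumes P: "proj_in P"
  shows "limit_vert \<notin> P \<or> (\<exists>k\<ge>1. vert k \<notin> P)"
proof (cases "over_max P")
  case True
  then show ?thesis
    using ex_vert_notin[OF P] by blast
next
  case False
  note pr = prime_contraction[OF proj_inD(1)[OF P]]
  have "fps_X \<notin> contraction P \<or> fps_Y \<notin> contraction P"
    using False max_ideal_subset[OF prime_inD(1)[OF pr]] unfolding over_max_iff by blast
  moreover have "coeff (limit_vert :: 'a fps fps poly) 1 = fps_Y" "coeff (vert 1 :: 'a fps fps poly) 2 = fps_X"
    by (simp_all add: limit_vert_def vert_def mon_def)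
  ultimately have "limit_vert \<notin> P \<or> vert 1 \<notin> P"
    using mem_iff_contraction[OF P False limit_vert_rees_poly] mem_iff_contraction[OF P False vert_rees_poly[of 1]]
    by metis
  then show ?thesis
    by blast
qed

text \<open>The limit vertex and all \<open>vert k\<close> with \<open>k \<ge> 1\<close> give an
  open cover. The point \<open>vert_prime k\<close> lies in the set of \<open>vert k\<close> alone,
  so a subcover must keep all of these.\<close>

lemma not_compact_proj_rees:
  "\<not> compact_space (subtopology (zariski (rees :: ('a::field fps fps, nat \<Rightarrow> 'a fps fps) up_ring)) (proj_points rees rees_gr))"
proof
  interpret X: prime_space "rees :: ('a fps fps, nat \<Rightarrow> 'a fps fps) up_ring" "proj_points rees rees_gr"
    by (rule prime_space_rees)
  assume compact: "compact_space X.X"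
  define D :: "'a fps fps poly \<Rightarrow> (nat \<Rightarrow> 'a fps fps) set set"
    where "D = (\<lambda>v. {p \<in> proj_points rees rees_gr. \<not> {coeff v} \<subseteq> p})"
  have D: "coeff ` P \<in> D v \<longleftrightarrow> proj_in P \<and> v \<notin> P" for P v
    unfolding D_def by (simp add: proj_points_image)
  have "openin X.X (D v)" if "v \<in> rees_poly" for v
    unfolding X.openin_iff D_def using that by (intro exI[of _ "{coeff v}"]) (auto simp: carrier_rees)
  define \<U> where "\<U> = insert (D limit_vert) ((\<lambda>k. D (vert k)) ` {1..})"
  have "\<Union>\<U> = topspace X.X"
  proof
    show "\<Union>\<U> \<subseteq> topspace X.X"
      unfolding X.topspace \<U>_def D_def by auto
    show "topspace X.X \<subseteq> \<Union>\<U>"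
    proof
      fix p assume "p \<in> topspace X.X"
      then have "p \<in> proj_points rees rees_gr"
        by (simp only: X.topspace)
      then obtain P where P: "p = coeff ` P" "proj_in P"
        unfolding proj_points_rees by blast
      then show "p \<in> \<Union>\<U>"
        using ex_vertex[OF P(2)] D[of P] unfolding \<U>_def by auto
    qed
  qed
  moreover have "\<forall>U\<in>\<U>. openin X.X U"
    unfolding \<U>_def using \<open>\<And>v. v \<in> rees_poly \<Longrightarrow> openin X.X (D v)\<close> by auto
  ultimately obtain \<F> where \<F>: "finite \<F>" "\<F> \<subseteq> \<U>" "\<Union>\<F> = topspace X.X"
    using compact unfolding compact_space by meson
  have "D (vert k) \<in> \<F>" if k: "k \<ge> 1" for k
  proof -
    have "coeff ` vert_prime k \<in> \<Union>\<F>"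
      unfolding \<F>(3) X.topspace proj_points_image using vert_prime(1)[OF k] .
    then obtain U where U: "U \<in> \<F>" "coeff ` vert_prime k \<in> U"
      by blast
    have "U \<noteq> D limit_vert"
      using U(2) D[of "vert_prime k" limit_vert] limit_vert_in_vert_prime[of k] by blast
    then obtain l where l: "U = D (vert l)"
      using U(1) \<F>(2) unfolding \<U>_def by blast
    then have "l = k"
      using U(2) D[of "vert_prime k" "vert l"] vert_in_vert_prime[OF k, of l] by blast
    then show ?thesis
      using U(1) l by simp
  qed
  then have "(\<lambda>k. D (vert k)) ` {1..} \<subseteq> \<F>"
    by auto
  moreover have "inj_on (\<lambda>k. D (vert k)) {1..}"
  proof (rule inj_onI)
    fix k l :: nat assume "k \<in> {1..}" "l \<in> {1..}" "D (vert k) = D (vert l)"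
    then show "k = l"
      using D[of "vert_prime k" "vert k"] D[of "vert_prime k" "vert l"] vert_prime(1)[of k]
        vert_in_vert_prime[of k] by auto
  qed
  ultimately have "finite {1::nat..}"
    using \<F>(1) finite_imageD finite_subset by blast
  then show False
    using infinite_Ici by blast
qed

section \<open>The example\<close>

lemma infinite_image_inj:
  assumes "inj_on f {1::nat..}" "\<And>k. k \<ge> 1 \<Longrightarrow> f k \<in> S"
  shows "infinite S"
proof
  assume "finite S"
  moreover have "f ` {1..} \<subseteq> S"
    using assms(2) by auto
  ultimately have "finite (f ` {1..})"
    by (rule finite_subset[rotated])
  then have "finite {1::nat..}"
    by (rule finite_imageD[OF _ assms(1)])
  then show False
    using infinite_Ici by blast
qed

lemma edge_prime_inject:
  assumes "(edge_prime k :: 'a::field fps fps poly set) = edge_prime l"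
  shows "k = l"
proof -
  have "(vert i :: 'a fps fps poly) \<in> edge_prime k \<longleftrightarrow> (vert i :: 'a fps fps poly) \<in> edge_prime l" for i
    unfolding assms ..
  from this[of k] this[of l] show ?thesis
    unfolding vert_in_edge_prime by auto
qed

text \<open>The order embedding \<open>E\<close> stands for passing from polynomials to cosets in
  the quotient; abstractly, only inclusions between primes matter.\<close>

lemma fiber_components:
  fixes E :: "complex fps fps poly set \<Rightarrow> 'b set"
  assumes "prime_space A PP" and PP: "PP = E ` {P. proj_in P \<and> over_max P}"
    and sub: "\<And>P Q. proj_in P \<Longrightarrow> over_max P \<Longrightarrow> proj_in Q \<Longrightarrow> over_max Q \<Longrightarrow> E P \<subseteq> E Q \<longleftrightarrow> P \<subseteq> Q"
  defines "Y \<equiv> subtopology (zariski A) PP"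
  shows "space_dim Y = 1"
    and "infinite {Z. irreducible_component Y Z \<and> space_dim (subtopology Y Z) = 1}"
proof -
  interpret Y: prime_space A PP
    by (rule assms(1))
  have dim: "chain_dim (E ` F) = chain_dim F" if F: "\<And>P. P \<in> F \<Longrightarrow> proj_in P \<and> over_max P" for F
    by (rule chain_dim_embedding) (use F sub in simp)
  have "chain_dim PP = 1"
    unfolding PP using edge_prime[of 1] vert_prime[of 1]
    by (subst dim) (auto intro!: chain_dim_fiber[of _ 1])
  then show "space_dim Y = 1"
    unfolding Y_def Y.space_dim .
  show "infinite {Z. irreducible_component Y Z \<and> space_dim (subtopology Y Z) = 1}"
  proof (rule infinite_image_inj[where f = "\<lambda>k. {q \<in> PP. E (edge_prime k) \<subseteq> q}"])
    have e: "E (edge_prime k) \<in> PP" if "k \<ge> 1" for k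
      unfolding PP using edge_prime[OF that] by blast
    show "inj_on (\<lambda>k. {q \<in> PP. E (edge_prime k) \<subseteq> q}) {1..}"
    proof (rule inj_onI)
      fix k l :: nat
      assume kl: "k \<in> {1..}" "l \<in> {1..}"
        and eq: "{q \<in> PP. E (edge_prime k) \<subseteq> q} = {q \<in> PP. E (edge_prime l) \<subseteq> q}"
      have "E (edge_prime k) \<subseteq> E (edge_prime l)" "E (edge_prime l) \<subseteq> E (edge_prime k)"
        using eq e[of k] e[of l] kl by auto
      then have "edge_prime k = (edge_prime l :: complex fps fps poly set)"
        using sub[OF edge_prime edge_prime, of k l] sub[OF edge_prime edge_prime, of l k] kl by simp
      then show "k = l"
        by (rule edge_prime_inject)
    qed
    fix k :: nat assume k: "k \<ge> 1"
    let ?F = "{P :: complex fps fps poly set. proj_in P \<and> over_max P \<and> edge_prime k \<subseteq> P}"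
    have "{q \<in> PP. E (edge_prime k) \<subseteq> q} = E ` ?F"
      unfolding PP using sub[OF edge_prime[OF k]] by blast
    moreover have "chain_dim ?F = 1"
      by (rule chain_dim_fiber[OF _ k])
        (use edge_prime[OF k] vert_prime[OF k] edge_prime_less_vert_prime[OF k] in blast)+
    moreover have "chain_dim (E ` ?F) = chain_dim ?F"
      by (rule dim) blast
    ultimately have "space_dim (subtopology Y {q \<in> PP. E (edge_prime k) \<subseteq> q}) = 1"
      unfolding Y_def Y.space_dim_closure[OF e[OF k]] by simp
    moreover have "irreducible_component Y {q \<in> PP. E (edge_prime k) \<subseteq> q}"
      unfolding Y_def
    proof (rule Y.irreducible_component_minimal[OF e[OF k]])
      fix q assume q: "q \<in> PP" "q \<subseteq> E (edge_prime k)"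
      then obtain P where P: "q = E P" "proj_in P" "over_max P"
        unfolding PP by blast
      then have "P \<subseteq> edge_prime k"
        using q(2) sub[OF P(2,3) edge_prime[OF k]] by blast
      then show "q = E (edge_prime k)"
        using minimal_edge_prime[OF k proj_inD(1)[OF P(2)] P(3)] P(1) by simp
    qed
    ultimately show "{q \<in> PP. E (edge_prime k) \<subseteq> q} \<in>
        {Z. irreducible_component Y Z \<and> space_dim (subtopology Y Z) = 1}"
      by blast
  qed
qed

text \<open>Minimality is needed against all primes, homogeneous or not, and
  \<open>minimal_edge_prime\<close> is proved in that generality.\<close>

lemma infinite_minimal_primes:
  fixes K :: "complex fps fps poly set"
  assumes K: "\<And>P. ideal_in rees_poly P \<Longrightarrow> K \<subseteq> P \<longleftrightarrow> over_max P"
  shows "infinite (minimal_primes (rees :: (complex fps fps, nat \<Rightarrow> complex fps fps) up_ring) (coeff ` K))"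
proof (rule infinite_image_inj[where f = "\<lambda>k. coeff ` edge_prime k"])
  show "inj_on (\<lambda>k. coeff ` (edge_prime k :: complex fps fps poly set)) {1..}"
    using edge_prime_inject by (auto simp: inj_on_def inj_image_eq_iff[OF inj_coeff])
  fix k :: nat assume k: "k \<ge> 1"
  note E = edge_prime[OF k]
  show "coeff ` edge_prime k \<in> minimal_primes rees (coeff ` K)"
    unfolding minimal_primes_def
  proof (intro CollectI conjI allI impI)
    show "primeideal (coeff ` edge_prime k) rees"
      unfolding rees.primeideal_image using proj_inD(1)[OF E(1)] .
    show "coeff ` K \<subseteq> coeff ` edge_prime k"
      unfolding inj_image_subset_iff[OF inj_coeff] K[OF proj_inD(2)[OF E(1)]] by (rule E(2))
    fix q assume q: "primeideal q rees \<and> coeff ` K \<subseteq> q \<and> q \<subseteq> coeff ` edge_prime k"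
    then obtain P where P: "prime_in rees_poly P" "q = coeff ` P"
      unfolding rees.primeideal_iff by blast
    have sub: "K \<subseteq> P" "P \<subseteq> edge_prime k"
      using q unfolding P(2) by (simp_all only: inj_image_subset_iff[OF inj_coeff])
    then have "P = edge_prime k"
      using minimal_edge_prime[OF k P(1)] K[OF prime_inD(1)[OF P(1)]] by blast
    then show "q = coeff ` edge_prime k"
      using P(2) by simp
  qed
qed

theorem theorem6p3:
  shows "\<exists>(R :: complex fps fps ring) m I.
    regular_local_ring R m \<and> ring_dim R = 2 \<and>
    graded_filtration R I \<and> (\<forall>n>0. primary_to R m (I n)) \<and>
    (let S = rees_algebra R I; G = rees_grading R I;
         J = rees_extension R I m;
         X = proj_scheme S G;
         Y = proj_scheme (S Quot J) (quotient_grading S G J)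
     in infinite (minimal_primes S J) \<and>
        space_dim (pts Y) = 1 \<and>
        infinite {Z. irreducible_component (pts Y) Z \<and> space_dim (subtopology (pts Y) Z) = 1} \<and>
        space_dim (pts X) = 2 \<and>
        \<not> noetherian_scheme X)"
proof -
  let ?R = "type_ring :: complex fps fps ring"
  let ?S = "rees :: (complex fps fps, nat \<Rightarrow> complex fps fps) up_ring"
  let ?J = "rees_extension ?R filt max_ideal"
  let ?PP = "proj_points (?S Quot ?J) (quotient_grading ?S rees_gr ?J)"
  obtain K :: "complex fps fps poly set" where K: "?J = coeff ` K"
    and sub_iff: "\<And>P. ideal_in rees_poly P \<Longrightarrow> K \<subseteq> P \<longleftrightarrow> (\<forall>a\<in>max_ideal. monom a 0 \<in> P)"
    and hom: "homogeneous_ideal ?S rees_gr (coeff ` K)"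
    by (rule rees_extension_max_ideal) (rule that)
  note sub_iff = sub_iff[folded over_max_def]
  interpret Q: graded_quotient ?S rees_gr ?J
    by (rule graded_quotient.intro) (simp_all only: K hom rees.cring rees_gr_subset)
  interpret X: prime_space ?S "proj_points ?S rees_gr"
    by (rule prime_space_rees)
  have pts: "pts (proj_scheme A G) = subtopology (zariski A) (proj_points A G)"
    for A :: "('x, 'y) ring_scheme" and G
    by (simp add: proj_scheme_def fraction_space_def)
  have mem: "coeff ` P \<in> proj_points ?S rees_gr" "?J \<subseteq> coeff ` P" if "proj_in P" "over_max P" for P
    using that sub_iff[OF proj_inD(2)[OF that(1)]]
    by (simp_all only: proj_points_image K inj_image_subset_iff[OF inj_coeff])
  define E where "E = (\<lambda>P. Q.\<pi> ` coeff ` P)"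
  have PP: "?PP = E ` {P. proj_in P \<and> over_max P}"
  proof (intro equalityI subsetI)
    fix p assume "p \<in> ?PP"
    then obtain p' where p': "p' \<in> proj_points ?S rees_gr" "?J \<subseteq> p'" "p = Q.\<pi> ` p'"
      unfolding Q.proj_points_image_iff by (elim bexE conjE)
    then obtain P where P: "p' = coeff ` P" "proj_in P"
      unfolding proj_points_rees by (elim imageE CollectE)
    have "over_max P"
      using p'(2) sub_iff[OF proj_inD(2)[OF P(2)]]
      by (simp only: P(1) K inj_image_subset_iff[OF inj_coeff])
    then show "p \<in> E ` {P. proj_in P \<and> over_max P}"
      using P p'(3) by (intro image_eqI[of _ _ P]) (simp_all add: E_def)
  next
    fix p assume "p \<in> E ` {P. proj_in P \<and> over_max P}"
    then obtain P where P: "p = E P" "proj_in P" "over_max P"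
      by blast
    then show "p \<in> ?PP"
      unfolding E_def using Q.image_proj_points[OF mem[OF P(2,3)]] by (simp only:)
  qed
  have sub: "E P \<subseteq> E P' \<longleftrightarrow> P \<subseteq> P'"
    if "proj_in P" "over_max P" "proj_in P'" "over_max P'" for P P'
    unfolding E_def Q.image_subset_iff[OF mem[OF that(1,2)] mem[OF that(3,4)]]
      inj_image_subset_iff[OF inj_coeff] ..
  note Y = fiber_components[OF Q.prime_space_quotient[OF prime_space_rees] PP sub]
  have min: "infinite (minimal_primes ?S ?J)"
    unfolding K using sub_iff by (rule infinite_minimal_primes)
  have dimX: "space_dim X.X = 2"
    unfolding X.space_dim unfolding proj_points_rees
    by (subst chain_dim_embedding) (simp_all add: inj_image_subset_iff[OF inj_coeff] chain_dim_proj)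
  \<comment> \<open>A Noetherian scheme is quasi-compact by definition, and this is what
    fails.\<close>
  have "\<not> noetherian_scheme (proj_scheme ?S rees_gr)"
    by (simp add: noetherian_scheme_def pts not_compact_proj_rees)
  with min Y dimX have "infinite (minimal_primes ?S ?J) \<and>
      space_dim (pts (proj_scheme (?S Quot ?J) (quotient_grading ?S rees_gr ?J))) = 1 \<and>
      infinite {Z. irreducible_component (pts (proj_scheme (?S Quot ?J) (quotient_grading ?S rees_gr ?J))) Z \<and>
        space_dim (subtopology (pts (proj_scheme (?S Quot ?J) (quotient_grading ?S rees_gr ?J))) Z) = 1} \<and>
      space_dim (pts (proj_scheme ?S rees_gr)) = 2 \<and> \<not> noetherian_scheme (proj_scheme ?S rees_gr)"
    by (simp only: pts simp_thms)
  moreover have "\<forall>n>0. primary_to ?R max_ideal (filt n)"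
    using primary_filt by blast
  ultimately show ?thesis
    using regular_local_power_series ring_dim_power_series graded_filtration_filt
    unfolding Let_def
    by (intro exI[of _ ?R] exI[of _ max_ideal] exI[of _ filt] conjI) simp_all
qed

end
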